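(* Let $n\ge 1$, $m\ge 0$, and let $\Omega\subseteq\mathbb C^{n+m}$ be a domain (not necessarily bounded) which is $n$-star-shaped Hartogs in the first $n$ variables $z=(z_1,\dots,z_n)$; write points of $\mathbb C^{n+m}$ as $(z,z')$ with $z'\in\mathbb C^m$. Let $\alpha=(\alpha_1,\dots,\alpha_n)$ with all $\alpha_j>0$, and put $$U^{\alpha}=\big\{(z,z',w)\in\mathbb C^{n+m}\times\mathbb C:\ (f_\alpha(z,w),z')\in\Omega,\ |w|<1\big\},\qquad f_\alpha(z,w)=\Big(\frac{z_1}{(1-|w|^2)^{\alpha_1/2}},\dots,\frac{z_n}{(1-|w|^2)^{\alpha_n/2}}\Big).$$ For $|\eta|<1$ let $U^\alpha_\eta=\{(z,z')\in\mathbb C^{n+m}:(z,z',\eta)\in U^\alpha\}$, with Bergman kernel $K_{U^\alpha_\eta}$. Define $$h(z,w,\eta)=\Big(z_1\Big(\frac{1-|\eta|^2}{1-w\bar\eta}\Big)^{\alpha_1},\dots,z_n\Big(\frac{1-|\eta|^2}{1-w\bar\eta}\Big)^{\alpha_n}\Big)$$ and the operator (acting on functions of $(z,z',w)$) $$D_{U^\alpha}=\frac{(1-|\eta|^2)^{\alpha\cdot\mathbf 1}}{\pi(1-w\bar\eta)^{2+\alpha\cdot\mathbf 1}}\Big(I+\sum_{j=1}^n\alpha_j\Big(I+z_j\frac{\partial}{\partial z_j}\Big)\Big),$$ where $I$ is the identity and $\alpha\cdot\mathbf 1=\sum_j\alpha_j$. Then for all $(z,z',w;\zeta,\zeta',\eta)\in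 U^\alpha\times U^\alpha$, the Bergman kernel of $U^\alpha$ is $$K_{U^\alpha}(z,z',w;\bar\zeta,\bar\zeta',\bar\eta)=D_{U^\alpha}\Big[K_{U^\alpha_\eta}\big(h(z,w,\eta),z';\bar\zeta,\bar\zeta'\big)\Big].$$
   Context: A domain $\Omega\subseteq\mathbb C^{n+m}$ is called $n$-star-shaped Hartogs in $(z_1,\dots,z_n)$ if $(z_1,\dots,z_n,\zeta)\in\Omega$ implies $(\lambda_1z_1,\dots,\lambda_nz_n,\zeta)\in\Omega$ for all $\lambda_j\in\mathbb C$ with $|\lambda_j|\le1$. The Bergman kernel $K_D(z;\bar\zeta)$ of a domain $D$ is the reproducing kernel of the space $A^2(D)$ of square-integrable holomorphic functions on $D$. Powers of $1-w\bar\eta$ (which has positive real part) are taken with the principal branch. In the formula, the differential operator acts on the function $(z,z',w)\mapsto K_{U^\alpha_\eta}(h(z,w,\eta),z';\bar\zeta,\bar\zeta')$, with $\partial/\partial z_j$ differentiating in the variable $z_j$. *)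

theory Defs
  imports "HOL-Analysis.Analysis"
begin

definition holo_on :: "(complex ^ 'i::finite \<Rightarrow> complex) \<Rightarrow> (complex ^ 'i) set \<Rightarrow> bool" where
  "holo_on f D \<longleftrightarrow> (\<forall>x\<in>D. \<exists>L. (f has_derivative L) (at x) \<and> (\<forall>c v. L (c *s v) = c * L v))"

definition A2 :: "(complex ^ 'i::finite) set \<Rightarrow> (complex ^ 'i \<Rightarrow> complex) set" where
  "A2 D = {f. holo_on f D \<and> (\<lambda>x. (cmod (f x))\<^sup>2) integrable_on D}"

text \<open>K x zeta stands for the Bergman kernel at (x, conj zeta); it is normalised to be 0 off D x D.\<close>
definition is_bergman_kernel :: "(complex ^ 'i::finite) set \<Rightarrow> (complex ^ 'i \<Rightarrow> complex ^ 'i \<Rightarrow> complex) \<Rightarrow> bool" where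
  "is_bergman_kernel D K \<longleftrightarrow>
     (\<forall>\<zeta>\<in>D. (\<lambda>x. K x \<zeta>) \<in> A2 D) \<and>
     (\<forall>f\<in>A2 D. \<forall>\<zeta>\<in>D. f \<zeta> = integral D (\<lambda>x. f x * cnj (K x \<zeta>))) \<and>
     (\<forall>x \<zeta>. x \<notin> D \<or> \<zeta> \<notin> D \<longrightarrow> K x \<zeta> = 0)"

definition bergman_kernel :: "(complex ^ 'i::finite) set \<Rightarrow> complex ^ 'i \<Rightarrow> complex ^ 'i \<Rightarrow> complex" where
  "bergman_kernel D = (THE K. is_bergman_kernel D K)"

definition cpartial :: "'i::finite \<Rightarrow> (complex ^ 'i \<Rightarrow> complex) \<Rightarrow> complex ^ 'i \<Rightarrow> complex" where
  "cpartial j G x = deriv (\<lambda>t. G (\<chi> i. if i = j then t else x $ i)) (x $ j)"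

text \<open>Coordinates of \<open>\<complex>^{n+m}\<close> are indexed by the finite type \<open>'n\<close>; the set \<open>J\<close>
  indexes the \<open>z\<close>-variables, its complement the \<open>z'\<close>-variables.\<close>
definition star_hartogs :: "'n::finite set \<Rightarrow> (complex ^ 'n) set \<Rightarrow> bool" where
  "star_hartogs J \<Omega> \<longleftrightarrow> (\<forall>x\<in>\<Omega>. \<forall>l::'n \<Rightarrow> complex. (\<forall>j\<in>J. cmod (l j) \<le> 1) \<longrightarrow>
       (\<chi> i. if i \<in> J then l i * x $ i else x $ i) \<in> \<Omega>)"

definition ext_pt :: "complex ^ 'n::finite \<Rightarrow> complex \<Rightarrow> complex ^ ('n option)" where
  "ext_pt x w = (\<chi> i. case i of None \<Rightarrow> w | Some j \<Rightarrow> x $ j)"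

definition f_alpha :: "'n::finite set \<Rightarrow> ('n \<Rightarrow> real) \<Rightarrow> complex ^ 'n \<Rightarrow> complex \<Rightarrow> complex ^ 'n" where
  "f_alpha J \<alpha> x w = (\<chi> i. if i \<in> J then x $ i / complex_of_real ((1 - (cmod w)\<^sup>2) powr (\<alpha> i / 2)) else x $ i)"

definition U_alpha :: "'n::finite set \<Rightarrow> ('n \<Rightarrow> real) \<Rightarrow> (complex ^ 'n) set \<Rightarrow> (complex ^ ('n option)) set" where
  "U_alpha J \<alpha> \<Omega> = {ext_pt x w | x w. f_alpha J \<alpha> x w \<in> \<Omega> \<and> cmod w < 1}"

definition U_alpha_eta :: "'n::finite set \<Rightarrow> ('n \<Rightarrow> real) \<Rightarrow> (complex ^ 'n) set \<Rightarrow> complex \<Rightarrow> (complex ^ 'n) set" where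
  "U_alpha_eta J \<alpha> \<Omega> \<eta> = {x. ext_pt x \<eta> \<in> U_alpha J \<alpha> \<Omega>}"

definition h_map :: "'n::finite set \<Rightarrow> ('n \<Rightarrow> real) \<Rightarrow> complex ^ 'n \<Rightarrow> complex \<Rightarrow> complex \<Rightarrow> complex ^ 'n" where
  "h_map J \<alpha> x w \<eta> = (\<chi> i. if i \<in> J then
       x $ i * ((complex_of_real (1 - (cmod \<eta>)\<^sup>2) / (1 - w * cnj \<eta>)) powr complex_of_real (\<alpha> i))
     else x $ i)"

end

theory Submission
  imports Defs "HOL-Complex_Analysis.Cauchy_Integral_Formula"
begin

text \<open>
  An automorphism of the disc moving \<open>0\<close> to \<open>\<eta>\<close> lifts to a biholomorphic map onto \<open>U\<^sup>\<alpha>\<close> from the same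
  construction over the slice \<open>V = U\<^sup>\<alpha>\<^sub>\<eta>\<close>, which reduces the formula to the base point \<open>(\<zeta>, 0)\<close>. There, with \<open>A = \<alpha>\<cdot>1\<close>, the
  kernel is \<open>\<kappa> / \<pi>\<close>, independent of \<open>w\<close>, where \<open>\<kappa> \<in> A\<^sup>2(V)\<close> represents the functional
  \<open>g \<mapsto> (D g)(\<zeta>)\<close>, \<open>D = 1 + A + \<Sum> \<alpha>\<^sub>j z\<^sub>j \<partial>\<^sub>j\<close>. Indeed, averaging over rotations of \<open>w\<close> replaces
  \<open>f\<close> by \<open>g(z) = f(z, 0)\<close>; the slice at \<open>w\<close> is the dilation of \<open>V\<close> by \<open>s\<^sup>\<alpha>\<^sup>/\<^sup>2\<close>, \<open>s = 1 - |w|\<^sup>2\<close>, and as dilations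
  are self-adjoint on \<open>A\<^sup>2(V)\<close> it contributes \<open>s\<^sup>A (D g)(s\<^sup>\<alpha> \<zeta>)\<close>, the derivative of \<open>s\<^sup>1\<^sup>+\<^sup>A g(s\<^sup>\<alpha> \<zeta>)\<close>,
  so that the integral over \<open>0 < s < 1\<close> is \<open>g(\<zeta>)\<close>. Differentiating \<open>K\<^sub>V(s\<^sup>\<alpha> z, \<zeta>) = K\<^sub>V(z, s\<^sup>\<alpha> \<zeta>)\<close>, again
  self-adjointness, at \<open>s = 1\<close> identifies \<open>\<kappa>\<close> with \<open>D K\<^sub>V(\<cdot>, \<zeta>)\<close>.
\<close>

section \<open>Change of variables for Lebesgue measure\<close>

text \<open>Integrability is the obstacle: \<open>g = f(., 0)\<close> need not lie in
  \<open>A2 V\<close>. For \<open>V\<close> the unit disc, \<open>f = 1 / (1 - z)\<close> is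
  square-integrable over the Hartogs domain but not over \<open>V\<close>. Averaging
  \<open>f * f\<close> besides \<open>f\<close> shows that \<open>|g|^2\<close> is integrable over
  the whole domain, so that for almost every \<open>w\<close> the function \<open>g\<close> composed
  with the dilation by \<open>s^(\<alpha>/2)\<close> is in \<open>A2 V\<close>. Self-adjointness and
  the functional of \<kappa> are applied only to such dilated copies. Dilations are self-adjoint
  because a rotation of one coordinate preserves \<open>V\<close> and the measure, so that its
  adjoint is the inverse rotation, and Cauchy's formula makes a dilation an average of rotations.
  The prefactor is the transformation law of Bergman kernels. Put \<open>a = 1 - |\<eta>|^2\<close>,
  \<open>q = 1 + cnj \<eta> * v\<close> and \<open>w = (v + \<eta>) / q\<close>. The lift multiplies
  \<open>z_j\<close> by \<open>q^(-\<alpha>_j)\<close> and has complex Jacobian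
  \<open>J = a q^(-(2 + A))\<close>, equal to \<open>a\<close> at the centre. Since
  \<open>1 - w cnj \<eta> = a / q\<close>, the factor \<open>1 / (pi a J)\<close> is
  \<open>a^A / (pi (1 - w cnj \<eta>)^(2 + A))\<close>.\<close>

definition complex_of_vec2 :: "real^2 \<Rightarrow> complex" where
  "complex_of_vec2 v = Complex (v $ 1) (v $ 2)"

definition vec2_of_complex :: "complex \<Rightarrow> real^2" where
  "vec2_of_complex z = vector [Re z, Im z]"

lemma complex_of_vec2_inverse [simp]: "vec2_of_complex (complex_of_vec2 v) = v"
  by (simp add: complex_of_vec2_def vec2_of_complex_def vec_eq_iff forall_2)

lemma vec2_of_complex_inverse [simp]: "complex_of_vec2 (vec2_of_complex z) = z"
  by (simp add: complex_of_vec2_def vec2_of_complex_def)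

lemma bounded_linear_complex_of_vec2: "bounded_linear complex_of_vec2"
  unfolding complex_of_vec2_def
  by (intro linear_conv_bounded_linear[THEN iffD1] linearI) (auto simp: complex_eq_iff)

lemma bounded_linear_vec2_of_complex: "bounded_linear vec2_of_complex"
  unfolding vec2_of_complex_def
  by (intro linear_conv_bounded_linear[THEN iffD1] linearI) (auto simp: vec_eq_iff forall_2)

lemma borel_measurable_complex_of_vec2 [measurable]: "complex_of_vec2 \<in> borel_measurable borel"
  by (intro borel_measurable_continuous_onI linear_continuous_on bounded_linear_complex_of_vec2)

lemma borel_measurable_vec2_of_complex [measurable]: "vec2_of_complex \<in> borel_measurable borel"
  by (intro borel_measurable_continuous_onI linear_continuous_on bounded_linear_vec2_of_complex)

lemma distr_complex_of_vec2: "distr lborel borel complex_of_vec2 = lborel"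
proof (rule lborel_eqI[symmetric])
  fix l u :: complex
  assume le: "\<And>b. b \<in> Basis \<Longrightarrow> l \<bullet> b \<le> u \<bullet> b"
  have le': "Re l \<le> Re u" "Im l \<le> Im u"
    using le[of 1] le[of \<i>] by (auto simp: Basis_complex_def inner_complex_def)
  have eq: "complex_of_vec2 -` box l u = box (vec2_of_complex l) (vec2_of_complex u)"
    by (auto simp: box_complex_eq mem_box_cart forall_2 complex_of_vec2_def vec2_of_complex_def in_box_complex_iff)
  have "emeasure (distr lborel borel complex_of_vec2) (box l u) = emeasure lborel (box (vec2_of_complex l) (vec2_of_complex u))"
    by (subst emeasure_distr) (auto simp: eq)
  also have "\<dots> = (\<Prod>b\<in>Basis. (vec2_of_complex u - vec2_of_complex l) \<bullet> b)"
    by (subst emeasure_lborel_box)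
       (use le' in \<open>auto simp: Basis_vec_def inner_axis forall_2 vec2_of_complex_def UNIV_2\<close>)
  also have "(\<Prod>b\<in>(Basis::(real^2) set). (vec2_of_complex u - vec2_of_complex l) \<bullet> b) = (\<Prod>b\<in>Basis. (u - l) \<bullet> b)"
    by (simp add: Basis_vec_def Basis_complex_def UNIV_2 axis_eq_axis inner_axis vec2_of_complex_def inner_complex_def)
  finally show "emeasure (distr lborel borel complex_of_vec2) (box l u) = (\<Prod>b\<in>Basis. (u - l) \<bullet> b)" .
qed auto

text \<open>Multiplication by \<open>\<phi>' z\<close>, seen as a real 2x2 matrix, has determinant
  \<open>|\<phi>' z|^2\<close>. The map is carried over to \<open>real^2\<close>, where the measure
  of an injective image is the integral of the absolute determinant.\<close>

lemma emeasure_holomorphic_image: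
  fixes \<phi> :: "complex \<Rightarrow> complex"
  assumes S: "open S" and der: "\<And>z. z \<in> S \<Longrightarrow> (\<phi> has_field_derivative \<phi>' z) (at z)"
    and inj: "inj_on \<phi> S" and A: "A \<in> sets borel" "A \<subseteq> \<phi> ` S" and fin: "emeasure lborel A < \<infinity>"
    and \<phi>': "\<phi>' \<in> borel_measurable borel" and \<phi>m: "\<phi> \<in> borel_measurable borel"
  shows "emeasure lborel A = (\<integral>\<^sup>+z. indicator S z * indicator A (\<phi> z) * ennreal ((cmod (\<phi>' z))\<^sup>2) \<partial>lborel)"
proof -
  let ?c = complex_of_vec2 and ?v = vec2_of_complex
  define T where "T = ?v ` S"
  have T_eq: "T = ?c -` S"
    by (auto simp: T_def) (metis complex_of_vec2_inverse image_eqI)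
  have openT: "open T"
    unfolding T_eq by (intro open_vimage S linear_continuous_on bounded_linear_complex_of_vec2)
  define g where "g = (\<lambda>x. ?v (\<phi> (?c x)))"
  define g' where "g' = (\<lambda>x h. ?v (\<phi>' (?c x) * ?c h))"
  have gder: "(g has_derivative g' x) (at x within T)" if "x \<in> T" for x
  proof -
    have "(\<phi> has_derivative (*) (\<phi>' (?c x))) (at (?c x))"
      using der[of "?c x"] that by (auto simp: T_eq has_field_derivative_def)
    then have "((\<lambda>x. \<phi> (?c x)) has_derivative (\<lambda>h. \<phi>' (?c x) * ?c h)) (at x within T)"
      by (rule has_derivative_compose[OF bounded_linear_imp_has_derivative[OF bounded_linear_complex_of_vec2]])
    then show ?thesis unfolding g_def g'_def
      by (rule bounded_linear.has_derivative[OF bounded_linear_vec2_of_complex])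
  qed
  have det: "\<bar>det (matrix (g' x))\<bar> = (cmod (\<phi>' (?c x)))\<^sup>2" for x
    by (simp add: det_2 matrix_def g'_def vec2_of_complex_def complex_of_vec2_def axis_def cmod_power2 flip: power2_eq_square)
  have injg: "inj_on g T"
    using inj unfolding g_def T_def inj_on_def by (auto dest!: arg_cong[where f = "?c"])
  have gT: "g ` T = ?v ` \<phi> ` S"
    by (auto simp: g_def T_def image_image)
  define B where "B = ?c -` A"
  have Bsets: "B \<in> sets borel" unfolding B_def using A(1) measurable_sets_borel[OF borel_measurable_complex_of_vec2] by simp
  have eB: "emeasure lborel B = emeasure lborel A"
    using emeasure_distr[of ?c lborel borel A] A(1) by (simp add: distr_complex_of_vec2 B_def)
  have BgT: "B \<subseteq> g ` T"
  proof
    fix x assume "x \<in> B"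
    then obtain s where "s \<in> S" "?c x = \<phi> s" using A(2) by (auto simp: B_def)
    then have "x = ?v (\<phi> s)" by (metis complex_of_vec2_inverse)
    then show "x \<in> g ` T" using \<open>s \<in> S\<close> unfolding gT by blast
  qed
  have finB: "emeasure lborel B < \<infinity>" using eB fin by simp
  have [measurable]: "\<phi> \<in> borel_measurable borel" "\<phi>' \<in> borel_measurable borel" "A \<in> sets borel" "S \<in> sets borel"
    using \<phi>m \<phi>' A S by auto
  define R where "R = T \<inter> g -` B"
  have gB: "g ` R = B"
    using BgT by (auto simp: R_def)
  have gm [measurable]: "g \<in> borel_measurable borel"
    unfolding g_def using \<phi>m by measurable
  have Rsets [measurable]: "R \<in> sets borel"
    unfolding R_def using openT Bsets measurable_sets_borel[OF gm Bsets] by auto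
  have B: "B \<in> lmeasurable" using Bsets finB by (auto simp: fmeasurable_def)
  have "(g has_derivative g' x) (at x within R)" if "x \<in> R" for x
    using gder[of x] that by (auto simp: R_def intro: has_derivative_subset)
  moreover have "inj_on g R" using injg by (auto simp: R_def inj_on_def)
  ultimately have hi: "((\<lambda>x. \<bar>det (matrix (g' x))\<bar>) has_integral measure lebesgue B) R"
    using has_measure_differentiable_image[of R g g' "measure lebesgue B"] Rsets B unfolding gB by auto
  have "((\<lambda>x. indicator R x * (cmod (\<phi>' (?c x)))\<^sup>2) has_integral measure lebesgue B) UNIV"
    using hi unfolding det by (subst (asm) has_integral_restrict_UNIV[symmetric])
      (erule has_integral_cong[THEN iffD1, rotated], auto simp: indicator_def)
  then have "(\<integral>\<^sup>+x. ennreal (indicator R x * (cmod (\<phi>' (?c x)))\<^sup>2) \<partial>lborel) = ennreal (measure lebesgue B)"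
    by (intro nn_integral_has_integral_lborel) auto
  also have "ennreal (measure lebesgue B) = emeasure lborel B"
    using Bsets finB by (simp add: emeasure_eq_ennreal_measure top.not_eq_extremum)
  finally have "emeasure lborel A = (\<integral>\<^sup>+x. ennreal (indicator R x * (cmod (\<phi>' (?c x)))\<^sup>2) \<partial>lborel)"
    using eB by simp
  also have "\<dots> = (\<integral>\<^sup>+x. indicator S (?c x) * indicator A (\<phi> (?c x)) * ennreal ((cmod (\<phi>' (?c x)))\<^sup>2) \<partial>lborel)"
    by (intro nn_integral_cong) (auto simp: R_def T_eq B_def g_def indicator_def)
  also have "\<dots> = (\<integral>\<^sup>+z. indicator S z * indicator A (\<phi> z) * ennreal ((cmod (\<phi>' z))\<^sup>2) \<partial>(distr lborel borel ?c))"
    by (rule nn_integral_distr[symmetric]) auto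
  finally show ?thesis by (simp add: distr_complex_of_vec2)
qed

lemma emeasure_lborel_mult_vimage:
  fixes c :: complex
  assumes c: "c \<noteq> 0" and A: "A \<in> sets borel" "emeasure lborel A < \<infinity>"
  shows "emeasure lborel A = ennreal ((cmod c)\<^sup>2) * emeasure lborel ((*) c -` A)"
proof -
  have [measurable]: "(*) c -` A \<in> sets borel"
    using measurable_sets_borel[of "(*) c" borel A] A by simp
  have surj: "A \<subseteq> (*) c ` UNIV"
    using c by (auto simp: image_iff intro!: exI[of _ "_ / c"])
  have "emeasure lborel A = (\<integral>\<^sup>+z. indicator UNIV z * indicator A (c * z) * ennreal ((cmod c)\<^sup>2) \<partial>lborel)"
    by (rule emeasure_holomorphic_image[where \<phi>'="\<lambda>_. c"]) (use c A surj in \<open>auto intro!: derivative_eq_intros injI\<close>)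
  also have "\<dots> = (\<integral>\<^sup>+z. ennreal ((cmod c)\<^sup>2) * indicator ((*) c -` A) z \<partial>lborel)"
    by (intro nn_integral_cong) (auto simp: indicator_def)
  also have "\<dots> = ennreal ((cmod c)\<^sup>2) * emeasure lborel ((*) c -` A)"
    by (subst nn_integral_cmult) auto
  finally show ?thesis .
qed

section \<open>Lebesgue measure of complex space, coordinate by coordinate\<close>

text \<open>Boxes determine Lebesgue measure, and a box in \<open>complex^'i\<close> is a product of
  planar boxes. Planar changes of variables can then be made in each coordinate separately.\<close>

lemma lborel_vec_eq_distr_PiM:
  "(lborel :: (complex^'i::finite) measure) = distr (\<Pi>\<^sub>M i\<in>UNIV. lborel) borel vec_lambda"
proof (rule lborel_eqI)
  interpret product_sigma_finite "\<lambda>_::'i. lborel :: complex measure" ..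
  have meas [measurable]: "vec_lambda \<in> borel_measurable (\<Pi>\<^sub>M i\<in>(UNIV::'i set). (lborel :: complex measure))"
    by (subst borel_measurable_euclidean_space) (auto simp: Basis_vec_def inner_axis)
  fix l u :: "complex^'i"
  assume le: "\<And>b. b \<in> Basis \<Longrightarrow> l \<bullet> b \<le> u \<bullet> b"
  have le': "l $ i \<bullet> b \<le> u $ i \<bullet> b" if "b \<in> Basis" for i b
    using le[of "axis i b"] that by (auto simp: Basis_vec_def inner_axis)
  have eq: "vec_lambda -` box l u = (\<Pi>\<^sub>E i\<in>UNIV. box (l $ i) (u $ i))"
    by (auto simp: mem_box Basis_vec_def inner_axis PiE_def Pi_def)
  have "emeasure (distr (\<Pi>\<^sub>M i\<in>UNIV. lborel) borel vec_lambda) (box l u) =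
     emeasure (\<Pi>\<^sub>M i\<in>(UNIV::'i set). lborel) (\<Pi>\<^sub>E i\<in>UNIV. box (l $ i) (u $ i))"
    by (subst emeasure_distr) (auto simp: eq space_PiM)
  also have "\<dots> = (\<Prod>i\<in>UNIV. emeasure lborel (box (l $ i) (u $ i)))"
    by (rule emeasure_PiM) auto
  also have "\<dots> = (\<Prod>i\<in>UNIV. ennreal (\<Prod>b\<in>Basis. (u $ i - l $ i) \<bullet> b))"
    using le' by (intro prod.cong refl) (subst emeasure_lborel_box, auto)
  also have "\<dots> = ennreal (\<Prod>i\<in>UNIV. \<Prod>b\<in>Basis. (u $ i - l $ i) \<bullet> b)"
    using le' by (intro prod_ennreal prod_nonneg) (auto simp: inner_diff_left)
  also have "(\<Prod>i\<in>UNIV. \<Prod>b\<in>Basis. (u $ i - l $ i) \<bullet> b) = (\<Prod>b\<in>Basis. (u - l) \<bullet> b)"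
  proof -
    have B: "(Basis :: (complex^'i) set) = (\<lambda>(i, b). axis i b) ` (UNIV \<times> Basis)"
      by (auto simp: Basis_vec_def)
    have inj: "inj_on (\<lambda>(i, b). axis i b) (UNIV \<times> (Basis :: complex set))"
      by (auto simp: inj_on_def axis_eq_axis)
    have "(\<Prod>b\<in>Basis. (u - l) \<bullet> b) = (\<Prod>(i,b)\<in>UNIV \<times> Basis. (u $ i - l $ i) \<bullet> b)"
      unfolding B by (subst prod.reindex[OF inj]) (auto intro!: prod.cong simp: inner_axis)
    then show ?thesis by (simp add: prod.cartesian_product)
  qed
  finally show "emeasure (distr (\<Pi>\<^sub>M i\<in>UNIV. lborel) borel vec_lambda) (box l u) = (\<Prod>b\<in>Basis. (u - l) \<bullet> b)" .
qed auto


lemma emeasure_lborel_vec_Pi: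
  fixes A :: "'i::finite \<Rightarrow> complex set"
  assumes A [measurable]: "\<And>i. A i \<in> sets borel"
  shows "emeasure lborel {x::complex^'i. \<forall>i. x $ i \<in> A i} = (\<Prod>i\<in>UNIV. emeasure lborel (A i))"
proof -
  interpret product_sigma_finite "\<lambda>_::'i. lborel :: complex measure" ..
  have meas [measurable]: "vec_lambda \<in> borel_measurable (\<Pi>\<^sub>M i\<in>(UNIV::'i set). (lborel :: complex measure))"
    by (subst borel_measurable_euclidean_space) (auto simp: Basis_vec_def inner_axis)
  have nth [measurable]: "(\<lambda>x::complex^'i. x $ i) \<in> borel_measurable borel" for i
    by (intro borel_measurable_continuous_onI continuous_intros)
  have S: "{x::complex^'i. \<forall>i. x $ i \<in> A i} \<in> sets borel"
    by measurable
  have eq: "vec_lambda -` {x. \<forall>i. x $ i \<in> A i} = (\<Pi>\<^sub>E i\<in>UNIV. A i)"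
    by (auto simp: PiE_def Pi_def)
  have "emeasure lborel {x::complex^'i. \<forall>i. x $ i \<in> A i} = emeasure (\<Pi>\<^sub>M i\<in>(UNIV::'i set). lborel) (\<Pi>\<^sub>E i\<in>UNIV. A i)"
    unfolding lborel_vec_eq_distr_PiM using S by (subst emeasure_distr) (auto simp: eq[simplified] space_PiM)
  also have "\<dots> = (\<Prod>i\<in>UNIV. emeasure lborel (A i))"
    by (rule emeasure_PiM) auto
  finally show ?thesis .
qed

definition diag_scale :: "('i \<Rightarrow> complex) \<Rightarrow> complex^'i::finite \<Rightarrow> complex^'i" where
  "diag_scale c x = (\<chi> i. c i * x $ i)"

lemma diag_scale_nth [simp]: "diag_scale c x $ i = c i * x $ i"
  by (simp add: diag_scale_def)

lemma bounded_linear_diag_scale: "bounded_linear (diag_scale c)"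
  by (intro linear_conv_bounded_linear[THEN iffD1] linearI) (auto simp: vec_eq_iff algebra_simps)

lemma borel_measurable_diag_scale [measurable]: "diag_scale c \<in> borel_measurable borel"
  by (intro borel_measurable_continuous_onI linear_continuous_on bounded_linear_diag_scale)

text \<open>Each complex coordinate contributes the real Jacobian \<open>|c i|^2\<close>. Stated as
  an equality of measures, it serves both the nonnegative and the Bochner integral.\<close>

lemma lborel_diag_scale:
  fixes c :: "'i::finite \<Rightarrow> complex"
  assumes c: "\<And>i. c i \<noteq> 0"
  shows "(lborel :: (complex^'i) measure) = density (distr lborel borel (diag_scale c)) (\<lambda>_. ennreal (\<Prod>i\<in>UNIV. (cmod (c i))\<^sup>2))"
proof (rule lborel_eqI)
  fix l u :: "complex^'i"
  assume le: "\<And>b. b \<in> Basis \<Longrightarrow> l \<bullet> b \<le> u \<bullet> b"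
  have eq: "diag_scale c -` box l u = {x. \<forall>i. x $ i \<in> (*) (c i) -` box (l $ i) (u $ i)}"
    by (auto simp: mem_box Basis_vec_def inner_axis)
  have box: "box l u = {x. \<forall>i. x $ i \<in> box (l $ i) (u $ i)}"
    by (auto simp: mem_box Basis_vec_def inner_axis)
  have sets: "(*) (c i) -` box (l $ i) (u $ i) \<in> sets borel" for i
    using measurable_sets_borel[of "(*) (c i)" borel "box (l $ i) (u $ i)"] by simp
  have "emeasure (density (distr lborel borel (diag_scale c)) (\<lambda>_. ennreal (\<Prod>i\<in>UNIV. (cmod (c i))\<^sup>2))) (box l u)
     = ennreal (\<Prod>i\<in>UNIV. (cmod (c i))\<^sup>2) * emeasure lborel (diag_scale c -` box l u)"
    by (simp add: emeasure_density nn_integral_cmult emeasure_distr)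
  also have "\<dots> = (\<Prod>i\<in>UNIV. ennreal ((cmod (c i))\<^sup>2)) * (\<Prod>i\<in>UNIV. emeasure lborel ((*) (c i) -` box (l $ i) (u $ i)))"
    unfolding eq by (subst emeasure_lborel_vec_Pi[OF sets], subst prod_ennreal) auto
  also have "\<dots> = (\<Prod>i\<in>UNIV. emeasure lborel (box (l $ i) (u $ i)))"
    unfolding prod.distrib[symmetric]
    by (intro prod.cong refl emeasure_lborel_mult_vimage[symmetric] c) (auto simp: emeasure_lborel_box_finite[unfolded infinity_ennreal_def])
  also have "\<dots> = emeasure lborel (box l u)"
    unfolding box by (rule emeasure_lborel_vec_Pi[symmetric]) auto
  also have "\<dots> = (\<Prod>b\<in>Basis. (u - l) \<bullet> b)"
    using le by (intro emeasure_lborel_box)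
  finally show "emeasure (density (distr lborel borel (diag_scale c)) (\<lambda>_. ennreal (\<Prod>i\<in>UNIV. (cmod (c i))\<^sup>2))) (box l u)
    = (\<Prod>b\<in>Basis. (u - l) \<bullet> b)" .
qed auto

lemma nn_integral_diag_scale:
  fixes c :: "'i::finite \<Rightarrow> complex"
  assumes c: "\<And>i. c i \<noteq> 0" and F [measurable]: "F \<in> borel_measurable borel"
  shows "(\<integral>\<^sup>+x. F x \<partial>lborel) = ennreal (\<Prod>i\<in>UNIV. (cmod (c i))\<^sup>2) * (\<integral>\<^sup>+x. F (diag_scale c x) \<partial>lborel)"
  by (subst lborel_diag_scale[OF c]) (auto simp: nn_integral_density nn_integral_distr nn_integral_cmult)

text \<open>The disc variable, at index \<open>None\<close>, splits off as a factor; integrals over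
  the Hartogs domain can be taken slice by slice.\<close>

lemma lborel_ext_pt:
  "(lborel :: (complex^('n::finite option)) measure) = distr (lborel \<Otimes>\<^sub>M lborel) borel (\<lambda>(x, w). ext_pt x w)"
proof (rule lborel_eqI)
  have blin: "bounded_linear (\<lambda>(x :: complex^'n, w). ext_pt x w)"
    by (intro linear_conv_bounded_linear[THEN iffD1] linearI)
       (auto simp: ext_pt_def vec_eq_iff split: option.splits)
  have meas [measurable]: "(\<lambda>(x :: complex^'n, w). ext_pt x w) \<in> borel_measurable (lborel \<Otimes>\<^sub>M lborel)"
    using borel_measurable_continuous_onI[OF linear_continuous_on[OF blin]] by (simp add: borel_prod[symmetric])
  fix l u :: "complex^('n option)"
  assume le: "\<And>b. b \<in> Basis \<Longrightarrow> l \<bullet> b \<le> u \<bullet> b"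
  define r where "r = (\<lambda>l::complex^('n option). (\<chi> i. l $ Some i) :: complex^'n)"
  have box: "box l u = {x. \<forall>i. x $ i \<in> box (l $ i) (u $ i)}" for l u :: "complex^('k::finite)"
    by (auto simp: mem_box Basis_vec_def inner_axis)
  have eq: "(\<lambda>(x :: complex^'n, w). ext_pt x w) -` box l u = box (r l) (r u) \<times> box (l $ None) (u $ None)"
    by (auto simp: box ext_pt_def r_def split: option.splits)
  have "emeasure (distr (lborel \<Otimes>\<^sub>M lborel) borel (\<lambda>(x :: complex^'n, w). ext_pt x w)) (box l u) =
     emeasure lborel (box (r l) (r u)) * emeasure lborel (box (l $ None) (u $ None))"
    by (subst emeasure_distr) (auto simp: eq space_pair_measure lborel.emeasure_pair_measure_Times)
  also have "\<dots> = (\<Prod>i\<in>UNIV. emeasure lborel (box (l $ Some i) (u $ Some i))) * emeasure lborel (box (l $ None) (u $ None))"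
    by (simp add: box[of "r l"] emeasure_lborel_vec_Pi) (simp add: r_def)
  also have "\<dots> = (\<Prod>i\<in>UNIV. emeasure lborel (box (l $ i) (u $ i)))"
    by (simp add: UNIV_option_conv prod.reindex mult.commute)
  also have "\<dots> = emeasure lborel (box l u)"
    by (simp add: box[of l] emeasure_lborel_vec_Pi)
  also have "\<dots> = (\<Prod>b\<in>Basis. (u - l) \<bullet> b)"
    using le by (intro emeasure_lborel_box)
  finally show "emeasure (distr (lborel \<Otimes>\<^sub>M lborel) borel (\<lambda>(x :: complex^'n, w). ext_pt x w)) (box l u)
    = (\<Prod>b\<in>Basis. (u - l) \<bullet> b)" .
qed auto

text \<open>Polar coordinates with the angle integrated out: \<open>1 - |w|^2 > x\<close> describes
  a disc of radius \<open>sqrt (1 - x)\<close>, whose area \<open>pi (1 - x)\<close> is linear in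
  \<open>x\<close>. Both measures are finite on half-lines, so comparing them there
  suffices.\<close>

lemma distr_disc_one_minus_norm_sq:
  "distr (density lborel (indicator (ball (0::complex) 1))) borel (\<lambda>w. 1 - (cmod w)\<^sup>2) =
     density lborel (\<lambda>s. ennreal (pi * indicator {0..1} s))" (is "?M = ?N")
proof (rule measure_eqI_lessThan)
  have N: "emeasure ?N {x<..} = ennreal (if x < 0 then pi else if x \<le> 1 then pi * (1 - x) else 0)" for x :: real
  proof -
    have "emeasure ?N {x<..} = (\<integral>\<^sup>+s. ennreal pi * indicator ({x<..} \<inter> {0..1}) s \<partial>lborel)"
      by (subst emeasure_density) (auto intro!: nn_integral_cong simp: indicator_def)
    also have "\<dots> = ennreal pi * emeasure lborel ({x<..} \<inter> {0..1})"
      by (subst nn_integral_cmult) auto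
    also have "{x<..} \<inter> {0..1} = (if x < 0 then {0..1} else if x \<le> 1 then {x<..1} else {})"
      by auto
    finally show ?thesis by (auto simp: ennreal_mult[symmetric] simp flip: ennreal_mult')
  qed
  have M: "emeasure ?M {x<..} = ennreal (if x < 0 then pi else if x \<le> 1 then pi * (1 - x) else 0)" for x :: real
  proof -
    have "emeasure ?M {x<..} = emeasure lborel (ball (0::complex) 1 \<inter> (\<lambda>w. 1 - (cmod w)\<^sup>2) -` {x<..})"
    proof -
      have m [measurable]: "(\<lambda>w::complex. 1 - (cmod w)\<^sup>2) -` {x<..} \<in> sets borel"
        using measurable_sets_borel[of "\<lambda>w::complex. 1 - (cmod w)\<^sup>2" borel "{x<..}"] by simp
      have "emeasure ?M {x<..} = (\<integral>\<^sup>+w. indicator (ball 0 1) w * indicator ((\<lambda>w. 1 - (cmod w)\<^sup>2) -` {x<..}) w \<partial>lborel)"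
        by (subst emeasure_distr, simp, simp, subst emeasure_density) (auto intro!: borel_measurable_indicator)
      then show ?thesis by (simp flip: indicator_inter_arith)
    qed
    also have "ball (0::complex) 1 \<inter> (\<lambda>w. 1 - (cmod w)\<^sup>2) -` {x<..} =
        (if x < 0 then ball 0 1 else if x \<le> 1 then ball 0 (sqrt (1 - x)) else {})"
    proof (cases "x < 0")
      case True
      have "(cmod w)\<^sup>2 < 1 - x" if "cmod w < 1" for w
        using that True power_le_one[of "cmod w" 2] by auto
      then show ?thesis using True by (auto simp: algebra_simps)
    next
      case False
      have "cmod w < 1 \<and> x < 1 - (cmod w)\<^sup>2 \<longleftrightarrow> cmod w < sqrt (1 - x)" for w
      proof -
        have "cmod w < sqrt (1 - x) \<longleftrightarrow> (cmod w)\<^sup>2 < 1 - x"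
          using real_sqrt_less_iff[of "(cmod w)\<^sup>2" "1 - x"] by simp
        moreover have "(cmod w)\<^sup>2 < 1 - x \<Longrightarrow> cmod w < 1"
          using False by (intro power2_less_imp_less[of _ 1]) auto
        ultimately show ?thesis by auto
      qed
      then have "ball (0::complex) 1 \<inter> (\<lambda>w. 1 - (cmod w)\<^sup>2) -` {x<..} = {w. cmod w < sqrt (1 - x)}"
        by (simp add: set_eq_iff)
      moreover have "{w::complex. cmod w < sqrt (1 - x)} = ball 0 (sqrt (1 - x))"
        by auto
      moreover have "{w::complex. cmod w < sqrt (1 - x)} = {}" if "\<not> x \<le> 1"
      proof -
        have "sqrt (1 - x) < 0" using that by simp
        then show ?thesis by (auto simp: not_less intro: order_trans[OF less_imp_le norm_ge_zero])
      qed
      ultimately show ?thesis using False by simp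
    qed
    finally show ?thesis by (auto simp: emeasure_ball eval_unit_ball_vol)
  qed
  show "emeasure ?M {x<..} = emeasure ?N {x<..}" for x
    unfolding M N ..
  show "emeasure ?M {x<..} < \<infinity>" for x
    unfolding M by simp
qed auto

section \<open>Automorphisms of the unit disc\<close>

lemma norm_one_plus_cnj_mult_sq:
  "(cmod (1 + cnj \<eta> * w))\<^sup>2 - (cmod (w + \<eta>))\<^sup>2 = (1 - (cmod w)\<^sup>2) * (1 - (cmod \<eta>)\<^sup>2)"
  unfolding cmod_power2 by (simp add: algebra_simps power2_eq_square)

lemma one_plus_cnj_mult_pos_Re:
  assumes "cmod \<eta> < 1" "cmod w < 1"
  shows "Re (1 + cnj \<eta> * w) > 0"
proof -
  have "cmod (cnj \<eta> * w) < 1"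
    using assms mult_strict_mono[of "cmod \<eta>" 1 "cmod w" 1] by (simp add: norm_mult)
  then show ?thesis
    using abs_Re_le_cmod[of "cnj \<eta> * w"] by simp
qed

lemma one_plus_cnj_mult_nonzero:
  assumes "cmod \<eta> < 1" "cmod w < 1"
  shows "1 + cnj \<eta> * w \<noteq> 0"
  using one_plus_cnj_mult_pos_Re[OF assms] by (metis less_irrefl zero_complex.sel(1))

definition disc_aut :: "complex \<Rightarrow> complex \<Rightarrow> complex" where
  "disc_aut \<eta> w = (w + \<eta>) / (1 + cnj \<eta> * w)"

lemma one_minus_norm_disc_aut:
  assumes "cmod \<eta> < 1" "cmod w < 1"
  shows "1 - (cmod (disc_aut \<eta> w))\<^sup>2 = (1 - (cmod w)\<^sup>2) * (1 - (cmod \<eta>)\<^sup>2) / (cmod (1 + cnj \<eta> * w))\<^sup>2"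
proof -
  have "1 + cnj \<eta> * w \<noteq> 0" by (rule one_plus_cnj_mult_nonzero[OF assms])
  then show ?thesis
    by (simp add: disc_aut_def norm_divide power_divide diff_divide_distrib flip: norm_one_plus_cnj_mult_sq)
qed

lemma norm_disc_aut_less_1:
  assumes "cmod \<eta> < 1" "cmod w < 1"
  shows "cmod (disc_aut \<eta> w) < 1"
proof -
  have "1 + cnj \<eta> * w \<noteq> 0" by (rule one_plus_cnj_mult_nonzero[OF assms])
  then have "0 < 1 - (cmod (disc_aut \<eta> w))\<^sup>2"
    unfolding one_minus_norm_disc_aut[OF assms] using assms by (simp add: abs_square_less_1)
  then show ?thesis by (simp add: abs_square_less_1)
qed

lemma disc_aut_inverse:
  assumes "cmod \<eta> < 1" "cmod w < 1"
  shows "disc_aut (- \<eta>) (disc_aut \<eta> w) = w"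
proof -
  have 1: "1 + cnj \<eta> * w \<noteq> 0" by (rule one_plus_cnj_mult_nonzero[OF assms])
  have 2: "1 - cnj \<eta> * \<eta> \<noteq> 0"
    using one_plus_cnj_mult_pos_Re[of "- \<eta>" \<eta>] assms by (metis complex_cnj_minus less_irrefl minus_mult_left norm_minus_cancel uminus_add_conv_diff add.commute zero_complex.sel(1))
  have "disc_aut (- \<eta>) (disc_aut \<eta> w) = (w * (1 - cnj \<eta> * \<eta>)) / (1 - cnj \<eta> * \<eta>)"
    unfolding disc_aut_def using 1 by (simp add: divide_simps) (simp add: algebra_simps)
  then show ?thesis using 2 by simp
qed

lemma image_disc_aut:
  assumes "cmod \<eta> < 1"
  shows "disc_aut \<eta> ` ball 0 1 = ball 0 1"
proof
  show "disc_aut \<eta> ` ball 0 1 \<subseteq> ball 0 1" using norm_disc_aut_less_1[OF assms] by auto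
  show "ball 0 1 \<subseteq> disc_aut \<eta> ` ball 0 1"
  proof
    fix w :: complex assume "w \<in> ball 0 1"
    then have "w = disc_aut \<eta> (disc_aut (- \<eta>) w)" "disc_aut (- \<eta>) w \<in> ball 0 1"
      using disc_aut_inverse[of "- \<eta>" w] norm_disc_aut_less_1[of "- \<eta>" w] assms by auto
    then show "w \<in> disc_aut \<eta> ` ball 0 1" by blast
  qed
qed

lemma has_field_derivative_disc_aut:
  assumes "cmod \<eta> < 1" "cmod w < 1"
  shows "(disc_aut \<eta> has_field_derivative (1 - (cmod \<eta>)\<^sup>2) / (1 + cnj \<eta> * w)\<^sup>2) (at w)"
proof -
  have 1: "1 + cnj \<eta> * w \<noteq> 0" by (rule one_plus_cnj_mult_nonzero[OF assms])
  show ?thesis unfolding disc_aut_def[abs_def] of_real_diff complex_norm_square of_real_1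
    by (rule derivative_eq_intros refl 1)+ (simp add: algebra_simps power2_eq_square)
qed

lemma nn_integral_disc_aut:
  assumes \<eta>: "cmod \<eta> < 1" and F [measurable]: "F \<in> borel_measurable borel"
  shows "(\<integral>\<^sup>+w. indicator (ball 0 1) w * F w \<partial>lborel) =
    (\<integral>\<^sup>+w. indicator (ball 0 1) w * (ennreal ((cmod ((1 - (cmod \<eta>)\<^sup>2) / (1 + cnj \<eta> * w)\<^sup>2))\<^sup>2) * F (disc_aut \<eta> w)) \<partial>lborel)"
proof -
  let ?d = "\<lambda>w. ennreal ((cmod ((1 - (cmod \<eta>)\<^sup>2) / (1 + cnj \<eta> * w)\<^sup>2))\<^sup>2)"
  have [measurable]: "disc_aut \<eta> \<in> borel_measurable borel" unfolding disc_aut_def[abs_def] by measurable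
  \<comment> \<open>The image formula concerns sets of finite measure. Intersecting with the disc
    provides them, and an equality of measures then covers every integrand.\<close>
  have "density lborel (indicator (ball 0 1)) = distr (density lborel (\<lambda>w. indicator (ball 0 1) w * ?d w)) borel (disc_aut \<eta>)"
    (is "?M = ?N")
  proof (rule measure_eqI)
    fix A :: "complex set" assume "A \<in> sets ?M"
    then have A [measurable]: "A \<in> sets borel" by simp
    have "emeasure ?M A = emeasure lborel (A \<inter> ball 0 1)"
      by (subst emeasure_density) (auto intro!: borel_measurable_indicator nn_integral_cong simp: indicator_def simp flip: nn_integral_indicator)
    also have "\<dots> = (\<integral>\<^sup>+w. indicator (ball 0 1) w * indicator (A \<inter> ball 0 1) (disc_aut \<eta> w) * ?d w \<partial>lborel)"
    proof (rule emeasure_holomorphic_image)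
      show "inj_on (disc_aut \<eta>) (ball 0 1)"
        by (rule inj_on_inverseI[of _ "disc_aut (- \<eta>)"]) (use \<eta> disc_aut_inverse in auto)
      show "emeasure lborel (A \<inter> ball 0 1) < \<infinity>"
        by (rule le_less_trans[OF emeasure_mono emeasure_lborel_ball_finite]) auto
    qed (use \<eta> image_disc_aut[OF \<eta>] has_field_derivative_disc_aut[OF \<eta>] in auto)
    also have "\<dots> = emeasure ?N A"
      using measurable_sets_borel[of "disc_aut \<eta>" borel A]
      by (subst emeasure_distr, simp, simp, subst emeasure_density)
        (use norm_disc_aut_less_1[OF \<eta>] in \<open>auto intro!: nn_integral_cong simp: indicator_def\<close>)
    finally show "emeasure ?M A = emeasure ?N A" .
  qed auto
  then have eq: "(\<integral>\<^sup>+w. F w \<partial>?M) = (\<integral>\<^sup>+w. F w \<partial>?N)" by simp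
  have ind [measurable]: "(indicator (ball (0::complex) 1) :: complex \<Rightarrow> ennreal) \<in> borel_measurable borel"
    by (intro borel_measurable_indicator) auto
  have "(\<integral>\<^sup>+w. F w \<partial>?M) = (\<integral>\<^sup>+w. indicator (ball 0 1) w * F w \<partial>lborel)"
    by (subst nn_integral_density) auto
  moreover have "(\<integral>\<^sup>+w. F w \<partial>?N) = (\<integral>\<^sup>+w. indicator (ball 0 1) w * (?d w * F (disc_aut \<eta> w)) \<partial>lborel)"
    by (subst nn_integral_distr, simp, simp, subst nn_integral_density) (auto simp: mult.assoc)
  ultimately show ?thesis using eq by simp
qed

section \<open>Holomorphic functions of several variables\<close>

lemma norm_vector_smult [simp]: "norm (c *s v) = cmod c * norm (v :: complex^'i::finite)"
  by (simp add: norm_vec_def L2_set_def norm_mult power_mult_distrib real_sqrt_mult flip: sum_distrib_left)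

lemma has_derivative_vecI:
  fixes G :: "'a::real_normed_vector \<Rightarrow> complex^'i::finite"
  assumes "\<And>i. ((\<lambda>x. G x $ i) has_derivative (\<lambda>h. G' h $ i)) (at x within S)"
  shows "(G has_derivative G') (at x within S)"
proof (subst has_derivative_componentwise_within, intro ballI)
  fix b :: "complex^'i" assume "b \<in> Basis"
  then obtain i u where b: "b = axis i u" by (auto simp: Basis_vec_def)
  show "((\<lambda>x. G x \<bullet> b) has_derivative (\<lambda>x. G' x \<bullet> b)) (at x within S)"
    unfolding b inner_axis by (intro derivative_intros assms)
qed

text \<open>The whole derivative instead of the partials \<open>cpartial\<close>: the Euler field
  and the chain rule become evaluations at a single vector.\<close>

definition cderiv :: "(complex^'i::finite \<Rightarrow> complex) \<Rightarrow> complex^'i \<Rightarrow> complex^'i \<Rightarrow> complex" where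
  "cderiv f x = frechet_derivative f (at x)"

lemma cderiv_eqI: "(f has_derivative L) (at x) \<Longrightarrow> cderiv f x = L"
  unfolding cderiv_def by (rule frechet_derivative_at[symmetric])

lemma holo_on_has_derivative:
  assumes "holo_on f D" "x \<in> D"
  shows "(f has_derivative cderiv f x) (at x)" and "cderiv f x (c *s v) = c * cderiv f x v"
proof -
  obtain L where L: "(f has_derivative L) (at x)" "\<forall>c v. L (c *s v) = c * L v"
    using assms unfolding holo_on_def by blast
  then show "(f has_derivative cderiv f x) (at x)" "cderiv f x (c *s v) = c * cderiv f x v"
    using cderiv_eqI[OF L(1)] by auto
qed

lemma linear_cderiv:
  assumes "holo_on f D" "x \<in> D"
  shows "linear (cderiv f x)"
  using holo_on_has_derivative(1)[OF assms] by (rule has_derivative_linear)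

lemma holo_onI:
  assumes "\<And>x. x \<in> D \<Longrightarrow> (f has_derivative L x) (at x)" "\<And>x c v. x \<in> D \<Longrightarrow> L x (c *s v) = c * L x v"
  shows "holo_on f D"
  using assms unfolding holo_on_def by blast

lemma holo_on_subset: "holo_on f D \<Longrightarrow> E \<subseteq> D \<Longrightarrow> holo_on f E"
  unfolding holo_on_def by blast

lemma holo_on_continuous_on: "holo_on f D \<Longrightarrow> continuous_on D f"
  by (meson continuous_at_imp_continuous_on has_derivative_continuous holo_on_has_derivative(1))

lemma holo_on_cong:
  assumes "open D" "\<And>x. x \<in> D \<Longrightarrow> f x = g x" "holo_on f D"
  shows "holo_on g D"
proof (rule holo_onI)
  fix x assume x: "x \<in> D"
  show "(g has_derivative cderiv f x) (at x)"
    by (rule has_derivative_transform_within_open[OF holo_on_has_derivative(1)[OF assms(3) x] assms(1) x]) (use assms in auto)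
qed (use holo_on_has_derivative(2)[OF assms(3)] in auto)

lemma holo_on_const: "holo_on (\<lambda>x. c) D"
  by (rule holo_onI[where L="\<lambda>_ _. 0"]) auto

lemma holo_on_nth: "holo_on (\<lambda>x. x $ i) D"
  by (rule holo_onI[where L="\<lambda>_ v. v $ i"]) (auto intro!: bounded_linear_imp_has_derivative bounded_linear_vec_nth)

lemma holo_on_add: "holo_on f D \<Longrightarrow> holo_on g D \<Longrightarrow> holo_on (\<lambda>x. f x + g x) D"
  by (rule holo_onI[where L="\<lambda>x v. cderiv f x v + cderiv g x v"])
     (auto intro!: derivative_intros holo_on_has_derivative(1) simp: holo_on_has_derivative(2) algebra_simps)

lemma holo_on_mult: "holo_on f D \<Longrightarrow> holo_on g D \<Longrightarrow> holo_on (\<lambda>x. f x * g x) D"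
  by (rule holo_onI[where L="\<lambda>x v. f x * cderiv g x v + cderiv f x v * g x"])
     (erule (1) has_derivative_mult[OF holo_on_has_derivative(1) holo_on_has_derivative(1)],
       auto simp: holo_on_has_derivative(2) algebra_simps)

lemma holo_on_compose_field:
  assumes "holo_on g D" "\<And>x. x \<in> D \<Longrightarrow> (\<phi> has_field_derivative \<phi>' (g x)) (at (g x))"
  shows "holo_on (\<lambda>x. \<phi> (g x)) D"
  by (rule holo_onI[where L="\<lambda>x v. \<phi>' (g x) * cderiv g x v"])
     (use assms in \<open>auto intro!: has_derivative_compose[OF holo_on_has_derivative(1)]
        simp: holo_on_has_derivative(2) has_field_derivative_def\<close>)

lemma holo_on_compose:
  fixes G :: "complex^'a::finite \<Rightarrow> complex^'b::finite"
  assumes f: "holo_on f D" and G: "\<And>i. holo_on (\<lambda>x. G x $ i) E" and sub: "\<And>x. x \<in> E \<Longrightarrow> G x \<in> D"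
  shows "holo_on (\<lambda>x. f (G x)) E"
proof (rule holo_onI)
  fix x assume x: "x \<in> E"
  have "(G has_derivative (\<lambda>v. \<chi> i. cderiv (\<lambda>x. G x $ i) x v)) (at x)"
    by (rule has_derivative_vecI) (use G x holo_on_has_derivative(1) in auto)
  then show "((\<lambda>x. f (G x)) has_derivative (\<lambda>v. cderiv f (G x) (\<chi> i. cderiv (\<lambda>x. G x $ i) x v))) (at x)"
    by (rule has_derivative_compose) (use f sub x holo_on_has_derivative(1) in auto)
  fix c v
  have "(\<chi> i. cderiv (\<lambda>x. G x $ i) x (c *s v)) = c *s (\<chi> i. cderiv (\<lambda>x. G x $ i) x v)"
    by (simp add: vec_eq_iff holo_on_has_derivative(2)[OF G x])
  then show "cderiv f (G x) (\<chi> i. cderiv (\<lambda>x. G x $ i) x (c *s v)) = c * cderiv f (G x) (\<chi> i. cderiv (\<lambda>x. G x $ i) x v)"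
    by (simp add: holo_on_has_derivative(2)[OF f sub[OF x]])
qed

lemma has_field_derivative_holo_curve:
  assumes f: "holo_on f D" and \<gamma>: "\<And>i. ((\<lambda>t. \<gamma> t $ i) has_field_derivative v $ i) (at t)" and t: "\<gamma> t \<in> D"
  shows "((\<lambda>t. f (\<gamma> t)) has_field_derivative cderiv f (\<gamma> t) v) (at t)"
proof -
  have "(\<gamma> has_derivative (\<lambda>h. h *s v)) (at t)"
    using \<gamma> by (intro has_derivative_vecI) (simp add: has_field_derivative_def mult_commute_abs)
  then have "((\<lambda>t. f (\<gamma> t)) has_derivative (\<lambda>h. cderiv f (\<gamma> t) (h *s v))) (at t)"
    by (rule has_derivative_compose) (rule holo_on_has_derivative(1)[OF f t])
  then show ?thesis
    by (simp add: has_field_derivative_def holo_on_has_derivative(2)[OF f t] mult_commute_abs)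
qed

text \<open>Through this lemma every use of Cauchy's theory in several variables becomes one on a
  disc in a single parameter.\<close>

lemma holo_curve_holomorphic:
  assumes f: "holo_on f D" and \<gamma>: "\<And>i. (\<lambda>t. \<gamma> t $ i) holomorphic_on T" and T: "open T" "\<And>t. t \<in> T \<Longrightarrow> \<gamma> t \<in> D"
  shows "(\<lambda>t. f (\<gamma> t)) holomorphic_on T"
proof (subst holomorphic_on_open[OF T(1)], intro ballI)
  fix t assume t: "t \<in> T"
  have "((\<lambda>t. f (\<gamma> t)) has_field_derivative cderiv f (\<gamma> t) (\<chi> i. deriv (\<lambda>t. \<gamma> t $ i) t)) (at t)"
    by (rule has_field_derivative_holo_curve[OF f]) (use holomorphic_derivI[OF \<gamma> T(1) t] T(2)[OF t] in auto)
  then show "\<exists>f'. ((\<lambda>t. f (\<gamma> t)) has_field_derivative f') (at t)" by blast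
qed

text \<open>Cauchy's inequality in one variable, on the complex line through \<open>y\<close> in
  direction \<open>v\<close>. The parameter radius \<open>r / norm v\<close> is the largest that
  keeps the line inside the ball.\<close>

lemma cderiv_bound:
  assumes f: "holo_on f D" and sub: "cball y r \<subseteq> D" and r: "r > 0" and B: "\<And>x. x \<in> cball y r \<Longrightarrow> cmod (f x) \<le> B"
  shows "cmod (cderiv f y v) \<le> B / r * norm v"
proof (cases "v = 0")
  case True
  have "y \<in> D" using sub r by auto
  then show ?thesis using True linear_0[OF linear_cderiv[OF f]] by simp
next
  case False
  define \<rho> where "\<rho> = r / norm v"
  have \<rho>: "\<rho> > 0" using r False by (simp add: \<rho>_def)
  have mem: "y + t *s v \<in> cball y r" if "cmod t \<le> \<rho>" for t
    using that False by (simp add: dist_norm \<rho>_def field_simps)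
  have cont: "continuous_on (cball 0 \<rho>) (\<lambda>t. f (y + t *s v))"
  proof (rule continuous_on_compose2[OF holo_on_continuous_on[OF f]])
    show "continuous_on (cball 0 \<rho>) (\<lambda>t. y + t *s v)"
      unfolding vector_scalar_mult_def by (intro continuous_intros)
    show "(\<lambda>t. y + t *s v) ` cball 0 \<rho> \<subseteq> D" using mem sub by auto
  qed
  have hol: "(\<lambda>t. f (y + t *s v)) holomorphic_on ball 0 \<rho>"
    by (rule holo_curve_holomorphic[OF f]) (use mem sub in \<open>auto intro!: holomorphic_intros\<close>)
  have "cmod ((deriv ^^ 1) (\<lambda>t. f (y + t *s v)) 0) \<le> fact 1 * B / \<rho> ^ 1"
    by (rule Cauchy_inequality[OF hol cont \<rho>]) (use mem B in auto)
  moreover have "((\<lambda>t. f (y + t *s v)) has_field_derivative cderiv f (y + 0 *s v) v) (at 0)"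
    by (rule has_field_derivative_holo_curve[OF f]) (use mem[of 0] \<rho> sub in \<open>auto intro!: derivative_eq_intros\<close>)
  ultimately show ?thesis
    by (simp add: DERIV_imp_deriv \<rho>_def)
qed

section \<open>Averages over the unit circle\<close>

definition circ :: "real \<Rightarrow> complex" where
  "circ x = exp (2 * of_real pi * \<i> * of_real x)"

lemma norm_circ [simp]: "cmod (circ x) = 1"
  by (simp add: circ_def)

lemma circ_reflect: "circ (1 - x) = cnj (circ x)"
proof -
  have "circ (1 - x) = exp (2 * of_real pi * \<i>) * exp (- (2 * of_real pi * \<i> * of_real x))"
    unfolding circ_def by (subst exp_add[symmetric]) (simp add: algebra_simps)
  then show ?thesis by (simp add: circ_def exp_cnj)
qed

lemma circ_mult_cnj [simp]: "circ x * cnj (circ x) = 1" "cnj (circ x) * circ x = 1"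
  using complex_norm_square[of "circ x"] by (auto simp: mult.commute)

lemma continuous_on_circ [continuous_intros]: "continuous_on S g \<Longrightarrow> continuous_on S (\<lambda>x. circ (g x))"
  unfolding circ_def by (intro continuous_intros)

text \<open>In the parameter \<open>x\<close> the form \<open>dz / (2 pi i (z - t))\<close> is
  \<open>circ x / (circ x - t) dx\<close>. At \<open>t = 0\<close> the weight is 1 and the formula
  is the mean value property; for real \<open>t\<close> in \<open>(0, 1)\<close> it expresses a
  dilation through rotations.\<close>

lemma Cauchy_unit_circle:
  assumes hol: "\<phi> holomorphic_on ball 0 1" and cont: "continuous_on (cball 0 1) \<phi>" and t: "cmod t < 1"
  shows "((\<lambda>x. circ x / (circ x - t) * \<phi> (circ x)) has_integral \<phi> t) {0..1}"
proof -
  have "((\<lambda>u. \<phi> u / (u - t)) has_contour_integral (2 * of_real pi * \<i> * \<phi> t)) (circlepath 0 1)"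
    by (rule Cauchy_integral_circlepath[OF cont hol]) (use t in auto)
  then have "((\<lambda>x. \<phi> (circ x) / (circ x - t) * (2 * of_real pi * \<i> * circ x)) has_integral (2 * of_real pi * \<i> * \<phi> t)) {0..1}"
    unfolding has_contour_integral_def
    by (rule has_integral_cong[THEN iffD1, rotated])
       (simp add: vector_derivative_circlepath01, simp add: circlepath circ_def)
  then have "((\<lambda>x. (\<phi> (circ x) / (circ x - t) * (2 * of_real pi * \<i> * circ x)) / (2 * of_real pi * \<i>)) has_integral (2 * of_real pi * \<i> * \<phi> t) / (2 * of_real pi * \<i>)) {0..1}"
    by (rule has_integral_divide)
  moreover have "\<phi> (circ x) / (circ x - t) * (2 * of_real pi * \<i> * circ x) / (2 * of_real pi * \<i>) = circ x / (circ x - t) * \<phi> (circ x)" for x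
    by simp
  ultimately show ?thesis by (simp only:) simp
qed

text \<open>Joint continuity gives joint measurability; a bound on the slices that is uniform in
  \<open>\<theta>\<close>, over an interval of length 1, gives joint integrability. Both are easier
  to supply than integrability on the product.\<close>

lemma Fubini_unit_interval:
  fixes H :: "real \<Rightarrow> 'a::euclidean_space \<Rightarrow> complex"
  assumes S: "open S" and cont: "continuous_on ({0..1} \<times> S) (\<lambda>(\<theta>, x). H \<theta> x)"
    and bd: "\<And>\<theta>. \<theta> \<in> {0..1} \<Longrightarrow> (\<integral>\<^sup>+x. indicator S x * ennreal (cmod (H \<theta> x)) \<partial>lborel) \<le> ennreal C"
  shows "set_integrable lborel S (\<lambda>x. integral {0..1} (\<lambda>\<theta>. H \<theta> x))"
    and "(LINT x:S|lborel. integral {0..1} (\<lambda>\<theta>. H \<theta> x)) = integral {0..1} (\<lambda>\<theta>. LINT x:S|lborel. H \<theta> x)"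
proof -
  let ?G = "\<lambda>(\<theta>, x). indicator ({0..1} \<times> S) (\<theta>, x) *\<^sub>R H \<theta> x"
  have Ssets: "{0..1::real} \<times> S \<in> sets borel"
    using S by (auto intro!: borel_Times)
  have "(\<lambda>p. indicator ({0..1} \<times> S) p *\<^sub>R (\<lambda>(\<theta>, x). H \<theta> x) p) \<in> borel_measurable borel"
    by (rule borel_measurable_continuous_on_indicator[OF Ssets cont])
  then have G [measurable]: "?G \<in> borel_measurable (lborel \<Otimes>\<^sub>M lborel)"
    by (simp add: lborel_prod case_prod_unfold)
  have "integrable (lborel \<Otimes>\<^sub>M lborel) ?G"
  proof (rule integrableI_bounded[OF G])
    have "(\<integral>\<^sup>+p. norm (?G p) \<partial>(lborel \<Otimes>\<^sub>M lborel)) = (\<integral>\<^sup>+\<theta>. \<integral>\<^sup>+x. norm (?G (\<theta>, x)) \<partial>lborel \<partial>lborel)"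
      by (rule lborel.nn_integral_fst[symmetric]) auto
    also have "\<dots> \<le> (\<integral>\<^sup>+\<theta>. ennreal C * indicator {0..1::real} \<theta> \<partial>lborel)"
    proof (rule nn_integral_mono)
      fix \<theta> :: real
      have "(\<integral>\<^sup>+x. norm (?G (\<theta>, x)) \<partial>lborel) = (\<integral>\<^sup>+x. indicator {0..1} \<theta> * (indicator S x * ennreal (cmod (H \<theta> x))) \<partial>lborel)"
        by (intro nn_integral_cong) (auto simp: indicator_def)
      also have "\<dots> \<le> ennreal C * indicator {0..1} \<theta>"
        using bd[of \<theta>] by (auto simp: indicator_def)
      finally show "(\<integral>\<^sup>+x. norm (?G (\<theta>, x)) \<partial>lborel) \<le> ennreal C * indicator {0..1} \<theta>" .
    qed
    also have "\<dots> < \<infinity>" by (simp add: nn_integral_cmult)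
    finally show "(\<integral>\<^sup>+p. norm (?G p) \<partial>(lborel \<Otimes>\<^sub>M lborel)) < \<infinity>" .
  qed
  note int = this
  have slice: "(LINT \<theta>|lborel. ?G (\<theta>, x)) = indicator S x *\<^sub>R integral {0..1} (\<lambda>\<theta>. H \<theta> x)" for x
  proof (cases "x \<in> S")
    case True
    have "continuous_on {0..1} (\<lambda>\<theta>. H \<theta> x)"
    proof -
      have "continuous_on {0..1} (\<lambda>\<theta>::real. (\<theta>, x))" by (intro continuous_intros)
      moreover have "(\<lambda>\<theta>::real. (\<theta>, x)) ` {0..1} \<subseteq> {0..1} \<times> S" using True by auto
      ultimately show ?thesis using continuous_on_compose2[OF cont] by fastforce
    qed
    then have "set_integrable lborel {0..1} (\<lambda>\<theta>. H \<theta> x)"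
      by (rule borel_integrable_atLeastAtMost')
    from set_borel_integral_eq_integral(2)[OF this] True show ?thesis
      by (simp add: set_lebesgue_integral_def indicator_times)
  qed (simp add: indicator_times)
  have slice2: "(LINT x|lborel. ?G (\<theta>, x)) = indicator {0..1} \<theta> *\<^sub>R (LINT x:S|lborel. H \<theta> x)" for \<theta>
    by (cases "\<theta> \<in> {0..1}") (simp_all add: set_lebesgue_integral_def indicator_times)
  have "integrable lborel (\<lambda>\<theta>. LINT x|lborel. ?G (\<theta>, x))"
    using lborel_pair.integrable_fst'[OF int] by simp
  then have "set_integrable lborel {0..1} (\<lambda>\<theta>. LINT x:S|lborel. H \<theta> x)"
    unfolding slice2 set_integrable_def .
  from set_borel_integral_eq_integral(2)[OF this]
  have "integral {0..1} (\<lambda>\<theta>. LINT x:S|lborel. H \<theta> x) = (LINT \<theta>|lborel. LINT x|lborel. ?G (\<theta>, x))"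
    unfolding slice2 set_lebesgue_integral_def by simp
  also have "\<dots> = (LINT x|lborel. LINT \<theta>|lborel. ?G (\<theta>, x))"
    using lborel_pair.Fubini_integral[of "\<lambda>\<theta> x. ?G (\<theta>, x)"] int by simp
  also have "\<dots> = (LINT x:S|lborel. integral {0..1} (\<lambda>\<theta>. H \<theta> x))"
    unfolding slice set_lebesgue_integral_def ..
  finally show "(LINT x:S|lborel. integral {0..1} (\<lambda>\<theta>. H \<theta> x)) = integral {0..1} (\<lambda>\<theta>. LINT x:S|lborel. H \<theta> x)"
    by simp
  have "integrable lborel (\<lambda>x. LINT \<theta>|lborel. ?G (\<theta>, x))"
    using lborel_pair.integrable_snd[of "\<lambda>\<theta> x. ?G (\<theta>, x)"] int by simp
  then show "set_integrable lborel S (\<lambda>x. integral {0..1} (\<lambda>\<theta>. H \<theta> x))"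
    unfolding slice set_integrable_def .
qed

section \<open>The Bergman space\<close>

definition ip :: "(complex^'i::finite) set \<Rightarrow> (complex^'i \<Rightarrow> complex) \<Rightarrow> (complex^'i \<Rightarrow> complex) \<Rightarrow> complex" where
  "ip D f g = (LINT x:D|lborel. f x * cnj (g x))"

definition nrm2 :: "(complex^'i::finite) set \<Rightarrow> (complex^'i \<Rightarrow> complex) \<Rightarrow> real" where
  "nrm2 D f = (LINT x:D|lborel. (cmod (f x))\<^sup>2)"

lemma borel_measurable_indicator_continuous:
  fixes f :: "'a::euclidean_space \<Rightarrow> complex"
  assumes "open D" "continuous_on D f"
  shows "(\<lambda>x. indicator D x *\<^sub>R f x) \<in> borel_measurable lborel"
  using borel_measurable_continuous_on_indicator[of D f] assms by simp

text \<open>The definition of \<open>A2\<close> uses the gauge integral. For a nonnegative function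
  this is absolute integrability, and continuity makes the integrand Borel, so that the completed
  measure can be replaced by \<open>lborel\<close>.\<close>

lemma A2_iff:
  assumes D: "open D"
  shows "f \<in> A2 D \<longleftrightarrow> holo_on f D \<and> set_integrable lborel D (\<lambda>x. (cmod (f x))\<^sup>2)"
proof -
  have "(\<lambda>x. (cmod (f x))\<^sup>2) integrable_on D \<longleftrightarrow> set_integrable lborel D (\<lambda>x. (cmod (f x))\<^sup>2)" if "holo_on f D"
  proof -
    have cont: "continuous_on D (\<lambda>x. (cmod (f x))\<^sup>2)"
      using holo_on_continuous_on[OF that] by (intro continuous_intros)
    have meas: "(\<lambda>x. indicator D x *\<^sub>R (cmod (f x))\<^sup>2) \<in> borel_measurable lborel"
      using borel_measurable_continuous_on_indicator[OF _ cont] D by simp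
    have "(\<lambda>x. (cmod (f x))\<^sup>2) integrable_on D \<longleftrightarrow> (\<lambda>x. (cmod (f x))\<^sup>2) absolutely_integrable_on D"
      by (rule absolutely_integrable_on_iff_nonneg[symmetric]) auto
    also have "\<dots> \<longleftrightarrow> set_integrable lborel D (\<lambda>x. (cmod (f x))\<^sup>2)"
      unfolding set_integrable_def using integrable_completion[OF meas] by simp
    finally show ?thesis .
  qed
  then show ?thesis unfolding A2_def by blast
qed

lemma A2_holo: "f \<in> A2 D \<Longrightarrow> holo_on f D"
  by (simp add: A2_def)

lemma A2_continuous_on: "f \<in> A2 D \<Longrightarrow> continuous_on D f"
  by (simp add: A2_holo holo_on_continuous_on)

lemma A2_sq_integrable: "open D \<Longrightarrow> f \<in> A2 D \<Longrightarrow> set_integrable lborel D (\<lambda>x. (cmod (f x))\<^sup>2)"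
  by (simp add: A2_iff)

lemma two_mult_le_sum_sq: "2 * (a * b) \<le> a\<^sup>2 + (b\<^sup>2 :: real)"
  using sum_squares_bound[of a b] by simp

text \<open>\<open>|f|^2 + |g|^2\<close> is a majorant. The functions are merely continuous here
  because one later application takes \<open>g = cnj f\<close>.\<close>

lemma set_integrable_mult_cnj:
  fixes f g :: "'a::euclidean_space \<Rightarrow> complex"
  assumes "open D" "continuous_on D f" "continuous_on D g"
    "set_integrable lborel D (\<lambda>x. (cmod (f x))\<^sup>2)" "set_integrable lborel D (\<lambda>x. (cmod (g x))\<^sup>2)"
  shows "set_integrable lborel D (\<lambda>x. f x * cnj (g x))"
  unfolding set_integrable_def
proof (rule Bochner_Integration.integrable_bound)
  show "integrable lborel (\<lambda>x. indicator D x *\<^sub>R ((cmod (f x))\<^sup>2 + (cmod (g x))\<^sup>2))"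
    using set_integral_add(1)[OF assms(4,5)] by (simp add: set_integrable_def)
  show "(\<lambda>x. indicat_real D x *\<^sub>R (f x * cnj (g x))) \<in> borel_measurable lborel"
    using assms by (intro borel_measurable_indicator_continuous continuous_intros)
  show "AE x in lborel. norm (indicat_real D x *\<^sub>R (f x * cnj (g x))) \<le> norm (indicat_real D x *\<^sub>R ((cmod (f x))\<^sup>2 + (cmod (g x))\<^sup>2))"
  proof (rule AE_I2)
    fix x
    have "cmod (f x) * cmod (g x) \<le> (cmod (f x))\<^sup>2 + (cmod (g x))\<^sup>2"
      using two_mult_le_sum_sq[of "cmod (f x)" "cmod (g x)"] mult_nonneg_nonneg[OF norm_ge_zero norm_ge_zero, of "f x" "g x"] by linarith
    then show "norm (indicat_real D x *\<^sub>R (f x * cnj (g x))) \<le> norm (indicat_real D x *\<^sub>R ((cmod (f x))\<^sup>2 + (cmod (g x))\<^sup>2))"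
      by (auto simp: norm_mult indicator_def)
  qed
qed

lemma A2_mult_cnj_integrable:
  assumes "open D" "f \<in> A2 D" "g \<in> A2 D"
  shows "set_integrable lborel D (\<lambda>x. f x * cnj (g x))"
  using assms by (intro set_integrable_mult_cnj A2_continuous_on A2_sq_integrable)

lemma A2_integral_eq_ip:
  assumes "open D" "f \<in> A2 D" "g \<in> A2 D"
  shows "integral D (\<lambda>x. f x * cnj (g x)) = ip D f g"
  using set_borel_integral_eq_integral(2)[OF A2_mult_cnj_integrable[OF assms]] by (simp add: ip_def)

lemma A2_add:
  assumes D: "open D" and f: "f \<in> A2 D" and g: "g \<in> A2 D"
  shows "(\<lambda>x. f x + g x) \<in> A2 D"
  unfolding A2_iff[OF D]
proof
  show holo: "holo_on (\<lambda>x. f x + g x) D" using f g by (intro holo_on_add A2_holo)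
  have "integrable lborel (\<lambda>x. indicator D x *\<^sub>R (2 * (cmod (f x))\<^sup>2 + 2 * (cmod (g x))\<^sup>2))"
    using set_integral_add(1)[OF set_integrable_mult_right[OF A2_sq_integrable[OF D f], of 2] set_integrable_mult_right[OF A2_sq_integrable[OF D g], of 2]]
    by (simp add: set_integrable_def)
  then show "set_integrable lborel D (\<lambda>x. (cmod (f x + g x))\<^sup>2)"
    unfolding set_integrable_def
  proof (rule Bochner_Integration.integrable_bound)
    have "continuous_on D (\<lambda>x. (cmod (f x + g x))\<^sup>2)"
      using f g by (intro continuous_intros A2_continuous_on)
    from borel_measurable_continuous_on_indicator[OF _ this] D
    show "(\<lambda>x. indicat_real D x *\<^sub>R (cmod (f x + g x))\<^sup>2) \<in> borel_measurable lborel" by simp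
    show "AE x in lborel. norm (indicat_real D x *\<^sub>R (cmod (f x + g x))\<^sup>2) \<le> norm (indicat_real D x *\<^sub>R (2 * (cmod (f x))\<^sup>2 + 2 * (cmod (g x))\<^sup>2))"
    proof (rule AE_I2)
      fix x
      have "(cmod (f x + g x))\<^sup>2 \<le> (cmod (f x) + cmod (g x))\<^sup>2"
        by (intro power_mono norm_triangle_ineq) auto
      also have "\<dots> \<le> 2 * (cmod (f x))\<^sup>2 + 2 * (cmod (g x))\<^sup>2"
        using two_mult_le_sum_sq[of "cmod (f x)" "cmod (g x)"] by (simp add: power2_sum)
      finally show "norm (indicat_real D x *\<^sub>R (cmod (f x + g x))\<^sup>2) \<le> norm (indicat_real D x *\<^sub>R (2 * (cmod (f x))\<^sup>2 + 2 * (cmod (g x))\<^sup>2))"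
        by (auto simp: indicator_def)
    qed
  qed
qed

lemma A2_cmult:
  assumes D: "open D" and f: "f \<in> A2 D"
  shows "(\<lambda>x. c * f x) \<in> A2 D"
  unfolding A2_iff[OF D]
  using f set_integrable_mult_right[OF A2_sq_integrable[OF D f], of "(cmod c)\<^sup>2"]
  by (intro conjI holo_on_mult holo_on_const A2_holo) (simp_all add: norm_mult power_mult_distrib)

lemma A2_diff:
  assumes D: "open D" and "f \<in> A2 D" "g \<in> A2 D"
  shows "(\<lambda>x. f x - g x) \<in> A2 D"
  using A2_add[OF D assms(2) A2_cmult[OF D assms(3), of "-1"]] by simp

lemma A2_zero: "open D \<Longrightarrow> (\<lambda>x. 0) \<in> A2 D"
  by (simp add: A2_iff holo_on_const set_integrable_def)

lemma A2_cong:
  assumes D: "open D" and "\<And>x. x \<in> D \<Longrightarrow> f x = g x" "f \<in> A2 D"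
  shows "g \<in> A2 D"
proof -
  have "set_integrable lborel D (\<lambda>x. (cmod (f x))\<^sup>2) \<longleftrightarrow> set_integrable lborel D (\<lambda>x. (cmod (g x))\<^sup>2)"
    unfolding set_integrable_def using assms(2) by (intro Bochner_Integration.integrable_cong) (auto simp: indicator_def)
  then show ?thesis using assms(3) holo_on_cong[of D f g] assms(1,2) unfolding A2_iff[OF D] by blast
qed

lemma ip_cong: "(\<And>x. x \<in> D \<Longrightarrow> f x = f' x) \<Longrightarrow> (\<And>x. x \<in> D \<Longrightarrow> g x = g' x) \<Longrightarrow> ip D f g = ip D f' g'"
  unfolding ip_def set_lebesgue_integral_def by (intro Bochner_Integration.integral_cong) (auto simp: indicator_def)

lemma ip_cnj: "cnj (ip D f g) = ip D g f"
  unfolding ip_def set_lebesgue_integral_def by (subst Bochner_Integration.integral_cnj[symmetric]) (simp add: mult.commute)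

lemma ip_add_left:
  assumes "open D" "f \<in> A2 D" "g \<in> A2 D" "h \<in> A2 D"
  shows "ip D (\<lambda>x. f x + g x) h = ip D f h + ip D g h"
  unfolding ip_def ring_distribs using assms by (intro set_integral_add A2_mult_cnj_integrable)

lemma ip_cmult_left: "ip D (\<lambda>x. c * f x) h = c * ip D f h"
  unfolding ip_def mult.assoc by (rule set_integral_mult_right)

lemma ip_add_right:
  assumes "open D" "f \<in> A2 D" "g \<in> A2 D" "h \<in> A2 D"
  shows "ip D h (\<lambda>x. f x + g x) = ip D h f + ip D h g"
  using ip_add_left[OF assms] by (metis ip_cnj complex_cnj_add)

lemma ip_cmult_right: "ip D h (\<lambda>x. c * f x) = cnj c * ip D h f"
  using ip_cmult_left[of D c f h] by (metis ip_cnj complex_cnj_mult)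

lemma ip_self: "ip D f f = complex_of_real (nrm2 D f)"
  unfolding ip_def nrm2_def set_lebesgue_integral_def
  by (subst integral_complex_of_real[symmetric])
     (auto intro!: Bochner_Integration.integral_cong simp: indicator_def simp flip: complex_norm_square)

lemma nrm2_nonneg: "nrm2 D f \<ge> 0"
  unfolding nrm2_def set_lebesgue_integral_def by (intro Bochner_Integration.integral_nonneg) (auto simp: indicator_def)

lemma nrm2_add:
  assumes "open D" "f \<in> A2 D" "g \<in> A2 D"
  shows "nrm2 D (\<lambda>x. f x + g x) = nrm2 D f + nrm2 D g + 2 * Re (ip D f g)"
proof -
  have "complex_of_real (nrm2 D (\<lambda>x. f x + g x)) = ip D f f + ip D f g + (ip D g f + ip D g g)"
    unfolding ip_self[symmetric] using assms by (simp add: ip_add_left ip_add_right A2_add)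
  then have "Re (complex_of_real (nrm2 D (\<lambda>x. f x + g x))) = Re (ip D f f + ip D f g + (ip D g f + ip D g g))" by simp
  then show ?thesis using arg_cong[OF ip_cnj[of D f g], of Re] by (simp add: ip_self)
qed

lemma nrm2_cmult: "nrm2 D (\<lambda>x. c * f x) = (cmod c)\<^sup>2 * nrm2 D f"
  unfolding nrm2_def norm_mult power_mult_distrib by (rule set_integral_mult_right)

section \<open>Mean value property and bounds for point evaluations\<close>

lemma nn_integral_rotate_about:
  fixes F :: "complex^'i::finite \<Rightarrow> ennreal"
  assumes F [measurable]: "F \<in> borel_measurable borel" and c: "cmod c = 1"
  shows "(\<integral>\<^sup>+x. F (\<zeta> + c *s (x - \<zeta>)) \<partial>lborel) = (\<integral>\<^sup>+x. F x \<partial>lborel)"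
proof -
  have c0: "c \<noteq> 0" using c by auto
  have sc: "c *s v = diag_scale (\<lambda>_. c) v" for v :: "complex^'i"
    by (simp add: vec_eq_iff)
  have m: "(\<lambda>x. F (\<zeta> + x)) \<in> borel_measurable borel" by simp
  have m': "(\<lambda>x. F (\<zeta> + diag_scale (\<lambda>_. c) (x - \<zeta>))) \<in> borel_measurable borel" by simp
  have tr: "(\<integral>\<^sup>+x. G x \<partial>lborel) = (\<integral>\<^sup>+x. G (\<zeta> + x) \<partial>lborel)" if "G \<in> borel_measurable borel" for G :: "complex^'i \<Rightarrow> ennreal"
    by (subst lborel_distr_plus[of \<zeta>, symmetric]) (use that in \<open>simp add: nn_integral_distr\<close>)
  have "(\<integral>\<^sup>+x. F (\<zeta> + c *s (x - \<zeta>)) \<partial>lborel) = (\<integral>\<^sup>+x. F (\<zeta> + diag_scale (\<lambda>_. c) x) \<partial>lborel)"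
    unfolding sc by (subst tr[OF m']) simp
  also have "\<dots> = (\<integral>\<^sup>+x. F (\<zeta> + x) \<partial>lborel)"
    by (subst nn_integral_diag_scale[OF c0 m]) (simp add: c)
  also have "\<dots> = (\<integral>\<^sup>+x. F x \<partial>lborel)"
    by (rule tr[OF F, symmetric])
  finally show ?thesis .
qed

lemma distr_eq_lborel_if_nn_integral:
  fixes T :: "'a::euclidean_space \<Rightarrow> 'a"
  assumes [measurable]: "T \<in> borel_measurable borel"
    and "\<And>F. F \<in> borel_measurable borel \<Longrightarrow> (\<integral>\<^sup>+x. F (T x) \<partial>lborel) = (\<integral>\<^sup>+x. F x \<partial>lborel)"
  shows "distr lborel borel T = lborel"
proof (rule measure_eqI)
  fix A assume "A \<in> sets (distr lborel borel T)"
  then have [measurable]: "A \<in> sets borel" by simp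
  have "emeasure (distr lborel borel T) A = (\<integral>\<^sup>+x. indicator A x \<partial>distr lborel borel T)" by simp
  also have "\<dots> = (\<integral>\<^sup>+x. indicator A (T x) \<partial>lborel)"
    by (subst nn_integral_distr) auto
  also have "\<dots> = emeasure lborel A" by (subst assms(2)) auto
  finally show "emeasure (distr lborel borel T) A = emeasure lborel A" .
qed auto

lemma distr_rotate_about:
  assumes "cmod c = 1"
  shows "distr lborel borel (\<lambda>x. \<zeta> + c *s (x - \<zeta>)) = (lborel :: (complex^'i::finite) measure)"
proof (rule distr_eq_lborel_if_nn_integral[OF _ nn_integral_rotate_about[OF _ assms]])
  show "(\<lambda>x. \<zeta> + c *s (x - \<zeta>)) \<in> borel_measurable borel"
    unfolding vector_scalar_mult_def by (intro borel_measurable_continuous_onI continuous_intros)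
qed auto

text \<open>The ball is averaged over the rotations \<open>x |-> \<zeta> + c (x - \<zeta>)\<close>
  with \<open>|c| = 1\<close>. For fixed \<open>x\<close> the circle average is
  \<open>f \<zeta>\<close>, by Cauchy's formula in \<open>c\<close>; for fixed \<open>c\<close> the
  integral over the ball does not change. Exchanging the two integrals gives the claim, without
  spherical coordinates.\<close>

lemma holo_mean_value:
  fixes f :: "complex^'i::finite \<Rightarrow> complex"
  assumes f: "holo_on f D" and sub: "cball \<zeta> r \<subseteq> D" and r: "r > 0"
  shows "f \<zeta> * measure lborel (ball \<zeta> r) = (LINT x:ball \<zeta> r|lborel. f x)"
proof -
  let ?B = "ball \<zeta> r"
  let ?R = "\<lambda>c x. \<zeta> + c *s (x - \<zeta>)"
  have memR: "?R c x \<in> cball \<zeta> r" if "cmod c \<le> 1" "x \<in> ?B" for c x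
  proof -
    have "norm (c *s (x - \<zeta>)) \<le> 1 * norm (x - \<zeta>)"
      unfolding norm_vector_smult using that by (intro mult_right_mono) auto
    then show ?thesis using that by (simp add: dist_norm norm_minus_commute)
  qed
  have memR': "?R (circ t) x \<in> ?B \<longleftrightarrow> x \<in> ?B" for t x
  proof -
    have "dist \<zeta> (?R (circ t) x) = norm (circ t *s (x - \<zeta>))"
      using norm_minus_commute[of \<zeta> "?R (circ t) x"] unfolding dist_norm by (simp only: add_diff_cancel_left')
    also have "\<dots> = dist \<zeta> x" unfolding norm_vector_smult by (simp add: dist_norm norm_minus_commute)
    finally show ?thesis by simp
  qed
  have contf: "continuous_on (cball \<zeta> r) f"
    using holo_on_continuous_on[OF holo_on_subset[OF f sub]] .
  obtain M where M: "\<And>x. x \<in> cball \<zeta> r \<Longrightarrow> cmod (f x) \<le> M"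
    using compact_imp_bounded[OF compact_continuous_image[OF contf compact_cball]] unfolding bounded_iff by blast
  have contR: "continuous_on S (\<lambda>p. ?R (g p) (h p))" if "continuous_on S g" "continuous_on S h" for S :: "'z::topological_space set" and g h
    unfolding vector_scalar_mult_def by (intro continuous_intros that)
  have intB: "set_integrable lborel ?B f"
  proof (rule set_integrable_subset)
    show "set_integrable lborel (cball \<zeta> r) f"
      unfolding set_integrable_def by (rule borel_integrable_compact[OF compact_cball contf])
  qed auto
  have avg: "integral {0..1} (\<lambda>t. f (?R (circ t) x)) = f \<zeta>" if x: "x \<in> ?B" for x
  proof -
    have "((\<lambda>t. circ t / (circ t - 0) * f (?R (circ t) x)) has_integral f (?R 0 x)) {0..1}"
    proof (rule Cauchy_unit_circle)
      show "(\<lambda>c. f (?R c x)) holomorphic_on ball 0 1"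
        by (rule holo_curve_holomorphic[OF f]) (use memR[OF _ x] sub in \<open>auto intro!: holomorphic_intros\<close>)
      show "continuous_on (cball 0 1) (\<lambda>c. f (?R c x))"
      proof (rule continuous_on_compose2[OF contf contR])
        show "(\<lambda>c. ?R c x) ` cball 0 1 \<subseteq> cball \<zeta> r" using memR[OF _ x] by force
      qed (intro continuous_intros)+
    qed auto
    moreover have "circ t \<noteq> 0" for t by (metis norm_circ norm_zero zero_neq_one)
    ultimately show ?thesis by (simp add: has_integral_iff)
  qed
  have inv: "(LINT x:?B|lborel. f (?R (circ t) x)) = (LINT x:?B|lborel. f x)" for t
  proof -
    have "(LINT x:?B|lborel. f x) = (LINT x|distr lborel borel (?R (circ t)). indicator ?B x *\<^sub>R f x)"
      unfolding distr_rotate_about[OF norm_circ] set_lebesgue_integral_def ..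
    also have "\<dots> = (LINT x|lborel. indicator ?B (?R (circ t) x) *\<^sub>R f (?R (circ t) x))"
    proof (rule integral_distr)
      show "?R (circ t) \<in> borel_measurable lborel"
        by (subst measurable_cong_sets[OF sets_lborel refl]) (intro borel_measurable_continuous_onI contR continuous_intros)
      show "(\<lambda>x. indicator ?B x *\<^sub>R f x) \<in> borel_measurable borel"
        using intB by (auto simp: set_integrable_def dest: borel_measurable_integrable)
    qed
    also have "\<dots> = (LINT x:?B|lborel. f (?R (circ t) x))"
      unfolding set_lebesgue_integral_def by (intro Bochner_Integration.integral_cong) (use memR' in \<open>auto simp: indicator_def\<close>)
    finally show ?thesis by simp
  qed
  have eq1: "(LINT x:?B|lborel. integral {0..1} (\<lambda>t. f (?R (circ t) x))) = integral {0..1} (\<lambda>t. LINT x:?B|lborel. f (?R (circ t) x))"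
  proof (rule Fubini_unit_interval(2)[where C="M * measure lborel ?B"])
    show "continuous_on ({0..1} \<times> ?B) (\<lambda>(t, x). f (?R (circ t) x))"
      unfolding case_prod_unfold
    proof (rule continuous_on_compose2[OF contf contR])
      show "(\<lambda>p. ?R (circ (fst p)) (snd p)) ` ({0..1} \<times> ?B) \<subseteq> cball \<zeta> r"
        using memR[of "circ _"] by force
    qed (intro continuous_intros)+
    fix t :: real
    have "(\<integral>\<^sup>+x. indicator ?B x * ennreal (cmod (f (?R (circ t) x))) \<partial>lborel) \<le> (\<integral>\<^sup>+x. ennreal M * indicator ?B x \<partial>lborel)"
      by (intro nn_integral_mono) (use M memR in \<open>auto simp: indicator_def intro!: ennreal_leI\<close>)
    also have "\<dots> = ennreal M * ennreal (measure lborel ?B)"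
    proof -
      have "emeasure lborel ?B = ennreal (measure lborel ?B)"
        by (rule emeasure_eq_ennreal_measure) (use emeasure_lborel_ball_finite[of \<zeta> r] in auto)
      then show ?thesis by (subst nn_integral_cmult_indicator) auto
    qed
    also have "\<dots> = ennreal (M * measure lborel ?B)"
      by (simp add: ennreal_mult'')
    finally show "(\<integral>\<^sup>+x. indicator ?B x * ennreal (cmod (f (?R (circ t) x))) \<partial>lborel) \<le> ennreal (M * measure lborel ?B)" .
  qed auto
  have eq2: "(LINT x:?B|lborel. integral {0..1} (\<lambda>t. f (?R (circ t) x))) = (LINT x:?B|lborel. f \<zeta>)"
    unfolding set_lebesgue_integral_def by (intro Bochner_Integration.integral_cong) (use avg in \<open>auto simp: indicator_def\<close>)
  have "f \<zeta> * measure lborel ?B = (LINT x:?B|lborel. f \<zeta>)"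
    unfolding set_lebesgue_integral_def by (simp add: mult.commute scaleR_conv_of_real)
  also have "\<dots> = (LINT x:?B|lborel. f x)"
    unfolding eq2[symmetric] eq1 inv by simp
  finally show ?thesis .
qed

text \<open>Applying the mean value property to \<open>f\<^sup>2\<close> makes the Cauchy-Schwarz inequality unnecessary.\<close>
lemma A2_point_bound:
  assumes D: "open D" and f: "f \<in> A2 D" and sub: "cball \<zeta> r \<subseteq> D" and r: "r > 0"
  shows "(cmod (f \<zeta>))\<^sup>2 * measure lborel (ball \<zeta> r) \<le> nrm2 D f"
proof -
  have int: "set_integrable lborel D (\<lambda>x. (cmod (f x))\<^sup>2)" using A2_sq_integrable[OF D f] .
  have sub': "ball \<zeta> r \<subseteq> D" using sub by auto
  have "(cmod (f \<zeta>))\<^sup>2 * measure lborel (ball \<zeta> r) = cmod ((f \<zeta> * f \<zeta>) * measure lborel (ball \<zeta> r))"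
    by (simp add: norm_mult power2_eq_square)
  also have "\<dots> = cmod (LINT x:ball \<zeta> r|lborel. f x * f x)"
    using f holo_mean_value[of "\<lambda>x. f x * f x" D \<zeta> r] sub r by (simp add: holo_on_mult A2_holo)
  also have "\<dots> \<le> (LINT x:ball \<zeta> r|lborel. cmod (f x * f x))"
    unfolding set_lebesgue_integral_def by (rule order_trans[OF integral_norm_bound]) simp
  also have "\<dots> = (LINT x:ball \<zeta> r|lborel. (cmod (f x))\<^sup>2)"
    by (simp add: norm_mult power2_eq_square)
  also have "\<dots> \<le> nrm2 D f"
    unfolding nrm2_def set_lebesgue_integral_def
  proof (rule integral_mono)
    show "integrable lborel (\<lambda>x. indicat_real (ball \<zeta> r) x *\<^sub>R (cmod (f x))\<^sup>2)"
      using set_integrable_subset[OF int, of "ball \<zeta> r"] sub' by (simp add: set_integrable_def)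
  qed (use int sub' in \<open>auto simp: set_integrable_def indicator_def\<close>)
  finally show ?thesis .
qed

lemma measure_ball_pos: "r > 0 \<Longrightarrow> measure lborel (ball (x::'a::euclidean_space) r) > 0"
  using content_ball_pos[of r x] by simp

lemma nrm2_eq_0:
  assumes D: "open D" and f: "f \<in> A2 D" and 0: "nrm2 D f = 0" and x: "x \<in> D"
  shows "f x = 0"
proof -
  obtain r where r: "r > 0" "cball x r \<subseteq> D"
    using D x open_contains_cball by blast
  have "(cmod (f x))\<^sup>2 * measure lborel (ball x r) \<le> 0"
    using A2_point_bound[OF D f r(2,1)] 0 by simp
  then show ?thesis using measure_ball_pos[OF r(1), of x] by (simp add: mult_le_0_iff)
qed

lemma nn_integral_sq_eq_nrm2:
  assumes "open D" "f \<in> A2 D"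
  shows "(\<integral>\<^sup>+x. ennreal (indicator D x * (cmod (f x))\<^sup>2) \<partial>lborel) = ennreal (nrm2 D f)"
  using A2_sq_integrable[OF assms] unfolding nrm2_def set_lebesgue_integral_def set_integrable_def
  by (subst nn_integral_eq_integral) auto

lemma borel_measurable_indicator_sq:
  fixes f :: "'a::euclidean_space \<Rightarrow> complex"
  assumes "open D" "continuous_on D f"
  shows "(\<lambda>x. indicator D x * (cmod (f x))\<^sup>2) \<in> borel_measurable borel"
proof -
  have "continuous_on D (\<lambda>x. (cmod (f x))\<^sup>2)" using assms by (intro continuous_intros)
  from borel_measurable_continuous_on_indicator[OF _ this] assms(1) show ?thesis by simp
qed

lemma measure_ball_eq: "measure lborel (ball (x::'a::euclidean_space) r) = measure lborel (ball (0::'a) r)"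
proof (cases "r \<ge> 0")
  case True
  then show ?thesis using content_ball_conv_unit_ball[of r x] content_ball_conv_unit_ball[of r "0::'a"] by simp
next
  case False
  then have "ball x r = {}" "ball (0::'a) r = {}" by auto
  then show ?thesis by (simp del: ball_eq_empty)
qed

text \<open>The ball of radius \<open>r\<close> around \<open>y\<close> stays in the ball of radius
  \<open>2 * r\<close> around \<open>x\<close>, so one constant serves all \<open>y\<close> near
  \<open>x\<close>.\<close>

lemma A2_uniform_bound:
  fixes f :: "complex^'i::finite \<Rightarrow> complex"
  assumes D: "open D" and f: "f \<in> A2 D" and sub: "cball x (2 * r) \<subseteq> D" and r: "r > 0" and y: "y \<in> cball x r"
  shows "(cmod (f y))\<^sup>2 \<le> nrm2 D f / measure lborel (ball (0::complex^'i) r)"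
proof -
  have "cball y r \<subseteq> D"
  proof (rule order_trans[OF _ sub])
    show "cball y r \<subseteq> cball x (2 * r)" using y by (simp add: cball_subset_cball_iff dist_commute)
  qed
  from A2_point_bound[OF D f this r] show ?thesis
    using measure_ball_pos[OF r, of "0::complex^'i"] by (simp add: measure_ball_eq[of y] field_simps)
qed

section \<open>Norm convergence, locally uniform convergence and completeness\<close>

lemma cderiv_diff:
  assumes "holo_on f D" "holo_on g D" "x \<in> D"
  shows "cderiv (\<lambda>x. f x - g x) x v = cderiv f x v - cderiv g x v"
  using cderiv_eqI[OF has_derivative_diff[OF holo_on_has_derivative(1)[OF assms(1,3)] holo_on_has_derivative(1)[OF assms(2,3)]]] by simp

text \<open>The values are bounded on \<open>cball x r\<close>, and Cauchy's inequality spends the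
  remaining distance \<open>r / 2\<close> around \<open>y\<close>.\<close>

lemma A2_cderiv_bound:
  fixes f :: "complex^'i::finite \<Rightarrow> complex"
  assumes D: "open D" and f: "f \<in> A2 D" and sub: "cball x (2 * r) \<subseteq> D" and r: "r > 0" and y: "y \<in> cball x (r / 2)"
  shows "cmod (cderiv f y v) \<le> sqrt (nrm2 D f / measure lborel (ball (0::complex^'i) r)) / (r / 2) * norm v"
proof (rule cderiv_bound[OF A2_holo[OF f]])
  have sub': "cball y (r / 2) \<subseteq> cball x r" using y by (simp add: cball_subset_cball_iff dist_commute)
  moreover have "cball x r \<subseteq> cball x (2 * r)" using r by auto
  ultimately show "cball y (r / 2) \<subseteq> D" using sub by blast
  show "cmod (f z) \<le> sqrt (nrm2 D f / measure lborel (ball (0::complex^'i) r))" if "z \<in> cball y (r / 2)" for z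
    by (rule real_le_rsqrt, rule A2_uniform_bound[OF D f sub r]) (use sub' that in blast)
qed (use r in auto)

text \<open>A Weierstrass theorem: a Cauchy sequence in norm is locally uniformly Cauchy together
  with its derivatives, so the limit is differentiable, and complex linearity of the derivative
  passes to pointwise limits.\<close>

lemma A2_Cauchy_limit_holo:
  fixes f :: "nat \<Rightarrow> complex^'i::finite \<Rightarrow> complex"
  assumes D: "open D" and f: "\<And>n. f n \<in> A2 D"
    and Cauchy: "\<And>e. e > 0 \<Longrightarrow> \<exists>N. \<forall>m\<ge>N. \<forall>n\<ge>N. nrm2 D (\<lambda>x. f m x - f n x) \<le> e"
  obtains g where "holo_on g D" "\<And>x. x \<in> D \<Longrightarrow> (\<lambda>n. f n x) \<longlonglongrightarrow> g x"
proof -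
  let ?P = "\<lambda>x r e. \<exists>N. \<forall>m\<ge>N. \<forall>n\<ge>N. \<forall>y\<in>ball x r. cmod (f m y - f n y) \<le> e \<and>
      (\<forall>v. cmod (cderiv (f m) y v - cderiv (f n) y v) \<le> e * norm v)"
  have local: "\<exists>r>0. ball x r \<subseteq> D \<and> (\<forall>e>0. ?P x r e)" if x: "x \<in> D" for x
  proof -
    obtain s where s: "s > 0" "cball x s \<subseteq> D"
      using D x open_contains_cball by blast
    define r where "r = s / 2"
    have r: "r > 0" "cball x (2 * r) \<subseteq> D" using s by (auto simp: r_def)
    let ?V = "measure lborel (ball (0::complex^'i) r)"
    have V: "?V > 0" using measure_ball_pos[OF r(1)] .
    have "?P x (r / 2) e" if e: "e > 0" for e
    proof -
      \<comment> \<open>Chosen so that both the bound \<open>d\<close> for the values and the bound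
        \<open>d / (r / 2)\<close> for the derivatives are at most \<open>e\<close>. Norms are then
        required to be at most \<open>d^2\<close> times the volume of the ball.\<close>
      define d where "d = min e (e * (r / 2))"
      have d: "d > 0" "d \<le> e" "d / (r / 2) \<le> e" using e r by (auto simp: d_def field_simps min_def)
      obtain N where N: "\<And>m n. m \<ge> N \<Longrightarrow> n \<ge> N \<Longrightarrow> nrm2 D (\<lambda>x. f m x - f n x) \<le> d\<^sup>2 * ?V"
        using Cauchy[of "d\<^sup>2 * ?V"] d V by auto
      have "cmod (f m y - f n y) \<le> e \<and> (\<forall>v. cmod (cderiv (f m) y v - cderiv (f n) y v) \<le> e * norm v)"
        if mn: "m \<ge> N" "n \<ge> N" and y: "y \<in> ball x (r / 2)" for m n y
      proof -
        have A: "(\<lambda>x. f m x - f n x) \<in> A2 D" by (intro A2_diff D f)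
        have yD: "y \<in> D" using y r by (intro subsetD[OF r(2)]) auto
        have le: "nrm2 D (\<lambda>x. f m x - f n x) / ?V \<le> d\<^sup>2"
          using N[OF mn] V by (simp add: field_simps)
        have sq: "sqrt (nrm2 D (\<lambda>x. f m x - f n x) / ?V) \<le> d"
          using real_sqrt_le_mono[OF le] d by simp
        have "(cmod (f m y - f n y))\<^sup>2 \<le> d\<^sup>2"
          by (rule order_trans[OF A2_uniform_bound[OF D A r(2,1)] le]) (use y r in auto)
        then have "cmod (f m y - f n y) \<le> d" using d by (simp add: power2_le_iff_abs_le)
        moreover have "cmod (cderiv (f m) y v - cderiv (f n) y v) \<le> e * norm v" for v
        proof -
          have "cmod (cderiv (f m) y v - cderiv (f n) y v) = cmod (cderiv (\<lambda>x. f m x - f n x) y v)"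
            using cderiv_diff[OF A2_holo[OF f] A2_holo[OF f] yD] by simp
          also have "\<dots> \<le> sqrt (nrm2 D (\<lambda>x. f m x - f n x) / ?V) / (r / 2) * norm v"
            by (rule A2_cderiv_bound[OF D A r(2,1)]) (use y in auto)
          also have "\<dots> \<le> d / (r / 2) * norm v"
            using sq r by (intro mult_right_mono divide_right_mono) auto
          also have "\<dots> \<le> e * norm v" using d by (intro mult_right_mono) auto
          finally show ?thesis .
        qed
        ultimately show ?thesis using d by auto
      qed
      then show ?thesis by blast
    qed
    moreover have "ball x (r / 2) \<subseteq> D" using r by (intro order_trans[OF _ r(2)]) auto
    ultimately show ?thesis using r(1) by (intro exI[of _ "r / 2"]) auto
  qed
  define g where "g = (\<lambda>x. lim (\<lambda>n. f n x))"
  define g' where "g' = (\<lambda>x v. lim (\<lambda>n. cderiv (f n) x v))"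
  have lim: "(\<lambda>n. f n x) \<longlonglongrightarrow> g x" if x: "x \<in> D" for x
  proof -
    have "Cauchy (\<lambda>n. f n x)"
    proof (rule metric_CauchyI)
      fix e :: real assume e: "e > 0"
      obtain r where r: "r > 0" "\<forall>e>0. ?P x r e"
        using local[OF x] by blast
      obtain N where "\<forall>m\<ge>N. \<forall>n\<ge>N. \<forall>y\<in>ball x r. cmod (f m y - f n y) \<le> e / 2"
        using r(2)[rule_format, of "e / 2"] e by auto
      then have "\<forall>m\<ge>N. \<forall>n\<ge>N. cmod (f m x - f n x) < e" using r(1) e by (smt (verit) centre_in_ball half_gt_zero_iff field_sum_of_halves)
      then show "\<exists>M. \<forall>m\<ge>M. \<forall>n\<ge>M. dist (f m x) (f n x) < e" by (auto simp: dist_norm)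
    qed
    then show ?thesis unfolding g_def by (simp add: Cauchy_convergent convergent_LIMSEQ_iff[symmetric])
  qed
  have lim': "(\<lambda>n. cderiv (f n) x v) \<longlonglongrightarrow> g' x v" if x: "x \<in> D" for x v
  proof -
    have "Cauchy (\<lambda>n. cderiv (f n) x v)"
    proof (rule metric_CauchyI)
      fix e :: real assume e: "e > 0"
      \<comment> \<open>The \<open>+ 1\<close> keeps the denominator positive when
        \<open>v = 0\<close>; the 2 makes the final inequality strict.\<close>
      define d where "d = e / (2 * (norm v + 1))"
      have d: "d > 0" using e by (simp add: d_def add_nonneg_pos)
      have dv: "d * norm v < e"
      proof -
        have "d * norm v \<le> d * (norm v + 1)" using d by simp
        also have "\<dots> = e / 2"
        proof -
          have "norm v + 1 \<noteq> 0" using norm_ge_zero[of v] by linarith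
          then show ?thesis unfolding d_def by (simp add: field_simps)
        qed
        finally show ?thesis using e by simp
      qed
      obtain r where r: "r > 0" "\<forall>e>0. ?P x r e"
        using local[OF x] by blast
      obtain N where "\<forall>m\<ge>N. \<forall>n\<ge>N. \<forall>y\<in>ball x r. \<forall>v. cmod (cderiv (f m) y v - cderiv (f n) y v) \<le> d * norm v"
        using r(2)[rule_format, OF d] by blast
      then have "\<forall>m\<ge>N. \<forall>n\<ge>N. cmod (cderiv (f m) x v - cderiv (f n) x v) < e" using r(1) dv by (meson centre_in_ball le_less_trans)
      then show "\<exists>M. \<forall>m\<ge>M. \<forall>n\<ge>M. dist (cderiv (f m) x v) (cderiv (f n) x v) < e" by (auto simp: dist_norm)
    qed
    then show ?thesis unfolding g'_def by (simp add: Cauchy_convergent convergent_LIMSEQ_iff[symmetric])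
  qed
  have der: "(g has_derivative g' x) (at x)" if x: "x \<in> D" for x
  proof -
    obtain r where r: "r > 0" "ball x r \<subseteq> D" "\<forall>e>0. ?P x r e"
      using local[OF x] by blast
    \<comment> \<open>The theorem on sequences of derivatives yields its own limit \<open>h\<close>
      on the ball; uniqueness of limits identifies it with the globally defined
      \<open>g\<close>.\<close>
    have "\<exists>h. \<forall>y\<in>ball x r. (\<lambda>n. f n y) \<longlonglongrightarrow> h y \<and> (h has_derivative g' y) (at y within ball x r)"
    proof (rule has_derivative_sequence[where ?x0.0=x and f'="\<lambda>n. cderiv (f n)"])
      show "(f n has_derivative cderiv (f n) y) (at y within ball x r)" if "y \<in> ball x r" for n y
        by (rule has_derivative_at_withinI, rule holo_on_has_derivative(1)[OF A2_holo[OF f]]) (use that r in auto)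
      show "\<forall>\<^sub>F n in sequentially. \<forall>y\<in>ball x r. \<forall>v. cmod (cderiv (f n) y v - g' y v) \<le> e * norm v" if e: "e > 0" for e
      proof -
        obtain N where N: "\<And>m n y v. m\<ge>N \<Longrightarrow> n\<ge>N \<Longrightarrow> y\<in>ball x r \<Longrightarrow> cmod (cderiv (f m) y v - cderiv (f n) y v) \<le> e * norm v"
          using r(3)[rule_format, OF e] by blast
        have "cmod (cderiv (f m) y v - g' y v) \<le> e * norm v" if "m \<ge> N" "y \<in> ball x r" for m y v
        proof (rule tendsto_upperbound)
          show "(\<lambda>n. cmod (cderiv (f m) y v - cderiv (f n) y v)) \<longlonglongrightarrow> cmod (cderiv (f m) y v - g' y v)"
            using that r by (intro tendsto_intros lim') auto
          show "\<forall>\<^sub>F n in sequentially. cmod (cderiv (f m) y v - cderiv (f n) y v) \<le> e * norm v"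
            using N[OF that(1) _ that(2)] unfolding eventually_sequentially by (intro exI[of _ N]) auto
        qed auto
        then show ?thesis unfolding eventually_sequentially by (intro exI[of _ N]) auto
      qed
    qed (use r lim[OF x] in auto)
    then obtain h where h: "\<And>y. y \<in> ball x r \<Longrightarrow> (\<lambda>n. f n y) \<longlonglongrightarrow> h y" "\<And>y. y \<in> ball x r \<Longrightarrow> (h has_derivative g' y) (at y within ball x r)"
      by blast
    have hg: "h y = g y" if "y \<in> ball x r" for y
      using LIMSEQ_unique[OF h(1)[OF that] lim] that r by auto
    have "(h has_derivative g' x) (at x)"
      using h(2)[of x] r(1) by (simp add: at_within_open[of x "ball x r"])
    then show ?thesis
      by (rule has_derivative_transform_within_open[of _ _ _ _ "ball x r"]) (use r hg in auto)
  qed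
  have lin: "g' x (c *s v) = c * g' x v" if x: "x \<in> D" for x c v
  proof (rule LIMSEQ_unique[OF lim'[OF x]])
    show "(\<lambda>n. cderiv (f n) x (c *s v)) \<longlonglongrightarrow> c * g' x v"
      unfolding holo_on_has_derivative(2)[OF A2_holo[OF f] x] by (intro tendsto_intros lim' x)
  qed
  show ?thesis
  proof (rule that)
    show "holo_on g D" by (rule holo_onI[OF der lin])
  qed (use lim in auto)
qed

text \<open>Fatou's lemma in \<open>n\<close>, with \<open>m\<close> fixed, bounds the norm of
  \<open>f m - g\<close> by the Cauchy estimate. This gives integrability of the difference and
  convergence at once.\<close>

lemma A2_complete:
  fixes f :: "nat \<Rightarrow> complex^'i::finite \<Rightarrow> complex"
  assumes D: "open D" and f: "\<And>n. f n \<in> A2 D"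
    and Cauchy: "\<And>e. e > 0 \<Longrightarrow> \<exists>N. \<forall>m\<ge>N. \<forall>n\<ge>N. nrm2 D (\<lambda>x. f m x - f n x) \<le> e"
  obtains g where "g \<in> A2 D" "(\<lambda>n. nrm2 D (\<lambda>x. f n x - g x)) \<longlonglongrightarrow> 0"
proof -
  obtain g where g: "holo_on g D" "\<And>x. x \<in> D \<Longrightarrow> (\<lambda>n. f n x) \<longlonglongrightarrow> g x"
    using A2_Cauchy_limit_holo[OF D f Cauchy] by metis
  note nn = nn_integral_sq_eq_nrm2[OF D]
  have meas: "(\<lambda>x. indicator D x * (cmod (h x))\<^sup>2) \<in> borel_measurable lborel" if "holo_on h D" for h
    using borel_measurable_indicator_sq[OF D holo_on_continuous_on[OF that]] by simp
  have Fatou: "(\<integral>\<^sup>+x. ennreal (indicator D x * (cmod (f m x - g x))\<^sup>2) \<partial>lborel) \<le> ennreal e"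
    if N: "\<forall>m\<ge>N. \<forall>n\<ge>N. nrm2 D (\<lambda>x. f m x - f n x) \<le> e" and m: "m \<ge> N" for m N e
  proof -
    have "(\<integral>\<^sup>+x. ennreal (indicator D x * (cmod (f m x - g x))\<^sup>2) \<partial>lborel)
      = (\<integral>\<^sup>+x. liminf (\<lambda>n. ennreal (indicator D x * (cmod (f m x - f n x))\<^sup>2)) \<partial>lborel)"
    proof (rule nn_integral_cong)
      fix x
      have "(\<lambda>n. ennreal (indicator D x * (cmod (f m x - f n x))\<^sup>2)) \<longlonglongrightarrow> ennreal (indicator D x * (cmod (f m x - g x))\<^sup>2)"
        using g(2)[of x] by (cases "x \<in> D") (auto intro!: tendsto_intros)
      then show "ennreal (indicator D x * (cmod (f m x - g x))\<^sup>2) = liminf (\<lambda>n. ennreal (indicator D x * (cmod (f m x - f n x))\<^sup>2))"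
        by (intro lim_imp_Liminf[symmetric]) auto
    qed
    also have "\<dots> \<le> liminf (\<lambda>n. \<integral>\<^sup>+x. ennreal (indicator D x * (cmod (f m x - f n x))\<^sup>2) \<partial>lborel)"
      by (rule nn_integral_liminf) (intro measurable_compose[OF meas measurable_ennreal] A2_holo A2_diff D f)
    also have "\<dots> = liminf (\<lambda>n. ennreal (nrm2 D (\<lambda>x. f m x - f n x)))"
      using nn[OF A2_diff[OF D f f]] by simp
    also have "\<dots> \<le> ennreal e"
    proof -
      have "eventually (\<lambda>n. ennreal (nrm2 D (\<lambda>x. f m x - f n x)) \<le> ennreal e) sequentially"
        using N m unfolding eventually_sequentially by (auto intro!: exI[of _ N] ennreal_leI)
      then show ?thesis by (intro Liminf_le) auto
    qed
    finally show ?thesis .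
  qed
  have diff: "(\<lambda>x. f m x - g x) \<in> A2 D" if N: "\<forall>m\<ge>N. \<forall>n\<ge>N. nrm2 D (\<lambda>x. f m x - f n x) \<le> e" and m: "m \<ge> N" for m N e
    unfolding A2_iff[OF D]
  proof
    show h: "holo_on (\<lambda>x. f m x - g x) D"
      using holo_on_add[OF A2_holo[OF f] holo_on_mult[OF holo_on_const g(1)], of m "-1"] by simp
    show "set_integrable lborel D (\<lambda>x. (cmod (f m x - g x))\<^sup>2)"
      unfolding set_integrable_def
      by (rule integrableI_bounded) (use meas[OF h] Fatou[OF N m] in \<open>auto intro: le_less_trans\<close>)
  qed
  obtain N where "\<forall>m\<ge>N. \<forall>n\<ge>N. nrm2 D (\<lambda>x. f m x - f n x) \<le> 1" using Cauchy[of 1] by auto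
  \<comment> \<open>Membership of \<open>g\<close> comes from
    \<open>g = f N - (f N - g)\<close>.\<close>
  from A2_diff[OF D f diff[OF this order_refl], of N] have gA: "g \<in> A2 D" by simp
  show ?thesis
  proof (rule that[OF gA])
    show "(\<lambda>n. nrm2 D (\<lambda>x. f n x - g x)) \<longlonglongrightarrow> 0"
    proof (rule metric_LIMSEQ_I)
      fix e :: real assume e: "e > 0"
      obtain N where N: "\<forall>m\<ge>N. \<forall>n\<ge>N. nrm2 D (\<lambda>x. f m x - f n x) \<le> e / 2" using Cauchy[of "e / 2"] e by auto
      have "nrm2 D (\<lambda>x. f m x - g x) < e" if "m \<ge> N" for m
        using Fatou[OF N that] nn[OF diff[OF N that]] e nrm2_nonneg[of D "\<lambda>x. f m x - g x"] by (simp add: ennreal_le_iff)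
      then show "\<exists>N. \<forall>n\<ge>N. dist (nrm2 D (\<lambda>x. f n x - g x)) 0 < e" using nrm2_nonneg[of D] by (auto simp: abs_of_nonneg)
    qed
  qed
qed

section \<open>Existence and uniqueness of the Bergman kernel\<close>

lemma ip_Cauchy_Schwarz:
  assumes D: "open D" and f: "f \<in> A2 D" and h: "h \<in> A2 D"
  shows "(cmod (ip D f h))\<^sup>2 \<le> nrm2 D f * nrm2 D h"
proof (cases "nrm2 D h = 0")
  case True
  \<comment> \<open>A function in \<open>A2 D\<close> of norm zero vanishes at every point of
    \<open>D\<close>, not just almost everywhere.\<close>
  have "ip D f h = ip D f (\<lambda>x. 0 * h x)"
    by (rule ip_cong) (use nrm2_eq_0[OF D h True] in auto)
  then show ?thesis using True unfolding ip_cmult_right by simp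
next
  case False
  then have pos: "nrm2 D h > 0" using nrm2_nonneg[of D h] by simp
  define a where "a = ip D f h"
  \<comment> \<open>The minimiser of the norm of \<open>f + c h\<close>; the minimum being
    nonnegative is the inequality.\<close>
  define c where "c = - a / nrm2 D h"
  have "nrm2 D (\<lambda>x. f x + c * h x) = nrm2 D f + (cmod c)\<^sup>2 * nrm2 D h + 2 * Re (cnj c * a)"
    by (simp add: nrm2_add[OF D f A2_cmult[OF D h]] nrm2_cmult ip_cmult_right a_def)
  also have "cnj c * a = - (complex_of_real ((cmod a)\<^sup>2 / nrm2 D h))"
    unfolding c_def of_real_divide complex_norm_square by (simp add: mult.commute)
  also have "(cmod c)\<^sup>2 * nrm2 D h = (cmod a)\<^sup>2 / nrm2 D h"
    using pos by (simp add: c_def norm_divide power_divide power2_eq_square)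
  finally have "nrm2 D f - (cmod a)\<^sup>2 / nrm2 D h \<ge> 0"
    using nrm2_nonneg[of D "\<lambda>x. f x + c * h x"] by simp
  then show ?thesis using pos by (simp add: a_def field_simps)
qed

text \<open>The element \<open>g\<close> of least norm on the hyperplane
  \<open>\<Lambda> = 1\<close> is orthogonal to the kernel of \<Lambda>, and \<kappa> is
  \<open>g\<close> divided by its squared norm. Minimising sequences converge by the parallelogram
  law and completeness.\<close>

lemma A2_riesz:
  assumes D: "open D"
    and add: "\<And>f g. f \<in> A2 D \<Longrightarrow> g \<in> A2 D \<Longrightarrow> \<Lambda> (\<lambda>x. f x + g x) = \<Lambda> f + \<Lambda> g"
    and scale: "\<And>f c. f \<in> A2 D \<Longrightarrow> \<Lambda> (\<lambda>x. c * f x) = c * \<Lambda> f"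
    and bound: "\<And>f. f \<in> A2 D \<Longrightarrow> (cmod (\<Lambda> f))\<^sup>2 \<le> C * nrm2 D f"
  obtains \<kappa> where "\<kappa> \<in> A2 D" "\<And>f. f \<in> A2 D \<Longrightarrow> \<Lambda> f = ip D f \<kappa>"
proof (cases "\<forall>f\<in>A2 D. \<Lambda> f = 0")
  case True
  have "ip D f (\<lambda>x. 0 * 0) = 0" for f unfolding ip_cmult_right by simp
  then show ?thesis using that[OF A2_zero[OF D]] True by simp
next
  case False
  then obtain f0 where f0: "f0 \<in> A2 D" "\<Lambda> f0 \<noteq> 0" by blast
  define M where "M = {f \<in> A2 D. \<Lambda> f = 1}"
  have M_ne: "(\<lambda>x. (1 / \<Lambda> f0) * f0 x) \<in> M"
    unfolding M_def mem_Collect_eq scale[OF f0(1)] using f0(2) A2_cmult[OF D f0(1)] by (intro conjI) (blast, simp)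
  define d where "d = Inf (nrm2 D ` M)"
  have bdd: "bdd_below (nrm2 D ` M)" by (rule bdd_belowI[of _ 0]) (auto simp: nrm2_nonneg)
  have d_le: "d \<le> nrm2 D f" if "f \<in> M" for f
    unfolding d_def using bdd that by (intro cInf_lower) auto
  have "\<exists>f\<in>M. nrm2 D f < d + 1 / real (Suc n)" for n
    using cInf_lessD[of "nrm2 D ` M" "d + 1 / real (Suc n)"] M_ne by (auto simp: d_def)
  then obtain f where f: "\<And>n. f n \<in> M" "\<And>n. nrm2 D (f n) < d + 1 / real (Suc n)" by metis
  have fA: "f n \<in> A2 D" for n using f(1)[of n] by (simp add: M_def)
  have fL: "\<Lambda> (f n) = 1" for n using f(1)[of n] by (simp add: M_def)
  \<comment> \<open>The midpoint of \<open>f m\<close> and \<open>f n\<close> lies in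
    \<open>M\<close> again, so \<open>f m + f n\<close> has squared norm at least
    \<open>4 * d\<close>; the parallelogram law turns this into smallness of the difference.\<close>
  have para: "nrm2 D (\<lambda>x. f m x - f n x) \<le> 2 / real (Suc m) + 2 / real (Suc n)" for m n
  proof -
    have "(\<lambda>x. (1/2) * (f m x + f n x)) \<in> M"
      unfolding M_def mem_Collect_eq scale[OF A2_add[OF D fA fA]] add[OF fA fA] fL
      using A2_cmult[OF D A2_add[OF D fA fA]] by (intro conjI) (blast, simp)
    from d_le[OF this] have "4 * d \<le> nrm2 D (\<lambda>x. f m x + f n x)"
      unfolding nrm2_cmult by (simp add: power2_eq_square norm_divide)
    moreover have "nrm2 D (\<lambda>x. f m x + f n x) = nrm2 D (f m) + nrm2 D (f n) + 2 * Re (ip D (f m) (f n))"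
      by (intro nrm2_add D fA)
    moreover have "nrm2 D (\<lambda>x. f m x - f n x) = nrm2 D (f m) + nrm2 D (f n) - 2 * Re (ip D (f m) (f n))"
      using nrm2_add[OF D fA A2_cmult[OF D fA], of m "-1" n] ip_cmult_right[of D "f m" "-1" "f n"] nrm2_cmult[of D "-1" "f n"] by simp
    ultimately have "nrm2 D (\<lambda>x. f m x - f n x) \<le> 2 * (1 / real (Suc m)) + 2 * (1 / real (Suc n))"
      using f(2)[of m] f(2)[of n] by linarith
    then show ?thesis by simp
  qed
  have Cauchy: "\<exists>N. \<forall>m\<ge>N. \<forall>n\<ge>N. nrm2 D (\<lambda>x. f m x - f n x) \<le> e" if e: "e > 0" for e
  proof -
    obtain N where N: "1 / real (Suc N) < e / 4" using e nat_approx_posE[of "e / 4"] by (auto simp: divide_simps)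
    have "nrm2 D (\<lambda>x. f m x - f n x) \<le> e" if "m \<ge> N" "n \<ge> N" for m n
    proof -
      have "1 / real (Suc m) \<le> 1 / real (Suc N)" "1 / real (Suc n) \<le> 1 / real (Suc N)"
        using that by (auto intro!: divide_left_mono)
      then have "2 / real (Suc m) + 2 / real (Suc n) \<le> 4 * (1 / real (Suc N))" by simp
      then show ?thesis using para[of m n] N by linarith
    qed
    then show ?thesis by blast
  qed
  obtain g where g: "g \<in> A2 D" "(\<lambda>n. nrm2 D (\<lambda>x. f n x - g x)) \<longlonglongrightarrow> 0"
    using A2_complete[OF D fA Cauchy] by metis
  have dA: "(\<lambda>x. f n x - g x) \<in> A2 D" for n by (intro A2_diff D fA g)
  have Lg: "\<Lambda> g = 1"
  proof -
    have "\<Lambda> (\<lambda>x. f n x - g x) = 1 - \<Lambda> g" for n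
      using add[OF fA A2_cmult[OF D g(1)], of n "-1"] scale[OF g(1), of "-1"] fL by simp
    then have "(cmod (1 - \<Lambda> g))\<^sup>2 \<le> C * nrm2 D (\<lambda>x. f n x - g x)" for n
      using bound[OF dA, of n] by simp
    moreover have "(\<lambda>n. C * nrm2 D (\<lambda>x. f n x - g x)) \<longlonglongrightarrow> C * 0"
      by (intro tendsto_intros g)
    ultimately have "(cmod (1 - \<Lambda> g))\<^sup>2 \<le> C * 0"
      by (intro tendsto_lowerbound) auto
    then show ?thesis by simp
  qed
  have orth: "ip D g h = 0" if h: "h \<in> A2 D" "\<Lambda> h = 0" for h
  proof -
    define a where "a = ip D g h"
    have ipn: "(\<lambda>n. ip D (f n) h) \<longlonglongrightarrow> a"
    proof -
      have "(\<lambda>n. ip D (f n) h - a) \<longlonglongrightarrow> 0"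
      proof (rule tendsto_norm_zero_cancel, rule tendsto_sandwich[where f="\<lambda>_. 0" and h="\<lambda>n. sqrt (nrm2 D (\<lambda>x. f n x - g x) * nrm2 D h)"])
        have "norm (ip D (f n) h - a) \<le> sqrt (nrm2 D (\<lambda>x. f n x - g x) * nrm2 D h)" for n
        proof -
          have "ip D (\<lambda>x. f n x - g x) h = ip D (f n) h - a"
            using ip_add_left[OF D fA A2_cmult[OF D g(1)] h(1), of n "-1"] ip_cmult_left[of D "-1" g h] by (simp add: a_def)
          then show ?thesis using ip_Cauchy_Schwarz[OF D dA h(1), of n] real_le_rsqrt by simp
        qed
        then show "\<forall>\<^sub>F n in sequentially. norm (ip D (f n) h - a) \<le> sqrt (nrm2 D (\<lambda>x. f n x - g x) * nrm2 D h)"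
          by simp
        have "(\<lambda>n. sqrt (nrm2 D (\<lambda>x. f n x - g x) * nrm2 D h)) \<longlonglongrightarrow> sqrt (0 * nrm2 D h)"
          by (intro tendsto_intros g)
        then show "(\<lambda>n. sqrt (nrm2 D (\<lambda>x. f n x - g x) * nrm2 D h)) \<longlonglongrightarrow> 0" by simp
      qed auto
      then show ?thesis by (simp add: LIM_zero_iff)
    qed
    \<comment> \<open>Adding a multiple of \<open>h\<close> stays in \<open>M\<close>, so the norm
      cannot fall below \<open>d\<close>; let \<open>n\<close> tend to infinity.\<close>
    have ge: "0 \<le> (cmod c)\<^sup>2 * nrm2 D h + 2 * Re (cnj c * a)" for c
    proof -
      have "d \<le> d + 1 / real (Suc n) + ((cmod c)\<^sup>2 * nrm2 D h + 2 * Re (cnj c * ip D (f n) h))" for n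
      proof -
        have "(\<lambda>x. f n x + c * h x) \<in> M"
          using add[OF fA A2_cmult[OF D h(1)], of n c] scale[OF h(1), of c] fL h(2)
          by (simp add: M_def A2_add A2_cmult D fA h(1))
        from d_le[OF this] show ?thesis
          using f(2)[of n] by (simp add: nrm2_add[OF D fA A2_cmult[OF D h(1)]] nrm2_cmult ip_cmult_right)
      qed
      moreover have "(\<lambda>n. d + 1 / real (Suc n) + ((cmod c)\<^sup>2 * nrm2 D h + 2 * Re (cnj c * ip D (f n) h)))
           \<longlonglongrightarrow> d + 0 + ((cmod c)\<^sup>2 * nrm2 D h + 2 * Re (cnj c * a))"
        by (intro tendsto_intros ipn LIMSEQ_Suc[OF lim_1_over_n])
      ultimately have "d \<le> d + 0 + ((cmod c)\<^sup>2 * nrm2 D h + 2 * Re (cnj c * a))"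
        by (intro tendsto_lowerbound) auto
      then show ?thesis by simp
    qed
    \<comment> \<open>Test with \<open>c = - s a\<close>: as \<open>s * nrm2 D h <= 1\<close>, the
      expression in \<open>ge\<close> is at most \<open>- s |a|^2\<close>, which forces
      \<open>a = 0\<close>. The \<open>+ 1\<close> covers \<open>nrm2 D h = 0\<close>.\<close>
    define s where "s = 1 / (nrm2 D h + 1)"
    have s: "s > 0" "s * nrm2 D h \<le> 1"
      using nrm2_nonneg[of D h] by (auto simp: s_def field_simps add_nonneg_pos)
    have eq: "cnj (- (of_real s * a)) * a = of_real (- s * (cmod a)\<^sup>2)"
      unfolding of_real_mult complex_norm_square by (simp add: mult_ac)
    have "0 \<le> s\<^sup>2 * (cmod a)\<^sup>2 * nrm2 D h + 2 * (- s * (cmod a)\<^sup>2)"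
      using ge[of "- (of_real s * a)"] unfolding eq Re_complex_of_real by (simp add: norm_mult power_mult_distrib)
    also have "\<dots> = s * (cmod a)\<^sup>2 * (s * nrm2 D h - 2)" by (simp add: algebra_simps power2_eq_square)
    finally have "0 \<le> s * (cmod a)\<^sup>2 * (s * nrm2 D h - 2)" .
    then have "s * (cmod a)\<^sup>2 \<le> 0" using s by (auto simp: zero_le_mult_iff)
    then show ?thesis using s by (simp add: a_def mult_le_0_iff)
  qed
  have pos: "nrm2 D g \<noteq> 0"
    using bound[OF g(1)] Lg by auto
  show ?thesis
  proof (rule that)
    show "(\<lambda>x. (1 / nrm2 D g) * g x) \<in> A2 D" by (intro A2_cmult D g)
    fix u assume u: "u \<in> A2 D"
    have hA: "(\<lambda>x. u x + (- \<Lambda> u) * g x) \<in> A2 D" by (intro A2_add A2_cmult D u g)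
    have "\<Lambda> (\<lambda>x. u x + (- \<Lambda> u) * g x) = 0"
      using add[OF u A2_cmult[OF D g(1), of "- \<Lambda> u"]] scale[OF g(1), of "- \<Lambda> u"] Lg by simp
    from orth[OF hA this] have "ip D (\<lambda>x. u x + (- \<Lambda> u) * g x) g = 0"
      by (metis ip_cnj complex_cnj_zero)
    then have "ip D u g = \<Lambda> u * nrm2 D g"
      unfolding ip_add_left[OF D u A2_cmult[OF D g(1)] g(1)] ip_cmult_left ip_self by simp
    then show "\<Lambda> u = ip D u (\<lambda>x. (1 / nrm2 D g) * g x)"
      unfolding ip_cmult_right using pos by simp
  qed
qed

lemma A2_eval_bound:
  assumes D: "open D" and z: "z \<in> D"
  obtains C where "\<And>f. f \<in> A2 D \<Longrightarrow> (cmod (f z))\<^sup>2 \<le> C * nrm2 D f"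
proof -
  obtain r where r: "r > 0" "cball z r \<subseteq> D" using D z open_contains_cball by blast
  show ?thesis
  proof (rule that)
    fix f assume "f \<in> A2 D"
    from A2_point_bound[OF D this r(2,1)] show "(cmod (f z))\<^sup>2 \<le> 1 / measure lborel (ball z r) * nrm2 D f"
      using measure_ball_pos[OF r(1), of z] by (simp add: pos_le_divide_eq)
  qed
qed

text \<open>The description in \<open>bergman_kernel\<close> needs existence and uniqueness as a
  function on the whole type. Existence is Riesz representation of point evaluations, cut off
  outside \<open>D\<close>; uniqueness outside \<open>D\<close> comes from the normalisation to
  0.\<close>

lemma is_bergman_kernel_bergman_kernel:
  assumes D: "open D"
  shows "is_bergman_kernel D (bergman_kernel D)"
proof -
  have "\<exists>k. k \<in> A2 D \<and> (\<forall>f\<in>A2 D. f \<zeta> = ip D f k)" if z: "\<zeta> \<in> D" for \<zeta>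
  proof -
    obtain C where C: "\<And>f. f \<in> A2 D \<Longrightarrow> (cmod (f \<zeta>))\<^sup>2 \<le> C * nrm2 D f"
      using A2_eval_bound[OF D z] by blast
    show ?thesis by (rule A2_riesz[OF D, of "\<lambda>f. f \<zeta>" C]) (use C in auto)
  qed
  then obtain k where k: "\<And>\<zeta>. \<zeta> \<in> D \<Longrightarrow> k \<zeta> \<in> A2 D" "\<And>\<zeta> f. \<zeta> \<in> D \<Longrightarrow> f \<in> A2 D \<Longrightarrow> f \<zeta> = ip D f (k \<zeta>)"
    by metis
  define K where "K = (\<lambda>x \<zeta>. if x \<in> D \<and> \<zeta> \<in> D then k \<zeta> x else 0)"
  have KA: "(\<lambda>x. K x \<zeta>) \<in> A2 D" if "\<zeta> \<in> D" for \<zeta>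
    by (rule A2_cong[OF D _ k(1)[OF that]]) (use that in \<open>auto simp: K_def\<close>)
  have "is_bergman_kernel D K"
    unfolding is_bergman_kernel_def
  proof (intro conjI ballI allI impI)
    fix f \<zeta> assume f: "f \<in> A2 D" and z: "\<zeta> \<in> D"
    have "f \<zeta> = ip D f (\<lambda>x. K x \<zeta>)"
      unfolding k(2)[OF z f] by (rule ip_cong) (use z in \<open>auto simp: K_def\<close>)
    then show "f \<zeta> = integral D (\<lambda>x. f x * cnj (K x \<zeta>))"
      using A2_integral_eq_ip[OF D f KA[OF z]] by simp
  qed (use KA in \<open>auto simp: K_def\<close>)
  moreover have "K' = K" if K': "is_bergman_kernel D K'" for K'
  proof (intro ext)
    fix x \<zeta>
    show "K' x \<zeta> = K x \<zeta>"
    proof (cases "x \<in> D \<and> \<zeta> \<in> D")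
      case False
      then show ?thesis using K' unfolding is_bergman_kernel_def K_def by auto
    next
      case True
      have K'A: "(\<lambda>x. K' x \<zeta>) \<in> A2 D" using K' True unfolding is_bergman_kernel_def by blast
      \<comment> \<open>Both candidates evaluate at \<open>\<zeta>\<close>, so their difference is
        orthogonal to itself.\<close>
      let ?u = "\<lambda>x. K' x \<zeta> + (-1) * k \<zeta> x"
      have u: "?u \<in> A2 D" by (intro A2_add A2_cmult D K'A k) (use True in auto)
      have rep: "?u \<zeta> = ip D ?u (\<lambda>x. K' x \<zeta>)"

      proof -
        have "f \<zeta> = integral D (\<lambda>x. f x * cnj (K' x \<zeta>))" if "f \<in> A2 D" for f
          using K' that True unfolding is_bergman_kernel_def by blast
        from this[OF u] show ?thesis unfolding A2_integral_eq_ip[OF D u K'A] .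
      qed
      have "ip D ?u ?u = ip D ?u (\<lambda>x. K' x \<zeta>) + cnj (-1) * ip D ?u (k \<zeta>)"
        using ip_add_right[OF D K'A A2_cmult[OF D k(1)] u, of \<zeta> "-1"] True unfolding ip_cmult_right by simp
      also have "\<dots> = 0"
        using k(2)[OF conjunct2[OF True] u] rep by simp
      finally have "nrm2 D ?u = 0" by (simp add: ip_self)
      from nrm2_eq_0[OF D u this conjunct1[OF True]] show ?thesis using True by (simp add: K_def)
    qed
  qed
  ultimately show ?thesis unfolding bergman_kernel_def by (rule theI)
qed

lemma bergman_kernel_A2: "open D \<Longrightarrow> \<zeta> \<in> D \<Longrightarrow> (\<lambda>x. bergman_kernel D x \<zeta>) \<in> A2 D"
  using is_bergman_kernel_bergman_kernel[of D] unfolding is_bergman_kernel_def by blast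

lemma bergman_kernel_reproducing:
  assumes D: "open D" and z: "\<zeta> \<in> D" and f: "f \<in> A2 D"
  shows "ip D f (\<lambda>x. bergman_kernel D x \<zeta>) = f \<zeta>"
proof -
  have "f \<zeta> = integral D (\<lambda>x. f x * cnj (bergman_kernel D x \<zeta>))"
    using is_bergman_kernel_bergman_kernel[OF D] z f unfolding is_bergman_kernel_def by blast
  then show ?thesis using A2_integral_eq_ip[OF D f bergman_kernel_A2[OF D z]] by simp
qed

text \<open>Apply \<open>rep\<close> to the kernel function of \<open>x\<close>: by Hermitian
  symmetry its value at \<open>\<zeta>\<close> is the conjugate of \<open>K x \<zeta>\<close>, and
  the conjugate of its pairing with \<open>G\<close> is \<open>G x\<close>.\<close>

lemma bergman_kernel_eqI:
  assumes D: "open D" and z: "\<zeta> \<in> D" and G: "G \<in> A2 D" and rep: "\<And>f. f \<in> A2 D \<Longrightarrow> ip D f G = f \<zeta>" and x: "x \<in> D"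
  shows "bergman_kernel D x \<zeta> = G x"
proof -
  have "bergman_kernel D x \<zeta> = ip D (\<lambda>x. bergman_kernel D x \<zeta>) (\<lambda>y. bergman_kernel D y x)"
    by (rule bergman_kernel_reproducing[OF D x bergman_kernel_A2[OF D z], symmetric])
  also have "\<dots> = cnj (ip D (\<lambda>y. bergman_kernel D y x) (\<lambda>x. bergman_kernel D x \<zeta>))"
    by (simp add: ip_cnj)
  also have "ip D (\<lambda>y. bergman_kernel D y x) (\<lambda>x. bergman_kernel D x \<zeta>) = bergman_kernel D \<zeta> x"
    by (rule bergman_kernel_reproducing[OF D z bergman_kernel_A2[OF D x]])
  also have "\<dots> = ip D (\<lambda>y. bergman_kernel D y x) G"
    by (rule rep[OF bergman_kernel_A2[OF D x], symmetric])
  also have "cnj \<dots> = ip D G (\<lambda>y. bergman_kernel D y x)" by (rule ip_cnj)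
  also have "\<dots> = G x" by (rule bergman_kernel_reproducing[OF D x G])
  finally show ?thesis .
qed

section \<open>Dilations of star-shaped Hartogs domains\<close>

lemma circ_nonzero [simp]: "circ x \<noteq> 0"
  by (simp add: circ_def)

lemma star_hartogs_diag_scale:
  assumes "star_hartogs J V" "x \<in> V" "\<And>j. j \<in> J \<Longrightarrow> cmod (c j) \<le> 1" "\<And>i. i \<notin> J \<Longrightarrow> c i = 1"
  shows "diag_scale c x \<in> V"
proof -
  have "diag_scale c x = (\<chi> i. if i \<in> J then c i * x $ i else x $ i)"
    using assms(4) by (auto simp: vec_eq_iff)
  then show ?thesis using assms(1-3) unfolding star_hartogs_def by auto
qed

lemma holo_on_diag_scale:
  assumes "holo_on f D" "\<And>x. x \<in> E \<Longrightarrow> diag_scale c x \<in> D"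
  shows "holo_on (\<lambda>x. f (diag_scale c x)) E"
  by (rule holo_on_compose[OF assms(1)]) (auto intro!: holo_on_mult holo_on_const holo_on_nth assms(2))

lemma A2I_nn_integral:
  assumes D: "open D" and f: "holo_on f D"
    and fin: "(\<integral>\<^sup>+x. ennreal (indicator D x * (cmod (f x))\<^sup>2) \<partial>lborel) < \<infinity>"
  shows "f \<in> A2 D"
  unfolding A2_iff[OF D]
proof
  show "set_integrable lborel D (\<lambda>x. (cmod (f x))\<^sup>2)"
    unfolding set_integrable_def
    by (rule integrableI_bounded)
       (use borel_measurable_indicator_sq[OF D holo_on_continuous_on[OF f]] fin in auto)
qed (rule f)

text \<open>Changing variables, the squared norm of the composite is a constant times an integral of
  \<open>|f|^2\<close> over a part of \<open>V\<close>.\<close>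

lemma A2_diag_scale:
  assumes V: "open V" and f: "f \<in> A2 V" and c: "\<And>i. c i \<noteq> 0" and sub: "\<And>x. x \<in> V \<Longrightarrow> diag_scale c x \<in> V"
  shows "(\<lambda>x. f (diag_scale c x)) \<in> A2 V"
proof (rule A2I_nn_integral[OF V holo_on_diag_scale[OF A2_holo[OF f] sub]])
  let ?F = "\<lambda>x. ennreal (indicator V x * (cmod (f x))\<^sup>2)"
  have F: "?F \<in> borel_measurable borel"
    using borel_measurable_indicator_sq[OF V A2_continuous_on[OF f]] by simp
  have P: "(\<Prod>i\<in>UNIV. (cmod (c i))\<^sup>2) > 0" using c by (intro prod_pos) auto
  have "ennreal (\<Prod>i\<in>UNIV. (cmod (c i))\<^sup>2) * (\<integral>\<^sup>+x. ?F (diag_scale c x) \<partial>lborel) < \<infinity>"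
    using nn_integral_diag_scale[OF c F] nn_integral_sq_eq_nrm2[OF V f] by simp
  then have fin: "(\<integral>\<^sup>+x. ?F (diag_scale c x) \<partial>lborel) < \<infinity>"
    using P c by (auto simp: ennreal_mult_less_top)
  show "(\<integral>\<^sup>+x. ennreal (indicator V x * (cmod (f (diag_scale c x)))\<^sup>2) \<partial>lborel) < \<infinity>"
    by (rule le_less_trans[OF nn_integral_mono fin]) (use sub in \<open>auto simp: indicator_def\<close>)
qed auto

lemma distr_diag_scale_unimodular:
  fixes c :: "'i::finite \<Rightarrow> complex"
  assumes "\<And>i. cmod (c i) = 1"
  shows "distr lborel borel (diag_scale c) = (lborel :: (complex^'i) measure)"
proof (rule distr_eq_lborel_if_nn_integral)
  have c0: "c i \<noteq> 0" for i using assms[of i] by auto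
  show "(\<integral>\<^sup>+x. F (diag_scale c x) \<partial>lborel) = (\<integral>\<^sup>+x. F x \<partial>lborel)" if "F \<in> borel_measurable borel" for F :: "complex^'i \<Rightarrow> ennreal"
    using nn_integral_diag_scale[OF c0 that] assms by simp
qed auto

text \<open>The non-integrable case is included, where both sides are the default value; reflections
  can then be made without checking integrability.\<close>

lemma integral_reflect_unit_interval:
  fixes F :: "real \<Rightarrow> complex"
  shows "integral {0..1} (\<lambda>x. F (1 - x)) = integral {0..1} F"
proof -
  have hi: "((\<lambda>x. G (1 - x)) has_integral i) {0..1}" if "(G has_integral i) {0..1}" for G :: "real \<Rightarrow> complex" and i
  proof -
    have "((\<lambda>x. G (- 1 *\<^sub>R x + 1)) has_integral (1 / \<bar>- 1\<bar> ^ DIM(real)) *\<^sub>R i) ((\<lambda>x. (1 / - 1) *\<^sub>R x + - ((1 / - 1) *\<^sub>R 1)) ` cbox 0 1)"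
      using that by (intro has_integral_affinity) auto
    moreover have "(\<lambda>x::real. (1 / - 1) *\<^sub>R x + - ((1 / - 1) *\<^sub>R 1)) ` cbox 0 1 = {0..1}"
      by (auto simp: image_iff intro!: bexI[of _ "1 - _"])
    ultimately show ?thesis by simp
  qed
  show ?thesis
  proof (cases "F integrable_on {0..1}")
    case True
    then show ?thesis using hi[of F "integral {0..1} F"] by (simp add: has_integral_iff)
  next
    case False
    then have "\<not> (\<lambda>x. F (1 - x)) integrable_on {0..1}"
      using hi[of "\<lambda>x. F (1 - x)"] by (auto simp: integrable_on_def)
    then show ?thesis using False by (simp add: not_integrable_integral)
  qed
qed

text \<open>The Cauchy kernel on the unit circle satisfies \<open>C (cnj \<lambda>) = cnj (C \<lambda>)\<close>, so the radial
  dilation, a superposition of rotations weighted by it, is self-adjoint.\<close>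
lemma ip_dilate_coordinate:
  fixes V :: "(complex^'n::finite) set"
  assumes V: "open V" and star: "star_hartogs J V" and j: "j \<in> J" and t: "0 < t" "t < 1"
    and f: "f \<in> A2 V" and g: "g \<in> A2 V"
  shows "ip V (\<lambda>x. f (diag_scale (\<lambda>i. if i = j then of_real t else 1) x)) g
       = ip V f (\<lambda>x. g (diag_scale (\<lambda>i. if i = j then of_real t else 1) x))"
proof -
  define S where "S = (\<lambda>c::complex. diag_scale (\<lambda>i::'n. if i = j then c else 1))"
  define C where "C = (\<lambda>\<theta>. circ \<theta> / (circ \<theta> - of_real t))"
  have SV: "S c x \<in> V" if "cmod c \<le> 1" "x \<in> V" for c x
    unfolding S_def by (rule star_hartogs_diag_scale[OF star that(2)]) (use that j in auto)
  have SS: "S a (S b x) = S (a * b) x" for a b x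
    by (simp add: S_def vec_eq_iff)
  have S1: "S 1 x = x" for x by (simp add: S_def vec_eq_iff)
  have SVc: "S (circ \<theta>) x \<in> V \<longleftrightarrow> x \<in> V" for \<theta> x
    using SV[of "circ \<theta>" x] SV[of "cnj (circ \<theta>)" "S (circ \<theta>) x"] by (auto simp: SS S1)
  have contS: "continuous_on X (\<lambda>p. S (u p) (v p))" if "continuous_on X u" "continuous_on X v" for X :: "'z::topological_space set" and u v
  proof -
    have "continuous_on X (\<lambda>p. (if i = j then u p else 1) * v p $ i)" for i
      using that by (cases "i = j") (auto intro!: continuous_intros)
    then show ?thesis unfolding S_def diag_scale_def by (intro continuous_on_vec_lambda) auto
  qed
  have circ_t: "circ \<theta> \<noteq> of_real t" for \<theta>
    using norm_circ[of \<theta>] t by (metis abs_of_pos less_irrefl norm_of_real)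
  have Cb: "cmod (C \<theta>) \<le> 1 / (1 - t)" for \<theta>
  proof -
    have "1 - t \<le> cmod (circ \<theta> - of_real t)"
      using norm_triangle_ineq2[of "circ \<theta>" "of_real t"] t by simp
    then show ?thesis using t unfolding C_def norm_divide norm_circ by (intro divide_left_mono mult_pos_pos) linarith+
  qed
  \<comment> \<open>A rotation preserves \<open>V\<close> and the measure, so its adjoint is the
    inverse rotation, which is the rotation at the reflected parameter
    \<open>1 - \<theta>\<close>.\<close>
  have rot: "ip V (\<lambda>x. h (S (circ \<theta>) x)) k = ip V h (\<lambda>x. k (S (circ (1 - \<theta>)) x))" if h: "h \<in> A2 V" and k: "k \<in> A2 V" for h k \<theta>
  proof -
    let ?R = "S (circ \<theta>)"
    have "(\<lambda>x. k (S (circ (1 - \<theta>)) x)) \<in> A2 V"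
      unfolding S_def by (rule A2_diag_scale[OF V k]) (use SV in \<open>auto simp: S_def\<close>)
    then have m: "(\<lambda>x. indicator V x *\<^sub>R (h x * cnj (k (S (circ (1 - \<theta>)) x)))) \<in> borel_measurable borel"
      using A2_mult_cnj_integrable[OF V h] by (auto simp: set_integrable_def dest!: borel_measurable_integrable)
    have d: "distr lborel borel ?R = lborel"
      unfolding S_def by (rule distr_diag_scale_unimodular) auto
    have "ip V h (\<lambda>x. k (S (circ (1 - \<theta>)) x)) = (LINT x|distr lborel borel ?R. indicator V x *\<^sub>R (h x * cnj (k (S (circ (1 - \<theta>)) x))))"
      by (simp add: d ip_def set_lebesgue_integral_def)
    also have "\<dots> = (LINT x|lborel. indicator V (?R x) *\<^sub>R (h (?R x) * cnj (k (S (circ (1 - \<theta>)) (?R x)))))"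
      by (rule integral_distr) (use m in \<open>auto simp: S_def\<close>)
    also have "\<dots> = ip V (\<lambda>x. h (S (circ \<theta>) x)) k"
      unfolding ip_def set_lebesgue_integral_def
      by (intro Bochner_Integration.integral_cong) (auto simp: SS S1 SVc circ_reflect indicator_def)
    finally show ?thesis by simp
  qed
  have main: "ip V (\<lambda>x. h (S (of_real t) x)) k = integral {0..1} (\<lambda>\<theta>. C \<theta> * ip V (\<lambda>x. h (S (circ \<theta>) x)) k)"
    if h: "h \<in> A2 V" and k: "k \<in> A2 V" for h k
  proof -
    let ?H = "\<lambda>\<theta> x. C \<theta> * (h (S (circ \<theta>) x) * cnj (k x))"
    have "integral {0..1} (\<lambda>\<theta>. ?H \<theta> x) = h (S (of_real t) x) * cnj (k x)" if x: "x \<in> V" for x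
    proof -
      \<comment> \<open>An open neighbourhood of the closed disc, by star-shapedness; it makes
        \<open>h (S c x)\<close> holomorphic across the unit circle.\<close>
      define T where "T = (\<lambda>c. S c x) -` V"
      have oT: "open T" unfolding T_def by (intro open_vimage V contS continuous_intros)
      have sub: "cball 0 1 \<subseteq> T" using SV x by (auto simp: T_def)
      have hol: "(\<lambda>c. h (S c x)) holomorphic_on T"
      proof (rule holo_curve_holomorphic[OF A2_holo[OF h] _ oT])
        show "(\<lambda>c. S c x $ i) holomorphic_on T" for i
          by (cases "i = j") (auto simp: S_def intro!: holomorphic_intros)
      qed (simp add: T_def)
      have "((\<lambda>\<theta>. circ \<theta> / (circ \<theta> - of_real t) * h (S (circ \<theta>) x)) has_integral h (S (of_real t) x)) {0..1}"
      proof (rule Cauchy_unit_circle)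
        show "(\<lambda>c. h (S c x)) holomorphic_on ball 0 1"
          by (rule holomorphic_on_subset[OF hol]) (use sub in auto)
        show "continuous_on (cball 0 1) (\<lambda>c. h (S c x))"
          by (rule holomorphic_on_imp_continuous_on[OF holomorphic_on_subset[OF hol sub]])
      qed (use t in auto)
      from has_integral_mult_left[OF this, of "cnj (k x)"] show ?thesis
        by (simp add: has_integral_iff C_def mult.assoc)
    qed
    then have "ip V (\<lambda>x. h (S (of_real t) x)) k = (LINT x:V|lborel. integral {0..1} (\<lambda>\<theta>. ?H \<theta> x))"
      unfolding ip_def set_lebesgue_integral_def by (intro Bochner_Integration.integral_cong) (auto simp: indicator_def)
    also have "\<dots> = integral {0..1} (\<lambda>\<theta>. LINT x:V|lborel. ?H \<theta> x)"
    proof (rule Fubini_unit_interval(2)[OF V, where C="1 / (1 - t) * (nrm2 V h + nrm2 V k)"])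
      have ch: "continuous_on ({0..1} \<times> V) (\<lambda>p. h (S (circ (fst p)) (snd p)))"
      proof (rule continuous_on_compose2[OF A2_continuous_on[OF h] contS])
        show "(\<lambda>p. S (circ (fst p)) (snd p)) ` ({0..1} \<times> V) \<subseteq> V" using SVc by auto
      qed (intro continuous_intros)+
      have ck: "continuous_on ({0..1::real} \<times> V) (\<lambda>p. k (snd p))"
        by (rule continuous_on_compose2[OF A2_continuous_on[OF k]]) (auto intro!: continuous_intros)
      have cC: "continuous_on ({0..1::real} \<times> V) (\<lambda>p. C (fst p))"
        unfolding C_def using circ_t by (intro continuous_intros) auto
      show "continuous_on ({0..1} \<times> V) (\<lambda>(\<theta>, x). ?H \<theta> x)"
        unfolding case_prod_unfold by (intro continuous_intros ch ck cC)
      fix \<theta> :: real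
      have hR: "(\<lambda>x. h (S (circ \<theta>) x)) \<in> A2 V"
        unfolding S_def by (rule A2_diag_scale[OF V h]) (use SV in \<open>auto simp: S_def\<close>)
      \<comment> \<open>Taking the rotated function itself as second argument in \<open>rot\<close>
        shows that rotations are isometries, which makes the slice bound independent of
        \<open>\<theta>\<close>.\<close>
      have nR: "nrm2 V (\<lambda>x. h (S (circ \<theta>) x)) = nrm2 V h"
      proof -
        have "ip V (\<lambda>x. h (S (circ \<theta>) x)) (\<lambda>x. h (S (circ \<theta>) x)) = ip V h (\<lambda>x. h (S (circ \<theta>) (S (circ (1 - \<theta>)) x)))"
          by (rule rot[OF h hR])
        then show ?thesis by (simp add: SS S1 circ_reflect ip_self)
      qed
      have "(\<integral>\<^sup>+x. indicator V x * ennreal (cmod (?H \<theta> x)) \<partial>lborel)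
         \<le> (\<integral>\<^sup>+x. ennreal (1 / (1 - t)) * (ennreal (indicator V x * (cmod (h (S (circ \<theta>) x)))\<^sup>2) + ennreal (indicator V x * (cmod (k x))\<^sup>2)) \<partial>lborel)"
      proof (rule nn_integral_mono)
        fix x
        let ?a = "cmod (h (S (circ \<theta>) x))" and ?b = "cmod (k x)"
        have ab: "?a * ?b \<le> ?a\<^sup>2 + ?b\<^sup>2"
          using two_mult_le_sum_sq[of ?a ?b] mult_nonneg_nonneg[OF norm_ge_zero norm_ge_zero, of "h (S (circ \<theta>) x)" "k x"] by linarith
        have "cmod (?H \<theta> x) \<le> 1 / (1 - t) * (?a\<^sup>2 + ?b\<^sup>2)"
          unfolding norm_mult complex_mod_cnj using Cb[of \<theta>] ab t by (intro mult_mono) auto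
        then have "ennreal (cmod (?H \<theta> x)) \<le> ennreal (1 / (1 - t)) * (ennreal (?a\<^sup>2) + ennreal (?b\<^sup>2))"
          using t by (simp add: ennreal_plus[symmetric] ennreal_mult[symmetric] ennreal_leI del: ennreal_plus)
        then show "indicator V x * ennreal (cmod (?H \<theta> x)) \<le> ennreal (1 / (1 - t)) * (ennreal (indicator V x * ?a\<^sup>2) + ennreal (indicator V x * ?b\<^sup>2))"
          by (auto simp: indicator_def)
      qed
      also have "\<dots> = ennreal (1 / (1 - t)) * (ennreal (nrm2 V h) + ennreal (nrm2 V k))"
      proof -
        have [measurable]: "(\<lambda>x. indicator V x * (cmod (h (S (circ \<theta>) x)))\<^sup>2) \<in> borel_measurable borel" "(\<lambda>x. indicator V x * (cmod (k x))\<^sup>2) \<in> borel_measurable borel"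
          using borel_measurable_indicator_sq[OF V A2_continuous_on[OF hR]] borel_measurable_indicator_sq[OF V A2_continuous_on[OF k]] by auto
        show ?thesis
          using nn_integral_sq_eq_nrm2[OF V hR] nn_integral_sq_eq_nrm2[OF V k] nR
          by (simp add: nn_integral_cmult nn_integral_add)
      qed
      also have "\<dots> = ennreal (1 / (1 - t) * (nrm2 V h + nrm2 V k))"
        using t nrm2_nonneg[of V h] nrm2_nonneg[of V k] by (simp only: ennreal_plus ennreal_mult' zero_le_divide_1_iff diff_ge_0_iff_ge less_imp_le)
      finally show "(\<integral>\<^sup>+x. indicator V x * ennreal (cmod (?H \<theta> x)) \<partial>lborel) \<le> ennreal (1 / (1 - t) * (nrm2 V h + nrm2 V k))" .
    qed
    also have "\<dots> = integral {0..1} (\<lambda>\<theta>. C \<theta> * ip V (\<lambda>x. h (S (circ \<theta>) x)) k)"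
      unfolding ip_def by (simp add: set_integral_mult_right)
    finally show ?thesis .
  qed
  have Cr: "C (1 - \<theta>) = cnj (C \<theta>)" for \<theta> by (simp add: C_def circ_reflect)
  have "ip V (\<lambda>x. f (S (of_real t) x)) g = integral {0..1} (\<lambda>\<theta>. C \<theta> * ip V f (\<lambda>x. g (S (circ (1 - \<theta>)) x)))"
    unfolding main[OF f g] rot[OF f g] ..
  \<comment> \<open>Reflection undoes the inversion of the rotations and conjugates the Cauchy
    weight by \<open>Cr\<close>; what results is the conjugate of \<open>main\<close> with
    \<open>f\<close> and \<open>g\<close> exchanged.\<close>
  also have "\<dots> = integral {0..1} (\<lambda>\<theta>. C (1 - \<theta>) * ip V f (\<lambda>x. g (S (circ \<theta>) x)))"
    using integral_reflect_unit_interval[of "\<lambda>\<theta>. C \<theta> * ip V f (\<lambda>x. g (S (circ (1 - \<theta>)) x))"] by simp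
  also have "\<dots> = integral {0..1} (\<lambda>\<theta>. cnj (C \<theta> * ip V (\<lambda>x. g (S (circ \<theta>) x)) f))"
    by (simp add: Cr ip_cnj)
  also have "\<dots> = cnj (integral {0..1} (\<lambda>\<theta>. C \<theta> * ip V (\<lambda>x. g (S (circ \<theta>) x)) f))"
    by (simp add: Henstock_Kurzweil_Integration.integral_cnj)
  also have "\<dots> = ip V f (\<lambda>x. g (S (of_real t) x))"
    unfolding main[OF g f, symmetric] by (rule ip_cnj)
  finally show ?thesis by (simp add: S_def)
qed

text \<open>Diagonal maps commute, so the coordinates can be moved across the pairing one at a
  time.\<close>

lemma ip_dilate:
  fixes V :: "(complex^'n::finite) set" and t :: "'n \<Rightarrow> real"
  assumes V: "open V" and star: "star_hartogs J V" and t: "\<And>i. 0 < t i" "\<And>i. t i \<le> 1" "\<And>i. i \<notin> J \<Longrightarrow> t i = 1"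
    and f: "f \<in> A2 V" and g: "g \<in> A2 V"
  shows "ip V (\<lambda>x. f (diag_scale (\<lambda>i. of_real (t i)) x)) g = ip V f (\<lambda>x. g (diag_scale (\<lambda>i. of_real (t i)) x))"
proof -
  have "ip V (\<lambda>x. f (diag_scale (\<lambda>i. if i \<in> K then of_real (t i) else 1) x)) g = ip V f (\<lambda>x. g (diag_scale (\<lambda>i. if i \<in> K then of_real (t i) else 1) x))"
    if "finite K" for K
    using that f g
  proof (induction K arbitrary: f g rule: finite_induct)
    case empty
    have "diag_scale (\<lambda>i. if i \<in> {} then complex_of_real (t i) else 1) x = x" for x :: "complex^'n"
      by (simp add: vec_eq_iff)
    then show ?case by simp
  next
    case (insert j K)
    let ?c = "\<lambda>K i. if i \<in> K then complex_of_real (t i) else 1"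
    let ?d = "\<lambda>i. if i = j then complex_of_real (t j) else 1"
    have cV: "diag_scale (?c K) x \<in> V" "diag_scale ?d x \<in> V" if "x \<in> V" for x
      by (rule star_hartogs_diag_scale[OF star that]; use t in \<open>auto simp: less_imp_le\<close>)+
    have c0: "?c K i \<noteq> 0" "?d i \<noteq> 0" for i using t(1)[of i] t(1)[of j] by (auto simp: less_le)
    have eq1: "diag_scale (?c (insert j K)) x = diag_scale ?d (diag_scale (?c K) x)"
      and eq2: "diag_scale (?c (insert j K)) x = diag_scale (?c K) (diag_scale ?d x)" for x :: "complex^'n"
      using insert(2) by (auto simp: vec_eq_iff)
    have fd: "(\<lambda>x. f (diag_scale ?d x)) \<in> A2 V" by (rule A2_diag_scale[OF V insert.prems(1) c0(2) cV(2)])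
    have gK: "(\<lambda>x. g (diag_scale (?c K) x)) \<in> A2 V" by (rule A2_diag_scale[OF V insert.prems(2) c0(1) cV(1)])
    have step: "ip V (\<lambda>x. f (diag_scale ?d x)) (\<lambda>x. g (diag_scale (?c K) x)) = ip V f (\<lambda>x. g (diag_scale (?c K) (diag_scale ?d x)))"
    \<comment> \<open>At \<open>t j = 1\<close> the Cauchy weight would be singular on the circle,
      but the dilation is the identity. This case also takes care of coordinates outside
      \<open>J\<close>.\<close>
    proof (cases "t j = 1")
      case True
      then have "diag_scale ?d x = x" for x :: "complex^'n" by (simp add: vec_eq_iff)
      then show ?thesis by simp
    next
      case False
      then have "j \<in> J" "t j < 1" using t by (auto simp: less_le)
      then show ?thesis by (intro ip_dilate_coordinate[OF V star _ t(1)] insert.prems gK)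
    qed
    have "ip V (\<lambda>x. f (diag_scale (?c (insert j K)) x)) g = ip V (\<lambda>x. f (diag_scale ?d (diag_scale (?c K) x))) g"
      unfolding eq1 ..
    also have "\<dots> = ip V (\<lambda>x. f (diag_scale ?d x)) (\<lambda>x. g (diag_scale (?c K) x))"
      by (rule insert.IH[OF fd insert.prems(2)])
    also have "\<dots> = ip V f (\<lambda>x. g (diag_scale (?c (insert j K)) x))"
      unfolding step eq2 ..
    finally show ?case .
  qed
  from this[of UNIV] show ?thesis by simp
qed

section \<open>Weighted dilations and their infinitesimal generator\<close>

text \<open>The dilation \<open>s^\<alpha>\<close> with a complex parameter, so that its derivative
  is a complex one; the right half-plane is where the powers are differentiated.\<close>

definition pscale :: "'n set \<Rightarrow> ('n \<Rightarrow> real) \<Rightarrow> complex \<Rightarrow> complex^'n::finite \<Rightarrow> complex^'n" where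
  "pscale J \<alpha> c = diag_scale (\<lambda>i. if i \<in> J then c powr of_real (\<alpha> i) else 1)"

text \<open>The velocity of \<open>pscale J \<alpha> s z\<close> at \<open>s = 1\<close>. Applying
  \<open>cderiv f z\<close> to it gives the weighted Euler operator, the sum of
  \<open>\<alpha>_j z_j\<close> times the partial derivatives.\<close>

definition euler_vec :: "'n set \<Rightarrow> ('n \<Rightarrow> real) \<Rightarrow> complex^'n::finite \<Rightarrow> complex^'n" where
  "euler_vec J \<alpha> z = (\<chi> i. if i \<in> J then of_real (\<alpha> i) * z $ i else 0)"

definition Dop :: "'n set \<Rightarrow> ('n \<Rightarrow> real) \<Rightarrow> (complex^'n::finite \<Rightarrow> complex) \<Rightarrow> complex^'n \<Rightarrow> complex" where
  "Dop J \<alpha> f z = of_real (1 + (\<Sum>j\<in>J. \<alpha> j)) * f z + cderiv f z (euler_vec J \<alpha> z)"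

lemma pscale_1 [simp]: "pscale J \<alpha> 1 z = z"
  by (simp add: pscale_def vec_eq_iff)

lemma pscale_mem:
  assumes "star_hartogs J V" "z \<in> V" "cmod c \<le> 1" "\<And>j. j \<in> J \<Longrightarrow> \<alpha> j > 0"
  shows "pscale J \<alpha> c z \<in> V"
  unfolding pscale_def
proof (rule star_hartogs_diag_scale[OF assms(1,2)])
  fix j assume "j \<in> J"
  then have "cmod (c powr of_real (\<alpha> j)) = cmod c powr \<alpha> j"
    by (simp add: norm_powr_real_powr')
  also have "\<dots> \<le> 1" using assms(3) assms(4)[OF \<open>j \<in> J\<close>] by (intro powr_le1) auto
  finally show "cmod (if j \<in> J then c powr of_real (\<alpha> j) else 1) \<le> 1" using \<open>j \<in> J\<close> by simp
qed auto

text \<open>The derivative of \<open>c^\<alpha> z\<close> is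
  \<open>\<alpha> c^\<alpha> z / c\<close>, the Euler vector at the dilated point divided by
  \<open>c\<close>.\<close>

lemma has_field_derivative_pscale:
  assumes f: "holo_on f D" and c: "Re c > 0" and mem: "pscale J \<alpha> c z \<in> D"
  shows "((\<lambda>c. f (pscale J \<alpha> c z)) has_field_derivative cderiv f (pscale J \<alpha> c z) (euler_vec J \<alpha> (pscale J \<alpha> c z)) / c) (at c)"
proof -
  have c0: "c \<noteq> 0" "c \<notin> \<real>\<^sub>\<le>\<^sub>0" using c by (auto simp: complex_nonpos_Reals_iff)
  let ?v = "(1 / c) *s euler_vec J \<alpha> (pscale J \<alpha> c z)"
  have "((\<lambda>c. f (pscale J \<alpha> c z)) has_field_derivative cderiv f (pscale J \<alpha> c z) ?v) (at c)"
  proof (rule has_field_derivative_holo_curve[OF f])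
    show "pscale J \<alpha> c z \<in> D" by (rule mem)
    fix i
    show "((\<lambda>t. pscale J \<alpha> t z $ i) has_field_derivative ?v $ i) (at c)"
    proof (cases "i \<in> J")
      case True
      have "((\<lambda>t. t powr of_real (\<alpha> i) * z $ i) has_field_derivative of_real (\<alpha> i) * c powr (of_real (\<alpha> i) - 1) * z $ i) (at c)"
        by (intro DERIV_cmult_right has_field_derivative_powr c0)
      then show ?thesis using True c0
        by (simp add: pscale_def euler_vec_def powr_diff field_simps)
    qed (simp add: pscale_def euler_vec_def)
  qed
  then show ?thesis by (simp add: holo_on_has_derivative(2)[OF f mem])
qed

lemma A2_cderiv_eval_bound:
  assumes D: "open D" and z: "z \<in> D"
  obtains C where "\<And>f. f \<in> A2 D \<Longrightarrow> (cmod (cderiv f z v))\<^sup>2 \<le> C * nrm2 D f"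
proof -
  obtain s where s: "s > 0" "cball z s \<subseteq> D" using D z open_contains_cball by blast
  define r where "r = s / 2"
  have r: "r > 0" "cball z (2 * r) \<subseteq> D" using s by (auto simp: r_def)
  let ?m = "measure lborel (ball (0::complex^'a) r)"
  have m: "?m > 0" by (rule measure_ball_pos[OF r(1)])
  show ?thesis
  proof (rule that)
    fix f assume f: "f \<in> A2 D"
    have "cmod (cderiv f z v) \<le> sqrt (nrm2 D f / ?m) / (r / 2) * norm v"
      by (rule A2_cderiv_bound[OF D f r(2,1)]) (use r in auto)
    then have "(cmod (cderiv f z v))\<^sup>2 \<le> (sqrt (nrm2 D f / ?m) / (r / 2) * norm v)\<^sup>2"
      by (intro power_mono) auto
    also have "\<dots> = (1 / ?m / (r / 2)\<^sup>2 * (norm v)\<^sup>2) * nrm2 D f"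
      using m nrm2_nonneg[of D f] by (simp add: power_mult_distrib power_divide real_sqrt_pow2)
    finally show "(cmod (cderiv f z v))\<^sup>2 \<le> (1 / ?m / (r / 2)\<^sup>2 * (norm v)\<^sup>2) * nrm2 D f" .
  qed
qed

lemma cderiv_add:
  assumes "holo_on f D" "holo_on g D" "x \<in> D"
  shows "cderiv (\<lambda>x. f x + g x) x v = cderiv f x v + cderiv g x v"
  using cderiv_eqI[OF has_derivative_add[OF holo_on_has_derivative(1)[OF assms(1,3)] holo_on_has_derivative(1)[OF assms(2,3)]]] by simp

lemma cderiv_cmult:
  assumes "holo_on f D" "x \<in> D"
  shows "cderiv (\<lambda>x. c * f x) x v = c * cderiv f x v"
  using cderiv_eqI[OF has_derivative_mult_right[OF holo_on_has_derivative(1)[OF assms]]] by simp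

text \<open>Pairing \<kappa> with the kernel function of \<open>z\<close> gives \<kappa> at
  \<open>z\<close> as the conjugate of \<open>Dop\<close> of that function at
  \<open>\<zeta>\<close>. It remains to move \<open>Dop\<close> from one argument of the kernel to
  the other, which is the symmetry \<open>sym\<close> differentiated at
  \<open>s = 1\<close>.\<close>

lemma bergman_kernel_Dop:
  fixes V :: "(complex^'n::finite) set"
  assumes V: "open V" and star: "star_hartogs J V" and \<alpha>: "\<And>j. j \<in> J \<Longrightarrow> \<alpha> j > 0" and \<zeta>: "\<zeta> \<in> V"
  obtains \<kappa> where "\<kappa> \<in> A2 V" "\<And>f. f \<in> A2 V \<Longrightarrow> ip V f \<kappa> = Dop J \<alpha> f \<zeta>"
    "\<And>z. z \<in> V \<Longrightarrow> \<kappa> z = Dop J \<alpha> (\<lambda>x. bergman_kernel V x \<zeta>) z"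
proof -
  let ?a = "complex_of_real (1 + (\<Sum>j\<in>J. \<alpha> j))"
  obtain C1 where C1: "\<And>f. f \<in> A2 V \<Longrightarrow> (cmod (f \<zeta>))\<^sup>2 \<le> C1 * nrm2 V f"
    using A2_eval_bound[OF V \<zeta>] by blast
  obtain C2 where C2: "\<And>f. f \<in> A2 V \<Longrightarrow> (cmod (cderiv f \<zeta> (euler_vec J \<alpha> \<zeta>)))\<^sup>2 \<le> C2 * nrm2 V f"
    using A2_cderiv_eval_bound[OF V \<zeta>] by blast
  obtain \<kappa> where \<kappa>: "\<kappa> \<in> A2 V" "\<And>f. f \<in> A2 V \<Longrightarrow> Dop J \<alpha> f \<zeta> = ip V f \<kappa>"
  proof (rule A2_riesz[OF V, of "\<lambda>f. Dop J \<alpha> f \<zeta>" "2 * (cmod ?a)\<^sup>2 * C1 + 2 * C2"])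
    show "Dop J \<alpha> (\<lambda>x. f x + g x) \<zeta> = Dop J \<alpha> f \<zeta> + Dop J \<alpha> g \<zeta>" if "f \<in> A2 V" "g \<in> A2 V" for f g
      by (simp add: Dop_def cderiv_add[OF A2_holo[OF that(1)] A2_holo[OF that(2)] \<zeta>] algebra_simps)
    show "Dop J \<alpha> (\<lambda>x. c * f x) \<zeta> = c * Dop J \<alpha> f \<zeta>" if "f \<in> A2 V" for f c
      by (simp add: Dop_def cderiv_cmult[OF A2_holo[OF that] \<zeta>] algebra_simps)
    fix f assume f: "f \<in> A2 V"
    let ?x = "cmod (?a * f \<zeta>)" and ?y = "cmod (cderiv f \<zeta> (euler_vec J \<alpha> \<zeta>))"
    have "(cmod (Dop J \<alpha> f \<zeta>))\<^sup>2 \<le> (?x + ?y)\<^sup>2"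
      unfolding Dop_def by (intro power_mono norm_triangle_ineq) auto
    also have "\<dots> \<le> 2 * ?x\<^sup>2 + 2 * ?y\<^sup>2"
      using two_mult_le_sum_sq[of ?x ?y] by (simp add: power2_sum)
    also have "?x\<^sup>2 = (cmod ?a)\<^sup>2 * (cmod (f \<zeta>))\<^sup>2" unfolding norm_mult power_mult_distrib ..
    also have "2 * ((cmod ?a)\<^sup>2 * (cmod (f \<zeta>))\<^sup>2) + 2 * ?y\<^sup>2 \<le> 2 * ((cmod ?a)\<^sup>2 * (C1 * nrm2 V f)) + 2 * (C2 * nrm2 V f)"
      by (intro add_mono mult_left_mono C1 C2 f) auto
    also have "\<dots> = (2 * (cmod ?a)\<^sup>2 * C1 + 2 * C2) * nrm2 V f" by (simp add: algebra_simps)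
    finally show "(cmod (Dop J \<alpha> f \<zeta>))\<^sup>2 \<le> (2 * (cmod ?a)\<^sup>2 * C1 + 2 * C2) * nrm2 V f" .
  qed blast
  show ?thesis
  proof (rule that[OF \<kappa>(1)])
    show "ip V f \<kappa> = Dop J \<alpha> f \<zeta>" if "f \<in> A2 V" for f using \<kappa>(2)[OF that] by simp
    fix z assume z: "z \<in> V"
    define k where "k = (\<lambda>y x. bergman_kernel V x y)"
    have kA: "k y \<in> A2 V" if "y \<in> V" for y unfolding k_def by (rule bergman_kernel_A2[OF V that])
    have rep: "ip V f (k y) = f y" if "f \<in> A2 V" "y \<in> V" for f y
      unfolding k_def by (rule bergman_kernel_reproducing[OF V that(2,1)])
    have sym: "k \<zeta> (pscale J \<alpha> (of_real s) z) = cnj (k z (pscale J \<alpha> (of_real s) \<zeta>))" if s: "0 < s" "s \<le> 1" for s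
    proof -
      define t where "t = (\<lambda>i. if i \<in> J then s powr \<alpha> i else 1)"
      have ps: "pscale J \<alpha> (of_real s) = diag_scale (\<lambda>i. of_real (t i))"
        unfolding pscale_def t_def using s by (intro arg_cong[of _ _ diag_scale] ext) (auto simp: powr_of_real)
      have t: "0 < t i" "t i \<le> 1" "i \<notin> J \<Longrightarrow> t i = 1" for i
        using s \<alpha>[of i] by (auto simp: t_def intro!: powr_le1)
      have mem: "diag_scale (\<lambda>i. of_real (t i)) x \<in> V" if "x \<in> V" for x
        by (rule star_hartogs_diag_scale[OF star that]) (use t in \<open>auto simp: abs_of_pos\<close>)
      have A: "(\<lambda>x. h (diag_scale (\<lambda>i. of_real (t i)) x)) \<in> A2 V" if "h \<in> A2 V" for h
        by (rule A2_diag_scale[OF V that _ mem]) (use t(1) in \<open>auto simp: less_le\<close>)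
      have "k \<zeta> (diag_scale (\<lambda>i. of_real (t i)) z) = ip V (\<lambda>x. k \<zeta> (diag_scale (\<lambda>i. of_real (t i)) x)) (k z)"
        by (rule rep[OF A[OF kA[OF \<zeta>]] z, symmetric])
      also have "\<dots> = ip V (k \<zeta>) (\<lambda>x. k z (diag_scale (\<lambda>i. of_real (t i)) x))"
        by (rule ip_dilate[OF V star t kA[OF \<zeta>] kA[OF z]])
      also have "\<dots> = cnj (ip V (\<lambda>x. k z (diag_scale (\<lambda>i. of_real (t i)) x)) (k \<zeta>))" by (simp add: ip_cnj)
      also have "\<dots> = cnj (k z (diag_scale (\<lambda>i. of_real (t i)) \<zeta>))"
        by (simp add: rep[OF A[OF kA[OF z]] \<zeta>])
      finally show ?thesis unfolding ps .
    qed
    \<comment> \<open>The symmetry holds only for \<open>s <= 1\<close>, hence one-sided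
      derivatives, which still determine the limit. The end point 1/2 merely keeps the interval away
      from 0.\<close>
    have d1: "((\<lambda>s. k \<zeta> (pscale J \<alpha> (of_real s) z)) has_vector_derivative cderiv (k \<zeta>) z (euler_vec J \<alpha> z)) (at 1 within {1/2..1})"
      using has_field_derivative_pscale[OF A2_holo[OF kA[OF \<zeta>]], of 1 J \<alpha> z] z
      by (intro has_vector_derivative_real_field) simp
    have "((\<lambda>s. k z (pscale J \<alpha> (of_real s) \<zeta>)) has_vector_derivative cderiv (k z) \<zeta> (euler_vec J \<alpha> \<zeta>)) (at 1 within {1/2..1})"
      using has_field_derivative_pscale[OF A2_holo[OF kA[OF z]], of 1 J \<alpha> \<zeta>] \<zeta>
      by (intro has_vector_derivative_real_field) simp
    then have "((\<lambda>s. cnj (k z (pscale J \<alpha> (of_real s) \<zeta>))) has_vector_derivative cnj (cderiv (k z) \<zeta> (euler_vec J \<alpha> \<zeta>))) (at 1 within {1/2..1})"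
      by (rule has_vector_derivative_cnj)
    then have d2: "((\<lambda>s. k \<zeta> (pscale J \<alpha> (of_real s) z)) has_vector_derivative cnj (cderiv (k z) \<zeta> (euler_vec J \<alpha> \<zeta>))) (at 1 within {1/2..1})"
      by (rule has_vector_derivative_transform[rotated 2]) (use sym in auto)
    have "at (1::real) within {1/2..1} \<noteq> bot"
      using trivial_limit_at_left_real[of "1::real"] at_within_Icc_at_left[of "1/2" "1::real"] by simp
    then have eqd: "cnj (cderiv (k z) \<zeta> (euler_vec J \<alpha> \<zeta>)) = cderiv (k \<zeta>) z (euler_vec J \<alpha> z)"
      by (rule vector_derivative_unique_within[OF _ d2 d1])
    have "\<kappa> z = ip V \<kappa> (k z)" by (rule rep[OF \<kappa>(1) z, symmetric])
    also have "\<dots> = cnj (ip V (k z) \<kappa>)" by (simp add: ip_cnj)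
    also have "\<dots> = cnj (Dop J \<alpha> (k z) \<zeta>)" using \<kappa>(2)[OF kA[OF z]] by simp
    also have "\<dots> = Dop J \<alpha> (k \<zeta>) z"
      using sym[of 1] eqd by (simp add: Dop_def)
    finally show "\<kappa> z = Dop J \<alpha> (\<lambda>x. bergman_kernel V x \<zeta>) z" by (simp add: k_def)
  qed
qed

section \<open>Integration over the Hartogs domain\<close>

definition base :: "complex^('n option) \<Rightarrow> complex^'n::finite" where
  "base p = (\<chi> i. p $ Some i)"

lemma ext_pt_nth [simp]: "ext_pt x w $ None = w" "ext_pt x w $ Some i = x $ i"
  by (simp_all add: ext_pt_def)

lemma base_nth [simp]: "base p $ i = p $ Some i"
  by (simp add: base_def)

lemma base_ext_pt [simp]: "base (ext_pt x w) = x"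
  by (simp add: vec_eq_iff)

lemma ext_pt_base [simp]: "ext_pt (base p) (p $ None) = p"
  by (simp add: vec_eq_iff ext_pt_def split: option.splits)

lemma ext_pt_inject [simp]: "ext_pt x w = ext_pt y v \<longleftrightarrow> x = y \<and> w = v"
  by (metis base_ext_pt ext_pt_nth(1))

lemma holo_on_vec_option:
  assumes "holo_on (\<lambda>x. G x $ None) E" "\<And>j. holo_on (\<lambda>x. G x $ Some j) E"
  shows "holo_on (\<lambda>x. G x $ i) E"
  using assms by (cases i) auto

lemma continuous_on_ext_pt [continuous_intros]:
  assumes "continuous_on S f" "continuous_on S g"
  shows "continuous_on S (\<lambda>x. ext_pt (f x) (g x))"
  unfolding ext_pt_def
proof (intro continuous_on_vec_lambda)
  fix i show "continuous_on S (\<lambda>x. case i of None \<Rightarrow> g x | Some j \<Rightarrow> f x $ j)"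
    using assms by (cases i) (auto intro!: continuous_intros)
qed

lemma continuous_on_base [continuous_intros]: "continuous_on S f \<Longrightarrow> continuous_on S (\<lambda>x. base (f x))"
  unfolding base_def by (intro continuous_intros continuous_on_vec_lambda)

lemma borel_measurable_ext_pt [measurable]:
  "(\<lambda>(x, w). ext_pt x w) \<in> borel_measurable (lborel \<Otimes>\<^sub>M lborel)"
  using borel_measurable_continuous_onI[of "\<lambda>p. ext_pt (fst p) (snd p)"]
  by (simp add: lborel_prod case_prod_unfold continuous_intros)

lemma nn_integral_ext_pt:
  fixes F :: "complex^('n::finite option) \<Rightarrow> ennreal"
  assumes F [measurable]: "F \<in> borel_measurable borel"
  shows "(\<integral>\<^sup>+p. F p \<partial>lborel) = (\<integral>\<^sup>+w. \<integral>\<^sup>+x. F (ext_pt x w) \<partial>lborel \<partial>lborel)"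
proof -
  have "(\<integral>\<^sup>+p. F p \<partial>lborel) = (\<integral>\<^sup>+p. F (case p of (x, w) \<Rightarrow> ext_pt x w) \<partial>(lborel \<Otimes>\<^sub>M lborel))"
    by (subst lborel_ext_pt, subst nn_integral_distr) auto
  also have "\<dots> = (\<integral>\<^sup>+w. \<integral>\<^sup>+x. F (ext_pt x w) \<partial>lborel \<partial>lborel)"
    by (subst lborel_pair.nn_integral_snd[symmetric]) (auto intro!: measurable_compose[OF borel_measurable_ext_pt])
  finally show ?thesis .
qed

lemma integral_ext_pt:
  fixes F :: "complex^('n::finite option) \<Rightarrow> complex"
  assumes F: "integrable lborel F"
  shows "integrable lborel (\<lambda>w. LINT x|lborel. F (ext_pt x w))"
    and "(LINT p|lborel. F p) = (LINT w|lborel. LINT x|lborel. F (ext_pt x w))"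
    and "AE w in lborel. integrable lborel (\<lambda>x. F (ext_pt x w))"
proof -
  have m [measurable]: "F \<in> borel_measurable borel" using F by (auto dest: borel_measurable_integrable)
  have int: "integrable (lborel \<Otimes>\<^sub>M lborel) (\<lambda>(x, w). F (ext_pt x w))"
    using F by (subst (asm) lborel_ext_pt) (simp add: integrable_distr_eq case_prod_unfold)
  show "integrable lborel (\<lambda>w. LINT x|lborel. F (ext_pt x w))"
    using lborel_pair.integrable_snd[OF int] .
  show "AE w in lborel. integrable lborel (\<lambda>x. F (ext_pt x w))"
    using int by (rule lborel_pair.AE_integrable_snd)
  have "(LINT p|lborel. F p) = (LINT p|(lborel \<Otimes>\<^sub>M lborel). F (case p of (x, w) \<Rightarrow> ext_pt x w))"
    by (subst lborel_ext_pt, subst integral_distr) auto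
  also have "\<dots> = (LINT w|lborel. LINT x|lborel. F (ext_pt x w))"
    using lborel_pair.integral_snd[OF int] by (simp add: case_prod_unfold)
  finally show "(LINT p|lborel. F p) = (LINT w|lborel. LINT x|lborel. F (ext_pt x w))" .
qed

lemma ext_pt_mem_U_alpha: "ext_pt x w \<in> U_alpha J \<alpha> \<Omega> \<longleftrightarrow> f_alpha J \<alpha> x w \<in> \<Omega> \<and> cmod w < 1"
  unfolding U_alpha_def by auto

lemma mem_U_alpha: "p \<in> U_alpha J \<alpha> \<Omega> \<longleftrightarrow> f_alpha J \<alpha> (base p) (p $ None) \<in> \<Omega> \<and> cmod (p $ None) < 1"
  using ext_pt_mem_U_alpha[of "base p" "p $ None"] by simp

lemma one_minus_norm_sq_pos: "cmod w < 1 \<Longrightarrow> 1 - (cmod w)\<^sup>2 > 0"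
  by (simp add: abs_square_less_1)

lemma f_alpha_eq_diag_scale:
  "f_alpha J \<alpha> x w = diag_scale (\<lambda>i. if i \<in> J then of_real ((1 - (cmod w)\<^sup>2) powr (- (\<alpha> i / 2))) else 1) x"
  by (simp add: vec_eq_iff f_alpha_def powr_minus field_simps)

lemma open_U_alpha:
  assumes "open \<Omega>"
  shows "open (U_alpha J \<alpha> \<Omega>)"
proof -
  let ?B = "{p::complex^('a option). cmod (p $ None) < 1}"
  have oB: "open ?B" by (intro open_Collect_less continuous_intros)
  have "continuous_on ?B (\<lambda>p. if i \<in> J then base p $ i / of_real ((1 - (cmod (p $ None))\<^sup>2) powr (\<alpha> i / 2)) else base p $ i)" for i
  proof (cases "i \<in> J")
    case True
    have "continuous_on ?B (\<lambda>p. base p $ i / of_real ((1 - (cmod (p $ None))\<^sup>2) powr (\<alpha> i / 2)))"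
      by (intro continuous_intros) (auto dest: one_minus_norm_sq_pos)
    then show ?thesis using True by simp
  next
    case False
    then show ?thesis by (simp) (intro continuous_intros)
  qed
  then have "continuous_on ?B (\<lambda>p. f_alpha J \<alpha> (base p) (p $ None))"
    unfolding f_alpha_def by (intro continuous_on_vec_lambda)
  from continuous_open_preimage[OF this oB assms]
  have "open (?B \<inter> (\<lambda>p. f_alpha J \<alpha> (base p) (p $ None)) -` \<Omega>)" .
  also have "?B \<inter> (\<lambda>p. f_alpha J \<alpha> (base p) (p $ None)) -` \<Omega> = U_alpha J \<alpha> \<Omega>"
    by (auto simp: mem_U_alpha)
  finally show ?thesis .
qed

text \<open>Passing from \<open>w\<close> to \<open>v\<close> multiplies the
  \<open>J\<close>-coordinates of \<open>f_alpha\<close> by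
  \<open>((1 - |w|^2) / (1 - |v|^2))^(\<alpha>/2) <= 1\<close>, which a star-shaped set
  permits.\<close>

lemma U_alpha_shrink:
  assumes star: "star_hartogs J V" and \<alpha>: "\<And>j. j \<in> J \<Longrightarrow> \<alpha> j > 0"
    and mem: "ext_pt x w \<in> U_alpha J \<alpha> V" and le: "cmod v \<le> cmod w"
  shows "ext_pt x v \<in> U_alpha J \<alpha> V"
proof -
  have w: "cmod w < 1" and fw: "f_alpha J \<alpha> x w \<in> V" using mem by (auto simp: ext_pt_mem_U_alpha)
  have v: "cmod v < 1" using le w by simp
  let ?a = "1 - (cmod w)\<^sup>2" and ?b = "1 - (cmod v)\<^sup>2"
  have ab: "0 < ?a" "0 < ?b" "?a \<le> ?b"
    using one_minus_norm_sq_pos[OF w] one_minus_norm_sq_pos[OF v] le by (auto intro!: power_mono)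
  let ?c = "\<lambda>i. if i \<in> J then complex_of_real (?a powr (\<alpha> i / 2) * ?b powr (- (\<alpha> i / 2))) else 1"
  have "f_alpha J \<alpha> x v = diag_scale ?c (f_alpha J \<alpha> x w)"
    using ab by (simp add: vec_eq_iff f_alpha_eq_diag_scale powr_minus)
  moreover have "diag_scale ?c (f_alpha J \<alpha> x w) \<in> V"
  proof (rule star_hartogs_diag_scale[OF star fw])
    fix j assume j: "j \<in> J"
    have "?a powr (\<alpha> j / 2) \<le> ?b powr (\<alpha> j / 2)" using ab \<alpha>[OF j] by (intro powr_mono2) auto
    then have "?a powr (\<alpha> j / 2) * ?b powr (- (\<alpha> j / 2)) \<le> 1" using ab(2) by (simp add: powr_minus divide_le_eq_1 flip: divide_inverse)
    moreover have "0 \<le> ?a powr (\<alpha> j / 2) * ?b powr (- (\<alpha> j / 2))" by simp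
    ultimately show "cmod (?c j) \<le> 1" unfolding if_P[OF j] norm_of_real by linarith
  qed auto
  ultimately show ?thesis using v by (simp add: ext_pt_mem_U_alpha)
qed

lemma f_alpha_0 [simp]: "f_alpha J \<alpha> x 0 = x"
  by (simp add: vec_eq_iff f_alpha_def)

lemma U_alpha_base_mem:
  assumes "star_hartogs J V" "\<And>j. j \<in> J \<Longrightarrow> \<alpha> j > 0" "p \<in> U_alpha J \<alpha> V"
  shows "base p \<in> V"
  using U_alpha_shrink[OF assms(1,2), where x="base p" and w="p $ None" and v=0] assms(3) by (simp add: ext_pt_mem_U_alpha)

text \<open>The fibres of \<open>U_alpha\<close> over the base are discs, so averaging over the rotations of \<open>w\<close>
  replaces a holomorphic integrand by its value at \<open>w = 0\<close>.\<close>
lemma U_alpha_average: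
  fixes V :: "(complex^'n::finite) set"
  assumes V: "open V" and star: "star_hartogs J V" and \<alpha>: "\<And>j. j \<in> J \<Longrightarrow> \<alpha> j > 0"
    and F: "holo_on F (U_alpha J \<alpha> V)" and k: "continuous_on V k"
    and int: "set_integrable lborel (U_alpha J \<alpha> V) (\<lambda>p. F p * k (base p))"
  shows "set_integrable lborel (U_alpha J \<alpha> V) (\<lambda>p. F (ext_pt (base p) 0) * k (base p))"
    and "(LINT p:U_alpha J \<alpha> V|lborel. F (ext_pt (base p) 0) * k (base p)) = (LINT p:U_alpha J \<alpha> V|lborel. F p * k (base p))"
proof -
  define W where "W = U_alpha J \<alpha> V"
  have oW: "open W" unfolding W_def by (rule open_U_alpha[OF V])
  \<comment> \<open>Only the disc coordinate turns. The domain is invariant because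
    \<open>f_alpha\<close> sees \<open>w\<close> only through its modulus.\<close>
  define R where "R = (\<lambda>\<theta>::real. diag_scale (case_option (circ \<theta>) (\<lambda>_::'n. 1)))"
  have R_ext: "R \<theta> p = ext_pt (base p) (circ \<theta> * p $ None)" for \<theta> p
    by (simp add: R_def vec_eq_iff ext_pt_def split: option.splits)
  have RW: "R \<theta> p \<in> W \<longleftrightarrow> p \<in> W" for \<theta> p
  proof -
    have "f_alpha J \<alpha> x (circ \<theta> * w) = f_alpha J \<alpha> x w" for x w
      unfolding f_alpha_def norm_mult norm_circ mult_1 ..
    then show ?thesis by (simp add: W_def mem_U_alpha R_ext norm_mult)
  qed
  have bR: "base (R \<theta> p) = base p" for \<theta> p by (simp add: R_ext)
  have contF: "continuous_on W F" using holo_on_continuous_on[OF F] by (simp add: W_def)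
  have distr: "distr lborel borel (R \<theta>) = lborel" for \<theta>
    unfolding R_def by (rule distr_diag_scale_unimodular) (auto split: option.splits)
  have Rm [measurable]: "R \<theta> \<in> borel_measurable borel" for \<theta> unfolding R_def by simp
  let ?H = "\<lambda>\<theta> p. F (R \<theta> p) * k (base p)"
  have avg: "integral {0..1} (\<lambda>\<theta>. ?H \<theta> p) = F (ext_pt (base p) 0) * k (base p)" if p: "p \<in> W" for p
  proof -
    let ?w = "p $ None"
    define T where "T = (\<lambda>c. ext_pt (base p) (c * ?w)) -` W"
    have oT: "open T" unfolding T_def by (intro open_vimage oW continuous_intros)
    have sub: "cball 0 1 \<subseteq> T"
    proof
      fix c :: complex assume "c \<in> cball 0 1"
      then have "cmod (c * ?w) \<le> cmod ?w" by (simp add: norm_mult mult_left_le_one_le)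
      then show "c \<in> T"
        unfolding T_def W_def using U_alpha_shrink[OF star \<alpha>, where x="base p" and w="?w"] p by (simp add: W_def)
    qed
    have hol: "(\<lambda>c. F (ext_pt (base p) (c * ?w))) holomorphic_on T"
    proof (rule holo_curve_holomorphic[OF F _ oT])
      show "(\<lambda>c. ext_pt (base p) (c * ?w) $ i) holomorphic_on T" for i
        by (cases i) (auto intro!: holomorphic_intros)
    qed (auto simp: T_def W_def)
    have "((\<lambda>\<theta>. circ \<theta> / (circ \<theta> - 0) * F (ext_pt (base p) (circ \<theta> * ?w))) has_integral F (ext_pt (base p) (0 * ?w))) {0..1}"
    proof (rule Cauchy_unit_circle)
      show "(\<lambda>c. F (ext_pt (base p) (c * ?w))) holomorphic_on ball 0 1"
        by (rule holomorphic_on_subset[OF hol]) (use sub in auto)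
      show "continuous_on (cball 0 1) (\<lambda>c. F (ext_pt (base p) (c * ?w)))"
        by (rule holomorphic_on_imp_continuous_on[OF holomorphic_on_subset[OF hol sub]])
    qed auto
    from has_integral_mult_left[OF this, of "k (base p)"] show ?thesis
      by (simp add: has_integral_iff R_ext)
  qed
  have avg': "indicator W p *\<^sub>R integral {0..1} (\<lambda>\<theta>. ?H \<theta> p) = indicator W p *\<^sub>R (F (ext_pt (base p) 0) * k (base p))" for p
  proof (cases "p \<in> W")
    case True
    show ?thesis unfolding avg[OF True] ..
  qed simp
  have inv: "(LINT p:W|lborel. ?H \<theta> p) = (LINT p:W|lborel. F p * k (base p))" for \<theta>
  proof -
    have "(LINT p:W|lborel. F p * k (base p)) = (LINT p|distr lborel borel (R \<theta>). indicator W p *\<^sub>R (F p * k (base p)))"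
      by (simp add: distr set_lebesgue_integral_def)
    also have "\<dots> = (LINT p|lborel. indicator W (R \<theta> p) *\<^sub>R (F (R \<theta> p) * k (base (R \<theta> p))))"
      by (rule integral_distr) (use int in \<open>auto simp: set_integrable_def W_def dest: borel_measurable_integrable\<close>)
    also have "\<dots> = (LINT p:W|lborel. ?H \<theta> p)"
      unfolding set_lebesgue_integral_def by (intro Bochner_Integration.integral_cong) (auto simp: bR RW indicator_def)
    finally show ?thesis by simp
  qed
  have kb: "continuous_on W (\<lambda>p. k (base p))"
    by (rule continuous_on_compose2[OF k]) (use U_alpha_base_mem[OF star \<alpha>] in \<open>auto intro!: continuous_intros simp: W_def\<close>)
  \<comment> \<open>The norm of the original integrand bounds every rotated slice, since rotations
    preserve domain, base and measure.\<close>
  let ?N = "\<integral>\<^sup>+p. ennreal (norm (indicator W p *\<^sub>R (F p * k (base p)))) \<partial>lborel"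
  have N_fin: "?N < \<infinity>"
    using int by (simp add: set_integrable_def integrable_iff_bounded W_def)
  have cont: "continuous_on ({0..1} \<times> W) (\<lambda>(\<theta>, p). ?H \<theta> p)"
    unfolding case_prod_unfold
  proof (intro continuous_intros)
    show "continuous_on ({0..1} \<times> W) (\<lambda>p. F (R (fst p) (snd p)))"
    proof (rule continuous_on_compose2[OF contF])
      show "continuous_on ({0..1} \<times> W) (\<lambda>p. R (fst p) (snd p))"
        unfolding R_ext by (intro continuous_intros)
    qed (use RW in auto)
    show "continuous_on ({0..1::real} \<times> W) (\<lambda>p. k (base (snd p)))"
      by (rule continuous_on_compose2[OF kb]) (auto intro!: continuous_intros)
  qed
  have bd: "(\<integral>\<^sup>+p. indicator W p * ennreal (cmod (?H \<theta> p)) \<partial>lborel) \<le> ennreal (enn2real ?N)" for \<theta>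
  proof -
    have "?N = (\<integral>\<^sup>+p. ennreal (norm (indicator W p *\<^sub>R (F p * k (base p)))) \<partial>distr lborel borel (R \<theta>))"
      by (simp add: distr)
    also have "\<dots> = (\<integral>\<^sup>+p. ennreal (norm (indicator W (R \<theta> p) *\<^sub>R (F (R \<theta> p) * k (base (R \<theta> p))))) \<partial>lborel)"
      by (rule nn_integral_distr) (use int in \<open>auto simp: set_integrable_def W_def simp del: norm_scaleR dest: borel_measurable_integrable\<close>)
    also have "\<dots> = (\<integral>\<^sup>+p. indicator W p * ennreal (cmod (?H \<theta> p)) \<partial>lborel)"
      by (intro nn_integral_cong) (auto simp: bR RW indicator_def)
    finally show ?thesis using N_fin by simp
  qed
  have "set_integrable lborel W (\<lambda>p. integral {0..1} (\<lambda>\<theta>. ?H \<theta> p))"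
    by (rule Fubini_unit_interval(1)[OF oW cont bd])
  moreover have "set_integrable lborel W (\<lambda>p. integral {0..1} (\<lambda>\<theta>. ?H \<theta> p)) \<longleftrightarrow> set_integrable lborel W (\<lambda>p. F (ext_pt (base p) 0) * k (base p))"
    unfolding set_integrable_def avg' ..
  ultimately show "set_integrable lborel (U_alpha J \<alpha> V) (\<lambda>p. F (ext_pt (base p) 0) * k (base p))" by (simp add: W_def)
  have "(LINT p:W|lborel. F (ext_pt (base p) 0) * k (base p)) = (LINT p:W|lborel. integral {0..1} (\<lambda>\<theta>. ?H \<theta> p))"
    unfolding set_lebesgue_integral_def avg' ..
  also have "\<dots> = integral {0..1} (\<lambda>\<theta>. LINT p:W|lborel. ?H \<theta> p)"
    by (rule Fubini_unit_interval(2)[OF oW cont bd])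
  also have "\<dots> = (LINT p:W|lborel. F p * k (base p))" unfolding inv by simp
  finally show "(LINT p:U_alpha J \<alpha> V|lborel. F (ext_pt (base p) 0) * k (base p)) = (LINT p:U_alpha J \<alpha> V|lborel. F p * k (base p))"
    by (simp add: W_def)
qed

text \<open>For \<open>s = 1 - |w|^2\<close> this maps \<open>V\<close> onto the slice at
  \<open>w\<close>. It is a square root of \<open>pscale\<close> at \<open>s\<close>: applied twice
  it dilates by \<open>s^\<alpha>\<close>.\<close>

definition tscale :: "'n set \<Rightarrow> ('n \<Rightarrow> real) \<Rightarrow> real \<Rightarrow> complex^'n::finite \<Rightarrow> complex^'n" where
  "tscale J \<alpha> s = diag_scale (\<lambda>i. of_real (if i \<in> J then s powr (\<alpha> i / 2) else 1))"

lemma powr_sum_prod: "finite J \<Longrightarrow> s > 0 \<Longrightarrow> (\<Prod>i\<in>J. s powr \<alpha> i) = s powr (\<Sum>i\<in>J. \<alpha> i)" for s :: real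
  by (induction J rule: finite_induct) (auto simp: powr_add)

lemma ext_tscale_mem_U_alpha:
  assumes "cmod w < 1"
  shows "ext_pt (tscale J \<alpha> (1 - (cmod w)\<^sup>2) u) w \<in> U_alpha J \<alpha> V \<longleftrightarrow> u \<in> V"
proof -
  have "f_alpha J \<alpha> (tscale J \<alpha> (1 - (cmod w)\<^sup>2) u) w = u"
    using one_minus_norm_sq_pos[OF assms] by (auto simp: vec_eq_iff f_alpha_def tscale_def)
  then show ?thesis using assms by (simp add: ext_pt_mem_U_alpha)
qed

text \<open>Scaling a complex coordinate by \<open>s^(\<alpha>/2)\<close> has real Jacobian
  \<open>s^\<alpha>\<close>, because two real dimensions are involved.\<close>

lemma prod_tscale:
  fixes J :: "'n::finite set"
  assumes "s > 0"
  shows "(\<Prod>i\<in>UNIV. (cmod (complex_of_real (if i \<in> J then s powr (\<alpha> i / 2) else 1)))\<^sup>2) = s powr (\<Sum>j\<in>J. \<alpha> j)"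
proof -
  have "(\<Prod>i\<in>UNIV. (cmod (complex_of_real (if i \<in> J then s powr (\<alpha> i / 2) else 1)))\<^sup>2) = (\<Prod>i\<in>UNIV. if i \<in> J then s powr \<alpha> i else 1)"
    using assms by (intro prod.cong refl) (auto simp: power2_eq_square powr_add[symmetric])
  also have "\<dots> = (\<Prod>i\<in>J. s powr \<alpha> i)" by (simp add: prod.If_cases)
  finally show ?thesis using powr_sum_prod[of J s \<alpha>] assms by simp
qed

lemma nn_integral_U_alpha_slice:
  assumes w: "cmod w < 1" and F: "(\<lambda>x. indicator (U_alpha J \<alpha> V) (ext_pt x w) * F x) \<in> borel_measurable borel"
  shows "(\<integral>\<^sup>+x. indicator (U_alpha J \<alpha> V) (ext_pt x w) * F x \<partial>lborel) =
    ennreal ((1 - (cmod w)\<^sup>2) powr (\<Sum>j\<in>J. \<alpha> j)) * (\<integral>\<^sup>+u. indicator V u * F (tscale J \<alpha> (1 - (cmod w)\<^sup>2) u) \<partial>lborel)"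
proof -
  have s: "1 - (cmod w)\<^sup>2 > 0" by (rule one_minus_norm_sq_pos[OF w])
  have c0: "complex_of_real (if i \<in> J then (1 - (cmod w)\<^sup>2) powr (\<alpha> i / 2) else 1) \<noteq> 0" for i using s by auto
  show ?thesis
    by (subst nn_integral_diag_scale[OF c0 F], subst prod_tscale[OF s])
       (simp add: ext_tscale_mem_U_alpha[OF w, unfolded tscale_def] tscale_def indicator_def)
qed

lemma integral_diag_scale:
  fixes c :: "'i::finite \<Rightarrow> complex" and G :: "complex^'i \<Rightarrow> complex"
  assumes c: "\<And>i. c i \<noteq> 0" and G [measurable]: "G \<in> borel_measurable borel"
  shows "(LINT x|lborel. G x) = of_real (\<Prod>i\<in>UNIV. (cmod (c i))\<^sup>2) * (LINT x|lborel. G (diag_scale c x))"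
proof -
  define P where "P = (\<Prod>i\<in>UNIV. (cmod (c i))\<^sup>2)"
  have P: "P \<ge> 0" unfolding P_def by (intro prod_nonneg) auto
  have "(LINT x|lborel. G x) = (LINT x|density (distr lborel borel (diag_scale c)) (\<lambda>_. ennreal P). G x)"
    by (rule arg_cong[of _ _ "\<lambda>M. integral\<^sup>L M G"]) (unfold P_def, rule lborel_diag_scale[OF c])
  also have "\<dots> = (LINT x|distr lborel borel (diag_scale c). P *\<^sub>R G x)"
    by (rule integral_density) (use P in auto)
  also have "\<dots> = (LINT x|lborel. P *\<^sub>R G (diag_scale c x))"
    by (rule integral_distr) auto
  also have "\<dots> = of_real P * (LINT x|lborel. G (diag_scale c x))"
    by (simp add: scaleR_conv_of_real)
  finally show ?thesis unfolding P_def .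
qed

lemma integral_U_alpha_slice:
  fixes F :: "complex^'n::finite \<Rightarrow> complex"
  assumes w: "cmod w < 1" and F: "(\<lambda>x. indicator (U_alpha J \<alpha> V) (ext_pt x w) *\<^sub>R F x) \<in> borel_measurable borel"
  shows "(LINT x|lborel. indicator (U_alpha J \<alpha> V) (ext_pt x w) *\<^sub>R F x) =
    of_real ((1 - (cmod w)\<^sup>2) powr (\<Sum>j\<in>J. \<alpha> j)) * (LINT u:V|lborel. F (tscale J \<alpha> (1 - (cmod w)\<^sup>2) u))"
proof -
  have s: "1 - (cmod w)\<^sup>2 > 0" by (rule one_minus_norm_sq_pos[OF w])
  let ?c = "\<lambda>i. complex_of_real (if i \<in> J then (1 - (cmod w)\<^sup>2) powr (\<alpha> i / 2) else 1)"
  let ?G = "\<lambda>x. indicat_real (U_alpha J \<alpha> V) (ext_pt x w) *\<^sub>R F x"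
  have c0: "?c i \<noteq> 0" for i using s by auto
  have "(LINT x|lborel. ?G x) = of_real (\<Prod>i\<in>UNIV. (cmod (?c i))\<^sup>2) * (LINT x|lborel. ?G (diag_scale ?c x))"
    by (rule integral_diag_scale[OF c0 F])
  also have "(LINT x|lborel. ?G (diag_scale ?c x)) = (LINT u:V|lborel. F (tscale J \<alpha> (1 - (cmod w)\<^sup>2) u))"
    unfolding set_lebesgue_integral_def
    by (intro Bochner_Integration.integral_cong refl) (simp add: ext_tscale_mem_U_alpha[OF w, unfolded tscale_def] tscale_def indicator_def)
  finally show ?thesis unfolding prod_tscale[OF s] .
qed

text \<open>Every slice lies in \<open>V\<close>, so the integral is at most
  \<open>nrm2 V \<kappa>\<close> times the area of the disc.\<close>

lemma A2_base:
  fixes V :: "(complex^'n::finite) set"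
  assumes V: "open V" and star: "star_hartogs J V" and \<alpha>: "\<And>j. j \<in> J \<Longrightarrow> \<alpha> j > 0" and \<kappa>: "\<kappa> \<in> A2 V"
  shows "(\<lambda>p. \<kappa> (base p)) \<in> A2 (U_alpha J \<alpha> V)"
proof (rule A2I_nn_integral[OF open_U_alpha[OF V]])
  let ?W = "U_alpha J \<alpha> V"
  show h: "holo_on (\<lambda>p. \<kappa> (base p)) ?W"
    by (rule holo_on_compose[OF A2_holo[OF \<kappa>]]) (auto intro!: holo_on_nth U_alpha_base_mem[OF star \<alpha>])
  let ?F = "\<lambda>p. ennreal (indicator ?W p * (cmod (\<kappa> (base p)))\<^sup>2)"
  have m: "?F \<in> borel_measurable borel"
    using borel_measurable_indicator_sq[OF open_U_alpha[OF V] holo_on_continuous_on[OF h]] by simp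
  have "(\<integral>\<^sup>+p. ?F p \<partial>lborel) = (\<integral>\<^sup>+w. \<integral>\<^sup>+x. ?F (ext_pt x w) \<partial>lborel \<partial>lborel)"
    by (rule nn_integral_ext_pt[OF m])
  also have "\<dots> \<le> (\<integral>\<^sup>+w. indicator (ball (0::complex) 1) w * ennreal (nrm2 V \<kappa>) \<partial>lborel)"
  proof (rule nn_integral_mono)
    fix w :: complex
    show "(\<integral>\<^sup>+x. ?F (ext_pt x w) \<partial>lborel) \<le> indicator (ball 0 1) w * ennreal (nrm2 V \<kappa>)"
    proof (cases "cmod w < 1")
      case True
      have "(\<integral>\<^sup>+x. ?F (ext_pt x w) \<partial>lborel) \<le> (\<integral>\<^sup>+x. ennreal (indicator V x * (cmod (\<kappa> x))\<^sup>2) \<partial>lborel)"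
        by (intro nn_integral_mono) (use U_alpha_base_mem[OF star \<alpha>] in \<open>auto simp: indicator_def dest!: U_alpha_base_mem[OF star \<alpha>, rotated]\<close>)
      then show ?thesis using True nn_integral_sq_eq_nrm2[OF V \<kappa>] by simp
    qed (simp add: ext_pt_mem_U_alpha)
  qed
  also have "\<dots> = ennreal (nrm2 V \<kappa>) * emeasure lborel (ball (0::complex) 1)"
    by (subst mult.commute, subst nn_integral_cmult_indicator) auto
  also have "\<dots> < \<infinity>" using emeasure_lborel_ball_finite[of "0::complex" 1] by (simp add: ennreal_mult_less_top)
  finally show "(\<integral>\<^sup>+p. ?F p \<partial>lborel) < \<infinity>" .
qed

text \<open>Diagonal linear maps commute with the Euler field.\<close>

lemma Dop_diag_scale:
  assumes g: "holo_on g V" and mem: "diag_scale c z \<in> V"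
  shows "Dop J \<alpha> (\<lambda>x. g (diag_scale c x)) z = Dop J \<alpha> g (diag_scale c z)"
proof -
  have "((\<lambda>x. g (diag_scale c x)) has_derivative (\<lambda>v. cderiv g (diag_scale c z) (diag_scale c v))) (at z)"
    by (rule has_derivative_compose[OF bounded_linear_imp_has_derivative[OF bounded_linear_diag_scale]])
       (rule holo_on_has_derivative(1)[OF g mem])
  moreover have "diag_scale c (euler_vec J \<alpha> z) = euler_vec J \<alpha> (diag_scale c z)"
    by (simp add: vec_eq_iff euler_vec_def)
  ultimately show ?thesis by (simp add: Dop_def cderiv_eqI)
qed

text \<open>\<open>s\<^sup>A (Dop g) (s\<^sup>\<alpha> \<zeta>)\<close> is the derivative of \<open>s\<^sup>1\<^sup>+\<^sup>A g (s\<^sup>\<alpha> \<zeta>)\<close>.\<close>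
lemma has_integral_Dop_pscale:
  fixes V :: "(complex^'n::finite) set"
  assumes V: "open V" and star: "star_hartogs J V" and \<alpha>: "\<And>j. j \<in> J \<Longrightarrow> \<alpha> j > 0" and \<zeta>: "\<zeta> \<in> V" and g: "holo_on g V"
  defines "\<Phi> \<equiv> (\<lambda>s. of_real (s powr (\<Sum>j\<in>J. \<alpha> j)) * Dop J \<alpha> g (pscale J \<alpha> (of_real s) \<zeta>))"
  shows "continuous_on {0<..1} \<Phi>" and "(\<Phi> has_integral g \<zeta>) {0..1}"
proof -
  define A where "A = (\<Sum>j\<in>J. \<alpha> j)"
  have A0: "A \<ge> 0" unfolding A_def using \<alpha> by (intro sum_nonneg) (auto simp: less_imp_le)
  define \<phi> where "\<phi> = (\<lambda>c. g (pscale J \<alpha> c \<zeta>))"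
  define H where "H = {c. Re c > 0}"
  have oH: "open H" unfolding H_def by (simp add: open_halfspace_Re_gt)
  \<comment> \<open>An open complex neighbourhood of \<open>(0, 1]\<close> on which
    \<open>\<phi>\<close> is holomorphic, so that its derivative is continuous along the
    interval.\<close>
  define T where "T = {c\<in>H. pscale J \<alpha> c \<zeta> \<in> V}"
  have contp: "continuous_on H (\<lambda>c. pscale J \<alpha> c \<zeta>)"
  proof -
    have "continuous_on H (\<lambda>c. (if i \<in> J then c powr of_real (\<alpha> i) else 1) * \<zeta> $ i)" for i
      by (cases "i \<in> J") (auto intro!: continuous_intros simp: H_def complex_nonpos_Reals_iff)
    then show ?thesis unfolding pscale_def diag_scale_def by (intro continuous_on_vec_lambda)
  qed
  have oT: "open T"
    using continuous_open_preimage[OF contp oH V] by (simp add: T_def vimage_def Int_def)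
  have memT: "of_real s \<in> T" if "0 < s" "s \<le> 1" for s :: real
    using that pscale_mem[OF star \<zeta> _ \<alpha>, of "of_real s"] by (simp add: T_def H_def)
  have der: "(\<phi> has_field_derivative cderiv g (pscale J \<alpha> c \<zeta>) (euler_vec J \<alpha> (pscale J \<alpha> c \<zeta>)) / c) (at c)" if "c \<in> T" for c
    unfolding \<phi>_def by (rule has_field_derivative_pscale[OF g]) (use that in \<open>auto simp: T_def H_def\<close>)
  have hol: "\<phi> holomorphic_on T"
    unfolding holomorphic_on_open[OF oT] using der by blast
  have Dop_eq: "Dop J \<alpha> g (pscale J \<alpha> c \<zeta>) = of_real (1 + A) * \<phi> c + c * deriv \<phi> c" if "c \<in> T" for c
    using DERIV_imp_deriv[OF der[OF that]] that by (auto simp: Dop_def A_def \<phi>_def T_def H_def)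
  have cont_of: "continuous_on {0<..1} (\<lambda>s. h (of_real s :: complex))" if "continuous_on T h" for h :: "complex \<Rightarrow> complex"
    by (rule continuous_on_compose2[OF that]) (use memT in \<open>auto intro!: continuous_intros\<close>)
  have "continuous_on {0<..1} (\<lambda>s. of_real (s powr A) * (of_real (1 + A) * \<phi> (of_real s) + of_real s * deriv \<phi> (of_real s)))"
    by (intro continuous_intros cont_of holomorphic_on_imp_continuous_on hol holomorphic_deriv oT) auto
  then show "continuous_on {0<..1} \<Phi>"
    by (rule continuous_on_eq) (use Dop_eq memT in \<open>auto simp: \<Phi>_def A_def\<close>)
  define u where "u = (\<lambda>s::real. of_real (s powr (1 + A)) * \<phi> (of_real s))"
  \<comment> \<open>Here \<open>u 0 = 0\<close> since \<open>0 powr (1 + A) = 0\<close>. The powers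
    are known only to be continuous at the end point 0, hence the interior form of the fundamental
    theorem.\<close>
  have "(\<Phi> has_integral u 1 - u 0) {0..1}"
  proof (rule fundamental_theorem_of_calculus_interior)
    \<comment> \<open>At \<open>s = 0\<close> the \<open>J\<close>-coordinates become 0,
      continuously because the exponents are positive; star-shapedness keeps that point in
      \<open>V\<close>.\<close>
    have "continuous_on {0..1} (\<lambda>s::real. pscale J \<alpha> (of_real s) \<zeta>)"
    proof -
      have "continuous_on {0..1} (\<lambda>s::real. (if i \<in> J then complex_of_real s powr of_real (\<alpha> i) else 1) * \<zeta> $ i)" for i
      proof (cases "i \<in> J")
        case True
        have "continuous_on {0..1} (\<lambda>s::real. complex_of_real (s powr \<alpha> i) * \<zeta> $ i)"
          using \<alpha>[OF True] by (intro continuous_intros continuous_on_powr') auto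
        then show ?thesis using True by (rule_tac continuous_on_eq) (auto simp: powr_of_real)
      qed simp
      then show ?thesis unfolding pscale_def diag_scale_def by (intro continuous_on_vec_lambda)
    qed
    then have "continuous_on {0..1} (\<lambda>s::real. \<phi> (of_real s))"
      unfolding \<phi>_def by (rule continuous_on_compose2[OF holo_on_continuous_on[OF g]])
        (use pscale_mem[OF star \<zeta> _ \<alpha>] in auto)
    then show "continuous_on {0..1} u"
      unfolding u_def using A0 by (intro continuous_intros continuous_on_powr') auto
    fix s :: real assume s: "s \<in> {0<..<1}"
    have T: "complex_of_real s \<in> T" using s memT by auto
    have d1: "((\<lambda>s. \<phi> (of_real s)) has_vector_derivative deriv \<phi> (of_real s)) (at s)"
      by (rule has_vector_derivative_real_field) (use hol oT T in \<open>auto intro: holomorphic_derivI\<close>)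
    have d2: "((\<lambda>s. complex_of_real (s powr (1 + A))) has_vector_derivative of_real ((1 + A) * s powr A)) (at s)"
      using s has_real_derivative_powr[of s "1 + A"]
      by (intro has_vector_derivative_of_real) (simp add: has_real_derivative_iff_has_vector_derivative)
    have "(u has_vector_derivative (of_real (s powr (1 + A)) * deriv \<phi> (of_real s) + of_real ((1 + A) * s powr A) * \<phi> (of_real s))) (at s)"
      unfolding u_def by (rule has_vector_derivative_mult[OF d2 d1])
    moreover have "of_real (s powr (1 + A)) * deriv \<phi> (of_real s) + of_real ((1 + A) * s powr A) * \<phi> (of_real s) = \<Phi> s"
      using s by (simp add: \<Phi>_def A_def[symmetric] Dop_eq[OF T] powr_add algebra_simps)
    ultimately show "(u has_vector_derivative \<Phi> s) (at s)" by simp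
  qed auto
  then show "(\<Phi> has_integral g \<zeta>) {0..1}" by (simp add: u_def \<phi>_def)
qed

lemma integral_disc_one_minus_norm_sq:
  fixes h :: "real \<Rightarrow> complex"
  assumes h [measurable]: "h \<in> borel_measurable borel"
    and int: "set_integrable lborel (ball (0::complex) 1) (\<lambda>w. h (1 - (cmod w)\<^sup>2))"
  shows "set_integrable lborel {0..1} h"
    and "(LINT w:ball (0::complex) 1|lborel. h (1 - (cmod w)\<^sup>2)) = of_real pi * (LINT s:{0..1}|lborel. h s)"
proof -
  let ?q = "\<lambda>w::complex. 1 - (cmod w)\<^sup>2"
  let ?i = "indicat_real (ball (0::complex) 1)"
  have im: "?i \<in> borel_measurable borel" by (intro borel_measurable_indicator) auto
  have d: "distr (density lborel (\<lambda>w. ennreal (?i w))) borel ?q = density lborel (\<lambda>s. ennreal (pi * indicator {0..1} s))"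
    using distr_disc_one_minus_norm_sq by (simp add: ennreal_indicator)
  have "integrable (density lborel (\<lambda>w. ennreal (?i w))) (\<lambda>w. h (?q w))"
    using int im by (subst integrable_density) (auto simp: set_integrable_def)
  then have "integrable (distr (density lborel (\<lambda>w. ennreal (?i w))) borel ?q) h"
    by (subst integrable_distr_eq) auto
  then have "integrable lborel (\<lambda>s. (pi * indicator {0..1} s) *\<^sub>R h s)"
    unfolding d by (subst (asm) integrable_density) auto
  from integrable_scaleR_right[OF this, of "1 / pi"] show "set_integrable lborel {0..1} h"
    by (simp add: set_integrable_def)
  have "(LINT w:ball (0::complex) 1|lborel. h (?q w)) = (LINT w|density lborel (\<lambda>w. ennreal (?i w)). h (?q w))"
    unfolding set_lebesgue_integral_def using im by (subst integral_density) auto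
  also have "\<dots> = (LINT s|distr (density lborel (\<lambda>w. ennreal (?i w))) borel ?q. h s)"
    by (subst integral_distr) auto
  also have "\<dots> = (LINT s|lborel. (pi * indicator {0..1} s) *\<^sub>R h s)"
    unfolding d by (subst integral_density) auto
  also have "\<dots> = of_real pi * (LINT s:{0..1}|lborel. h s)"
  proof -
    have "(pi * indicator {0..1} s) *\<^sub>R h s = of_real pi * (indicator {0..1} s *\<^sub>R h s)" for s
      by (simp add: scaleR_conv_of_real)
    then show ?thesis unfolding set_lebesgue_integral_def by (simp only: integral_mult_right_zero)
  qed
  finally show "(LINT w:ball (0::complex) 1|lborel. h (?q w)) = of_real pi * (LINT s:{0..1}|lborel. h s)" .
qed

text \<open>After averaging, a slice integral depends on \<open>w\<close> only through
  \<open>s\<close>, so the integral over the disc is \<open>pi\<close> times one over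
  \<open>s\<close>. This is where the constant \<open>pi\<close> comes from.\<close>

lemma U_alpha_center_reproducing:
  fixes V :: "(complex^'n::finite) set"
  assumes V: "open V" and star: "star_hartogs J V" and \<alpha>: "\<And>j. j \<in> J \<Longrightarrow> \<alpha> j > 0" and \<zeta>: "\<zeta> \<in> V"
    and \<kappa>: "\<kappa> \<in> A2 V" "\<And>f. f \<in> A2 V \<Longrightarrow> ip V f \<kappa> = Dop J \<alpha> f \<zeta>"
    and f: "f \<in> A2 (U_alpha J \<alpha> V)"
  shows "ip (U_alpha J \<alpha> V) f (\<lambda>p. \<kappa> (base p)) = of_real pi * f (ext_pt \<zeta> 0)"
proof -
  define W where "W = U_alpha J \<alpha> V"
  define A where "A = (\<Sum>j\<in>J. \<alpha> j)"
  have W: "open W" unfolding W_def by (rule open_U_alpha[OF V])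
  have fW: "f \<in> A2 W" using f by (simp add: W_def)
  define g where "g = (\<lambda>x. f (ext_pt x 0))"
  have g: "holo_on g V"
    unfolding g_def
  proof (rule holo_on_compose[OF A2_holo[OF f]])
    show "holo_on (\<lambda>x. ext_pt x 0 $ i) V" for i
      by (rule holo_on_vec_option) (auto intro: holo_on_const holo_on_nth)
  qed (simp add: ext_pt_mem_U_alpha)
  have \<kappa>b: "(\<lambda>p. \<kappa> (base p)) \<in> A2 W" unfolding W_def by (rule A2_base[OF V star \<alpha> \<kappa>(1)])
  have ck: "continuous_on V (\<lambda>x. cnj (\<kappa> x))" by (intro continuous_intros A2_continuous_on[OF \<kappa>(1)])
  note int0 = A2_mult_cnj_integrable[OF W fW \<kappa>b]
  have int1: "set_integrable lborel W (\<lambda>p. g (base p) * cnj (\<kappa> (base p)))"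
    and eq1: "(LINT p:W|lborel. g (base p) * cnj (\<kappa> (base p))) = ip W f (\<lambda>p. \<kappa> (base p))"
    using U_alpha_average[OF V star \<alpha> A2_holo[OF f] ck] int0 by (simp_all add: g_def W_def ip_def)
  \<comment> \<open>The integrand is \<open>f * f\<close>, with modulus \<open>|f|^2\<close>. Unlike
    \<open>|f|^2\<close> it is holomorphic and can be averaged, which yields integrability of
    \<open>|g|^2\<close> over \<open>W\<close>.\<close>
  have "set_integrable lborel W (\<lambda>p. f p * cnj (cnj (f p)))"
    using A2_sq_integrable[OF W fW] A2_continuous_on[OF fW] W
    by (intro set_integrable_mult_cnj) (auto intro!: continuous_intros)
  then have int2: "set_integrable lborel W (\<lambda>p. g (base p) * g (base p))"
    using U_alpha_average(1)[OF V star \<alpha> holo_on_mult[OF A2_holo[OF f] A2_holo[OF f]], of "\<lambda>_. 1"]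
    by (simp add: g_def W_def)
  define \<Phi> where "\<Phi> = (\<lambda>s. of_real (s powr A) * Dop J \<alpha> g (pscale J \<alpha> (of_real s) \<zeta>))"
  \<comment> \<open>Cut off to be Borel on the whole line. On \<open>[0, 1]\<close> it agrees with
    \<open>\<Phi>\<close>, also at 0, where \<open>0 powr A = 0\<close>.\<close>
  define \<Psi> where "\<Psi> = (\<lambda>s::real. indicator {0<..1} s *\<^sub>R \<Phi> s)"
  have \<Psi>m [measurable]: "\<Psi> \<in> borel_measurable borel"
    unfolding \<Psi>_def using has_integral_Dop_pscale(1)[OF V star \<alpha> \<zeta> g]
    by (intro borel_measurable_continuous_on_indicator) (auto simp: \<Phi>_def A_def)
  define F1 where "F1 = (\<lambda>p. indicator W p *\<^sub>R (g (base p) * cnj (\<kappa> (base p))))"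
  define F2 where "F2 = (\<lambda>p. indicator W p *\<^sub>R (g (base p) * g (base p)))"
  have F1: "integrable lborel F1" using int1 by (simp add: F1_def set_integrable_def)
  have F2: "integrable lborel F2" using int2 by (simp add: F2_def set_integrable_def)
  have em [measurable]: "(\<lambda>x. ext_pt x w) \<in> borel_measurable borel" for w :: complex
    by (intro borel_measurable_continuous_onI continuous_intros)
  have F1m [measurable]: "F1 \<in> borel_measurable borel" and F2m [measurable]: "F2 \<in> borel_measurable borel"
    using F1 F2 by (auto dest: borel_measurable_integrable)
  \<comment> \<open>Restricted to \<open>w\<close> whose slice of \<open>|g|^2\<close> is
    integrable, which is almost every \<open>w\<close>: only then is the dilated \<open>g\<close>
    known to be in \<open>A2 V\<close>.\<close>
  have slice: "(LINT x|lborel. F1 (ext_pt x w)) = indicator (ball 0 1) w *\<^sub>R \<Psi> (1 - (cmod w)\<^sup>2)"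
    if intw: "integrable lborel (\<lambda>x. F2 (ext_pt x w))" for w
  proof (cases "cmod w < 1")
    case False
    then show ?thesis by (simp add: F1_def W_def ext_pt_mem_U_alpha)
  next
    case True
    define s where "s = 1 - (cmod w)\<^sup>2"
    have s: "0 < s" "s \<le> 1" using one_minus_norm_sq_pos[OF True] by (auto simp: s_def)
    define t where "t = (\<lambda>i. if i \<in> J then s powr (\<alpha> i / 2) else 1)"
    have t: "0 < t i" "t i \<le> 1" "i \<notin> J \<Longrightarrow> t i = 1" for i
      using s \<alpha>[of i] by (auto simp: t_def intro!: powr_le1)
    have ts: "tscale J \<alpha> s = diag_scale (\<lambda>i. of_real (t i))" by (simp add: tscale_def t_def)
    have mem: "diag_scale (\<lambda>i. of_real (t i)) x \<in> V" if "x \<in> V" for x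
      by (rule star_hartogs_diag_scale[OF star that]) (use t in \<open>auto simp: abs_of_pos\<close>)
    have t0: "complex_of_real (t i) \<noteq> 0" for i using t(1)[of i] by simp
    let ?T = "diag_scale (\<lambda>i. complex_of_real (t i)) :: complex^'n \<Rightarrow> _"
    have TT: "?T (?T \<zeta>) = pscale J \<alpha> (of_real s) \<zeta>"
      using s by (auto simp: vec_eq_iff t_def pscale_def powr_of_real powr_add[symmetric] mult.assoc[symmetric] simp flip: of_real_mult)
    have gT: "(\<lambda>x. g (?T x)) \<in> A2 V"
    proof (rule A2I_nn_integral[OF V holo_on_diag_scale[OF g mem]])
      have eqn: "ennreal (norm (F2 (ext_pt x w))) = indicator (U_alpha J \<alpha> V) (ext_pt x w) * ennreal ((cmod (g x))\<^sup>2)" for x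
        by (auto simp: F2_def W_def indicator_def norm_mult power2_eq_square)
      have m: "(\<lambda>x. indicator (U_alpha J \<alpha> V) (ext_pt x w) * ennreal ((cmod (g x))\<^sup>2)) \<in> borel_measurable borel"
        unfolding eqn[symmetric] by measurable
      have "(\<integral>\<^sup>+x. ennreal (norm (F2 (ext_pt x w))) \<partial>lborel) < \<infinity>"
        using intw by (simp add: integrable_iff_bounded)
      then have "ennreal (s powr A) * (\<integral>\<^sup>+u. indicator V u * ennreal ((cmod (g (?T u)))\<^sup>2) \<partial>lborel) < \<infinity>"
        unfolding eqn nn_integral_U_alpha_slice[OF True m] by (simp add: s_def[symmetric] ts A_def)
      then have "(\<integral>\<^sup>+u. indicator V u * ennreal ((cmod (g (?T u)))\<^sup>2) \<partial>lborel) < \<infinity>"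
        using s by (auto simp: ennreal_mult_less_top)
      moreover have "indicator V u * ennreal ((cmod (g (?T u)))\<^sup>2) = ennreal (indicator V u * (cmod (g (?T u)))\<^sup>2)" for u
        by (auto simp: indicator_def)
      ultimately show "(\<integral>\<^sup>+u. ennreal (indicator V u * (cmod (g (?T u)))\<^sup>2) \<partial>lborel) < \<infinity>" by simp
    qed auto
    have gTT: "(\<lambda>x. g (?T (?T x))) \<in> A2 V" by (rule A2_diag_scale[OF V gT t0 mem])
    have "(LINT x|lborel. F1 (ext_pt x w)) = (LINT x|lborel. indicator (U_alpha J \<alpha> V) (ext_pt x w) *\<^sub>R (g x * cnj (\<kappa> x)))"
      by (simp add: F1_def W_def)
    also have "\<dots> = of_real (s powr A) * (LINT u:V|lborel. g (?T u) * cnj (\<kappa> (?T u)))"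
    proof -
      have "(\<lambda>x. F1 (ext_pt x w)) \<in> borel_measurable borel" by measurable
      then have "(\<lambda>x. indicator (U_alpha J \<alpha> V) (ext_pt x w) *\<^sub>R (g x * cnj (\<kappa> x))) \<in> borel_measurable borel"
        by (simp add: F1_def W_def)
      from integral_U_alpha_slice[OF True this] show ?thesis by (simp add: s_def[symmetric] ts A_def)
    qed
    also have "(LINT u:V|lborel. g (?T u) * cnj (\<kappa> (?T u))) = ip V (\<lambda>x. g (?T x)) (\<lambda>x. \<kappa> (?T x))"
      by (simp add: ip_def)
    \<comment> \<open>The half-dilation on \<kappa> moves over to \<open>g\<close>, where the two
      together make the full dilation \<open>s^\<alpha>\<close> of \<open>TT\<close>.\<close>
    also have "\<dots> = ip V (\<lambda>x. g (?T (?T x))) \<kappa>"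
      by (rule ip_dilate[OF V star t gT \<kappa>(1), symmetric])
    also have "\<dots> = Dop J \<alpha> (\<lambda>x. g (?T (?T x))) \<zeta>" by (rule \<kappa>(2)[OF gTT])
    also have "\<dots> = Dop J \<alpha> g (?T (?T \<zeta>))"
      by (subst Dop_diag_scale[OF A2_holo[OF gT] mem[OF \<zeta>]], subst Dop_diag_scale[OF g mem[OF mem[OF \<zeta>]]]) simp
    finally show ?thesis using True s by (simp add: TT \<Psi>_def \<Phi>_def s_def[symmetric])
  qed
  have AE: "AE w in lborel. (LINT x|lborel. F1 (ext_pt x w)) = indicator (ball 0 1) w *\<^sub>R \<Psi> (1 - (cmod w)\<^sup>2)"
    using integral_ext_pt(3)[OF F2] by eventually_elim (rule slice)
  have Lm: "(\<lambda>w. LINT x|lborel. F1 (ext_pt x w)) \<in> borel_measurable lborel"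
    using integral_ext_pt(1)[OF F1] by (rule borel_measurable_integrable)
  have Rm: "(\<lambda>w::complex. indicator (ball 0 1) w *\<^sub>R \<Psi> (1 - (cmod w)\<^sup>2)) \<in> borel_measurable lborel"
    by (intro borel_measurable_scaleR borel_measurable_indicator measurable_compose[OF _ \<Psi>m]) auto
  have eq2: "(LINT p|lborel. F1 p) = (LINT w:ball 0 1|lborel. \<Psi> (1 - (cmod w)\<^sup>2))"
    unfolding integral_ext_pt(2)[OF F1] set_lebesgue_integral_def by (rule integral_cong_AE[OF Lm Rm AE])
  have int3: "set_integrable lborel (ball (0::complex) 1) (\<lambda>w. \<Psi> (1 - (cmod w)\<^sup>2))"
    unfolding set_integrable_def using integrable_cong_AE[OF Lm Rm AE] integral_ext_pt(1)[OF F1] by simp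
  note disc = integral_disc_one_minus_norm_sq[OF \<Psi>m int3]
  have "(LINT s:{0..1}|lborel. \<Psi> s) = integral {0..1} \<Psi>"
    by (rule set_borel_integral_eq_integral(2)[OF disc(1)])
  also have "\<dots> = integral {0..1} \<Phi>"
    by (rule integral_cong) (auto simp: \<Psi>_def \<Phi>_def indicator_def)
  also have "\<dots> = g \<zeta>"
    using has_integral_Dop_pscale(2)[OF V star \<alpha> \<zeta> g] by (simp add: has_integral_iff \<Phi>_def A_def)
  finally have "(LINT s:{0..1}|lborel. \<Psi> s) = f (ext_pt \<zeta> 0)" by (simp add: g_def)
  moreover have "ip W f (\<lambda>p. \<kappa> (base p)) = (LINT p|lborel. F1 p)"
    unfolding eq1[symmetric] by (simp add: F1_def set_lebesgue_integral_def)
  ultimately show ?thesis using eq2 disc(2) by (simp add: W_def)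
qed

section \<open>Reduction to the centre of the disc\<close>

text \<open>In the right half-plane \<open>Ln (a / q) = ln a - Ln q\<close> holds without a jump of
  the branch.\<close>

lemma divide_powr_real:
  assumes a: "a > 0" and q: "Re q > 0"
  shows "(of_real a / q) powr of_real r = of_real (a powr r) * q powr (- of_real r)"
proof -
  have q0: "q \<noteq> 0" "q \<notin> \<real>\<^sub>\<le>\<^sub>0" using q by (auto simp: complex_nonpos_Reals_iff)
  have "Ln (of_real a * inverse q) = of_real (ln a) + Ln (inverse q)"
    using Ln_times_of_real[of a "inverse q"] a q0 by (simp add: Ln_of_real)
  also have "Ln (inverse q) = - Ln q" using q0 by (intro Ln_inverse)
  finally have "(of_real a / q) powr of_real r = exp (of_real (r * ln a) + - of_real r * Ln q)"
    using a q0 by (simp add: powr_def divide_inverse right_diff_distrib)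
  also have "\<dots> = of_real (a powr r) * q powr (- of_real r)"
    using a q0 unfolding exp_add exp_of_real by (simp add: powr_def)
  finally show ?thesis .
qed

lemma star_hartogs_U_alpha_eta:
  assumes "star_hartogs J \<Omega>"
  shows "star_hartogs J (U_alpha_eta J \<alpha> \<Omega> \<eta>)"
  unfolding star_hartogs_def
proof (intro ballI allI impI)
  fix x l assume x: "x \<in> U_alpha_eta J \<alpha> \<Omega> \<eta>" and l: "\<forall>j\<in>J. cmod (l j) \<le> 1"
  have "f_alpha J \<alpha> (\<chi> i. if i \<in> J then l i * x $ i else x $ i) \<eta> = (\<chi> i. if i \<in> J then l i * f_alpha J \<alpha> x \<eta> $ i else f_alpha J \<alpha> x \<eta> $ i)"
    by (simp add: vec_eq_iff f_alpha_def)
  moreover have "\<dots> \<in> \<Omega>"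
    using assms x l unfolding star_hartogs_def U_alpha_eta_def by (auto simp: ext_pt_mem_U_alpha)
  ultimately show "(\<chi> i. if i \<in> J then l i * x $ i else x $ i) \<in> U_alpha_eta J \<alpha> \<Omega> \<eta>"
    using x by (simp add: U_alpha_eta_def ext_pt_mem_U_alpha)
qed

lemma open_U_alpha_eta:
  assumes "open \<Omega>"
  shows "open (U_alpha_eta J \<alpha> \<Omega> \<eta>)"
proof -
  have "U_alpha_eta J \<alpha> \<Omega> \<eta> = (\<lambda>x. ext_pt x \<eta>) -` U_alpha J \<alpha> \<Omega>"
    by (auto simp: U_alpha_eta_def)
  then show ?thesis using open_vimage[OF open_U_alpha[OF assms], of "\<lambda>x. ext_pt x \<eta>"] by (simp add: continuous_intros)
qed

section \<open>The lifted automorphism and its change of variables\<close>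

text \<open>Under \<open>disc_aut\<close> the quantity \<open>1 - |w|^2\<close> acquires the factor
  \<open>|1 + cnj \<eta> w|^(-2)\<close>; this multiplier compensates for it in
  \<open>f_alpha\<close> up to a phase. The base has positive real part, so the principal power is
  holomorphic.\<close>

definition aut_factor :: "'n set \<Rightarrow> ('n \<Rightarrow> real) \<Rightarrow> complex \<Rightarrow> complex \<Rightarrow> 'n \<Rightarrow> complex" where
  "aut_factor J \<alpha> \<eta> w i = (if i \<in> J then (1 + cnj \<eta> * w) powr (- of_real (\<alpha> i)) else 1)"

text \<open>The automorphism of the disc taking 0 to \<open>\<eta>\<close> lifts to a biholomorphic map from
  \<open>U_alpha\<close> over the slice at \<open>\<eta>\<close> onto \<open>U_alpha\<close> over \<open>\<Omega>\<close>.\<close>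
definition aut :: "'n set \<Rightarrow> ('n \<Rightarrow> real) \<Rightarrow> complex \<Rightarrow> complex^('n::finite option) \<Rightarrow> complex^('n option)" where
  "aut J \<alpha> \<eta> p = ext_pt (diag_scale (aut_factor J \<alpha> \<eta> (p $ None)) (base p)) (disc_aut \<eta> (p $ None))"

lemma aut_factor_nonzero:
  assumes "cmod \<eta> < 1" "cmod w < 1"
  shows "aut_factor J \<alpha> \<eta> w i \<noteq> 0"
proof -
  have "1 + cnj \<eta> * w \<noteq> 0" by (rule one_plus_cnj_mult_nonzero[OF assms])
  then show ?thesis by (simp add: aut_factor_def)
qed

text \<open>\<open>f_alpha\<close> of the image point is \<open>f_alpha\<close> taken at
  \<open>v\<close> and then at \<open>\<eta>\<close>, times the unimodular factors \<open>u\<close>.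
  Star-shapedness applied to \<open>u\<close> and to \<open>1 / u\<close> removes these
  phases.\<close>

lemma aut_mem_iff:
  assumes star: "star_hartogs J \<Omega>" and \<eta>: "cmod \<eta> < 1" and w: "cmod (p $ None) < 1"
  shows "aut J \<alpha> \<eta> p \<in> U_alpha J \<alpha> \<Omega> \<longleftrightarrow> p \<in> U_alpha J \<alpha> (U_alpha_eta J \<alpha> \<Omega> \<eta>)"
proof -
  define v where "v = p $ None"
  define q where "q = 1 + cnj \<eta> * v"
  define y where "y = f_alpha J \<alpha> (f_alpha J \<alpha> (base p) v) \<eta>"
  define u where "u = (\<lambda>i. aut_factor J \<alpha> \<eta> v i * (if i \<in> J then of_real (cmod q powr \<alpha> i) else 1))"
  have v: "cmod v < 1" using w by (simp add: v_def)
  have q0: "q \<noteq> 0" unfolding q_def by (rule one_plus_cnj_mult_nonzero[OF \<eta> v])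
  have u1: "cmod (u i) = 1" for i
    using q0 by (auto simp: u_def aut_factor_def q_def[symmetric] norm_mult norm_inverse norm_powr_real_powr' powr_minus)
  have u0: "u i \<noteq> 0" for i using u1[of i] by auto
  have uJ: "u i = 1" if "i \<notin> J" for i using that by (simp add: u_def aut_factor_def)
  have a: "0 < 1 - (cmod v)\<^sup>2" "0 < 1 - (cmod \<eta>)\<^sup>2" "0 < (cmod q)\<^sup>2"
    using one_minus_norm_sq_pos[OF v] one_minus_norm_sq_pos[OF \<eta>] q0 by auto
  have fac: "(1 - (cmod (disc_aut \<eta> v))\<^sup>2) powr (\<alpha> i / 2) = (1 - (cmod v)\<^sup>2) powr (\<alpha> i / 2) * (1 - (cmod \<eta>)\<^sup>2) powr (\<alpha> i / 2) / cmod q powr \<alpha> i" for i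
  proof -
    have "((cmod q)\<^sup>2) powr (\<alpha> i / 2) = cmod q powr \<alpha> i"
      using q0 by (simp add: powr_powr flip: powr_numeral)
    then show ?thesis
      unfolding one_minus_norm_disc_aut[OF \<eta> v] q_def[symmetric] using a by (simp add: powr_divide powr_mult)
  qed
  have eq: "f_alpha J \<alpha> (diag_scale (aut_factor J \<alpha> \<eta> v) (base p)) (disc_aut \<eta> v) = diag_scale u y"
    by (auto simp: vec_eq_iff f_alpha_def y_def u_def fac aut_factor_def)
  have "diag_scale u y \<in> \<Omega> \<longleftrightarrow> y \<in> \<Omega>"
  proof
    assume "diag_scale u y \<in> \<Omega>"
    then have "diag_scale (\<lambda>i. 1 / u i) (diag_scale u y) \<in> \<Omega>"
      by (rule star_hartogs_diag_scale[OF star]) (auto simp: norm_divide u1 uJ)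
    moreover have "diag_scale (\<lambda>i. 1 / u i) (diag_scale u y) = y" using u0 by (simp add: vec_eq_iff)
    ultimately show "y \<in> \<Omega>" by simp
  qed (rule star_hartogs_diag_scale[OF star], auto simp: u1 uJ)
  then show ?thesis
    using norm_disc_aut_less_1[OF \<eta> v] \<eta> v
    by (simp add: aut_def mem_U_alpha[of p] ext_pt_mem_U_alpha U_alpha_eta_def eq y_def v_def[symmetric])
qed

lemma holo_on_one_plus_powr:
  assumes \<eta>: "cmod \<eta> < 1" and E: "\<And>p. p \<in> E \<Longrightarrow> cmod (p $ None) < 1"
  shows "holo_on (\<lambda>p. (1 + cnj \<eta> * p $ None) powr c) E"
proof (rule holo_on_compose_field[where \<phi>="\<lambda>z. z powr c" and \<phi>'="\<lambda>z. c * z powr (c - 1)"])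
  show "holo_on (\<lambda>p. 1 + cnj \<eta> * p $ None) E" by (intro holo_on_add holo_on_mult holo_on_const holo_on_nth)
  fix p assume "p \<in> E"
  then have "Re (1 + cnj \<eta> * p $ None) > 0" using one_plus_cnj_mult_pos_Re[OF \<eta> E] by simp
  then show "((\<lambda>z. z powr c) has_field_derivative c * (1 + cnj \<eta> * p $ None) powr (c - 1)) (at (1 + cnj \<eta> * p $ None))"
    by (intro has_field_derivative_powr) (auto simp: complex_nonpos_Reals_iff)
qed

lemma holo_on_aut:
  assumes \<eta>: "cmod \<eta> < 1" and E: "\<And>p. p \<in> E \<Longrightarrow> cmod (p $ None) < 1"
  shows "holo_on (\<lambda>p. aut J \<alpha> \<eta> p $ i) E"
proof (rule holo_on_vec_option)
  show "holo_on (\<lambda>p. aut J \<alpha> \<eta> p $ None) E"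
    unfolding aut_def ext_pt_nth
    by (rule holo_on_compose_field[OF holo_on_nth has_field_derivative_disc_aut[OF \<eta> E]])
  fix j
  show "holo_on (\<lambda>p. aut J \<alpha> \<eta> p $ Some j) E"
    unfolding aut_def ext_pt_nth diag_scale_nth base_nth aut_factor_def
    by (cases "j \<in> J") (auto intro!: holo_on_mult holo_on_nth holo_on_one_plus_powr[OF \<eta> E] holo_on_const)
qed

lemma continuous_on_aut:
  assumes \<eta>: "cmod \<eta> < 1" and E: "\<And>p. p \<in> E \<Longrightarrow> cmod (p $ None) < 1"
  shows "continuous_on E (aut J \<alpha> \<eta>)"
proof -
  have "continuous_on E (\<lambda>p. \<chi> i. aut J \<alpha> \<eta> p $ i)"
    by (intro continuous_on_vec_lambda holo_on_continuous_on holo_on_aut[OF \<eta> E])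
  then show ?thesis by simp
qed

text \<open>The squared modulus of the complex Jacobian: with \<open>q = 1 + cnj \<eta> * w\<close>,
  \<open>disc_aut\<close> contributes \<open>(1 - |\<eta>|^2) / q^2\<close> and the fibre
  multipliers together \<open>q^(-A)\<close>.\<close>

definition aut_jac :: "'n set \<Rightarrow> ('n \<Rightarrow> real) \<Rightarrow> complex \<Rightarrow> complex \<Rightarrow> real" where
  "aut_jac J \<alpha> \<eta> w = ((1 - (cmod \<eta>)\<^sup>2) * cmod (1 + cnj \<eta> * w) powr (- (2 + (\<Sum>j\<in>J. \<alpha> j))))\<^sup>2"

lemma prod_aut_factor:
  fixes J :: "'n::finite set"
  assumes "1 + cnj \<eta> * w \<noteq> 0"
  shows "(\<Prod>i\<in>UNIV. (cmod (aut_factor J \<alpha> \<eta> w i))\<^sup>2) = (cmod (1 + cnj \<eta> * w) powr (- (\<Sum>j\<in>J. \<alpha> j)))\<^sup>2"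
proof -
  have "(\<Prod>i\<in>UNIV. (cmod (aut_factor J \<alpha> \<eta> w i))\<^sup>2) = (\<Prod>i\<in>UNIV. if i \<in> J then (cmod (1 + cnj \<eta> * w) powr (- \<alpha> i))\<^sup>2 else 1)"
    by (intro prod.cong refl) (auto simp: aut_factor_def norm_powr_real_powr' simp flip: of_real_minus)
  also have "\<dots> = (\<Prod>i\<in>J. cmod (1 + cnj \<eta> * w) powr (- \<alpha> i))\<^sup>2"
    by (simp add: prod.If_cases prod_power_distrib)
  also have "(\<Prod>i\<in>J. cmod (1 + cnj \<eta> * w) powr (- \<alpha> i)) = cmod (1 + cnj \<eta> * w) powr (\<Sum>i\<in>J. - \<alpha> i)"
    using assms by (intro powr_sum_prod) auto
  finally show ?thesis by (simp add: sum_negf)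
qed

text \<open>\<open>aut\<close> is triangular: it acts on the disc variable alone and is diagonal on
  each fibre, so the planar and the diagonal change of variables combine by Fubini. The indicator in
  front of \<open>aut\<close> makes it Borel on the whole space.\<close>

lemma nn_integral_aut:
  fixes \<Omega> :: "(complex^'n::finite) set"
  assumes \<Omega>: "open \<Omega>" and star: "star_hartogs J \<Omega>" and \<eta>: "cmod \<eta> < 1"
    and F [measurable]: "F \<in> borel_measurable borel" and F0: "\<And>p. p \<notin> U_alpha J \<alpha> \<Omega> \<Longrightarrow> F p = 0"
  defines "W \<equiv> U_alpha J \<alpha> (U_alpha_eta J \<alpha> \<Omega> \<eta>)"
  shows "(\<integral>\<^sup>+p. F p \<partial>lborel) = (\<integral>\<^sup>+p. indicator W p * (ennreal (aut_jac J \<alpha> \<eta> (p $ None)) * F (indicator W p *\<^sub>R aut J \<alpha> \<eta> p)) \<partial>lborel)"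
proof -
  have V: "open (U_alpha_eta J \<alpha> \<Omega> \<eta>)" by (rule open_U_alpha_eta[OF \<Omega>])
  have W: "open W" unfolding W_def by (rule open_U_alpha[OF V])
  have Wlt: "cmod (p $ None) < 1" if "p \<in> W" for p using that by (simp add: W_def mem_U_alpha)
  have Wm [measurable]: "W \<in> sets borel" using W by simp
  have am [measurable]: "(\<lambda>p. indicator W p *\<^sub>R aut J \<alpha> \<eta> p) \<in> borel_measurable borel"
    by (rule borel_measurable_continuous_on_indicator[OF _ continuous_on_aut[OF \<eta> Wlt]]) auto
  have nm [measurable]: "(\<lambda>p::complex^('n option). p $ None) \<in> borel_measurable borel"
    by (intro borel_measurable_continuous_onI continuous_intros)
  have jm [measurable]: "(\<lambda>w. aut_jac J \<alpha> \<eta> w) \<in> borel_measurable borel"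
    unfolding aut_jac_def by measurable
  have em [measurable]: "(\<lambda>x. ext_pt x w) \<in> borel_measurable borel" for w :: complex
    by (intro borel_measurable_continuous_onI continuous_intros)
  have Rm: "(\<lambda>p. indicator W p * (ennreal (aut_jac J \<alpha> \<eta> (p $ None)) * F (indicator W p *\<^sub>R aut J \<alpha> \<eta> p))) \<in> borel_measurable borel"
    by measurable
  define G where "G = (\<lambda>w. \<integral>\<^sup>+x. F (ext_pt x w) \<partial>lborel)"
  have Gm [measurable]: "G \<in> borel_measurable borel"
  proof -
    have "(\<lambda>p. F (ext_pt (snd p) (fst p))) \<in> borel_measurable (borel \<Otimes>\<^sub>M lborel)"
      by (intro measurable_compose[OF _ F] ) (auto intro!: borel_measurable_continuous_onI continuous_intros simp: borel_prod cong: measurable_cong_sets[OF sets_pair_measure_cong[OF refl sets_lborel]])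
    then have "(\<lambda>w. \<integral>\<^sup>+x. (\<lambda>w x. F (ext_pt x w)) w x \<partial>lborel) \<in> borel_measurable borel"
      by (intro lborel.borel_measurable_nn_integral) (simp add: case_prod_unfold)
    then show ?thesis by (simp add: G_def)
  qed
  have "(\<integral>\<^sup>+p. F p \<partial>lborel) = (\<integral>\<^sup>+w. G w \<partial>lborel)"
    unfolding G_def by (rule nn_integral_ext_pt[OF F])
  also have "\<dots> = (\<integral>\<^sup>+w. indicator (ball 0 1) w * G w \<partial>lborel)"
  proof (rule nn_integral_cong)
    fix w :: complex
    show "G w = indicator (ball 0 1) w * G w"
      by (cases "cmod w < 1") (auto simp: G_def F0 ext_pt_mem_U_alpha)
  qed
  also have "\<dots> = (\<integral>\<^sup>+w. indicator (ball 0 1) w * (ennreal ((cmod ((1 - (cmod \<eta>)\<^sup>2) / (1 + cnj \<eta> * w)\<^sup>2))\<^sup>2) * G (disc_aut \<eta> w)) \<partial>lborel)"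
    by (rule nn_integral_disc_aut[OF \<eta> Gm])
  also have "\<dots> = (\<integral>\<^sup>+w. \<integral>\<^sup>+x. (\<lambda>p. indicator W p * (ennreal (aut_jac J \<alpha> \<eta> (p $ None)) * F (indicator W p *\<^sub>R aut J \<alpha> \<eta> p))) (ext_pt x w) \<partial>lborel \<partial>lborel)"
  proof (rule nn_integral_cong)
    fix w :: complex
    let ?q = "1 + cnj \<eta> * w"
    show "indicator (ball 0 1) w * (ennreal ((cmod ((1 - (cmod \<eta>)\<^sup>2) / ?q\<^sup>2))\<^sup>2) * G (disc_aut \<eta> w)) =
      (\<integral>\<^sup>+x. (\<lambda>p. indicator W p * (ennreal (aut_jac J \<alpha> \<eta> (p $ None)) * F (indicator W p *\<^sub>R aut J \<alpha> \<eta> p))) (ext_pt x w) \<partial>lborel)"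
    proof (cases "cmod w < 1")
      case False
      then have "ext_pt x w \<notin> W" for x using Wlt[of "ext_pt x w"] by auto
      then show ?thesis using False by simp
    next
      case True
      have q0: "?q \<noteq> 0" by (rule one_plus_cnj_mult_nonzero[OF \<eta> True])
      let ?c = "aut_factor J \<alpha> \<eta> w"
      \<comment> \<open>Off \<open>W\<close> the point is carried outside \<open>U_alpha\<close>,
        where \<open>F\<close> vanishes by \<open>F0\<close>.\<close>
      have Fx: "F (ext_pt (diag_scale ?c x) (disc_aut \<eta> w)) = indicator W (ext_pt x w) * F (indicator W (ext_pt x w) *\<^sub>R aut J \<alpha> \<eta> (ext_pt x w))" for x
        using aut_mem_iff[OF star \<eta>, of "ext_pt x w"] True F0[of "aut J \<alpha> \<eta> (ext_pt x w)"]
        by (cases "ext_pt x w \<in> W") (auto simp: W_def aut_def)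
      have "G (disc_aut \<eta> w) = ennreal ((cmod ?q powr (- (\<Sum>j\<in>J. \<alpha> j)))\<^sup>2) * (\<integral>\<^sup>+x. F (ext_pt (diag_scale ?c x) (disc_aut \<eta> w)) \<partial>lborel)"
        unfolding G_def prod_aut_factor[OF q0, symmetric]
        by (rule nn_integral_diag_scale[OF aut_factor_nonzero[OF \<eta> True]]) measurable
      moreover have "(cmod ((1 - (cmod \<eta>)\<^sup>2) / ?q\<^sup>2))\<^sup>2 * (cmod ?q powr (- (\<Sum>j\<in>J. \<alpha> j)))\<^sup>2 = aut_jac J \<alpha> \<eta> w"
      proof -
        have "cmod (complex_of_real (1 - (cmod \<eta>)\<^sup>2) / ?q\<^sup>2) = (1 - (cmod \<eta>)\<^sup>2) * cmod ?q powr (- 2)"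
          unfolding norm_divide norm_of_real norm_power using q0 one_minus_norm_sq_pos[OF \<eta>]
          by (simp add: powr_minus divide_inverse)
        moreover have "cmod ?q powr (- (2 + (\<Sum>j\<in>J. \<alpha> j))) = cmod ?q powr (- 2) * cmod ?q powr (- (\<Sum>j\<in>J. \<alpha> j))"
          by (simp add: powr_add[symmetric])
        ultimately show ?thesis unfolding aut_jac_def by (simp add: power_mult_distrib)
      qed
      ultimately have "indicator (ball 0 1) w * (ennreal ((cmod ((1 - (cmod \<eta>)\<^sup>2) / ?q\<^sup>2))\<^sup>2) * G (disc_aut \<eta> w)) =
         ennreal (aut_jac J \<alpha> \<eta> w) * (\<integral>\<^sup>+x. F (ext_pt (diag_scale ?c x) (disc_aut \<eta> w)) \<partial>lborel)"
        using True by (simp add: mult.assoc[symmetric] ennreal_mult[symmetric])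
      also have "\<dots> = (\<integral>\<^sup>+x. ennreal (aut_jac J \<alpha> \<eta> w) * F (ext_pt (diag_scale ?c x) (disc_aut \<eta> w)) \<partial>lborel)"
        by (rule nn_integral_cmult[symmetric]) simp
      also have "\<dots> = (\<integral>\<^sup>+x. (\<lambda>p. indicator W p * (ennreal (aut_jac J \<alpha> \<eta> (p $ None)) * F (indicator W p *\<^sub>R aut J \<alpha> \<eta> p))) (ext_pt x w) \<partial>lborel)"
        unfolding Fx by (intro nn_integral_cong) (simp add: mult_ac)
      finally show ?thesis .
    qed
  qed
  also have "\<dots> = (\<integral>\<^sup>+p. indicator W p * (ennreal (aut_jac J \<alpha> \<eta> (p $ None)) * F (indicator W p *\<^sub>R aut J \<alpha> \<eta> p)) \<partial>lborel)"
    by (rule nn_integral_ext_pt[OF Rm, symmetric])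
  finally show ?thesis .
qed

text \<open>As an equality of measures the change of variables passes to Bochner integrals through
  rules that ask only for measurability.\<close>

lemma density_eq_distr_aut:
  fixes \<Omega> :: "(complex^'n::finite) set" and \<alpha> :: "'n \<Rightarrow> real"
  assumes \<Omega>: "open \<Omega>" and star: "star_hartogs J \<Omega>" and \<eta>: "cmod \<eta> < 1"
  defines "W \<equiv> U_alpha J \<alpha> (U_alpha_eta J \<alpha> \<Omega> \<eta>)"
  shows "(\<lambda>p. indicator W p *\<^sub>R aut J \<alpha> \<eta> p) \<in> borel_measurable borel"
    and "(\<lambda>p. indicator W p * aut_jac J \<alpha> \<eta> (p $ None)) \<in> borel_measurable borel"
    and "density lborel (\<lambda>p. ennreal (indicator (U_alpha J \<alpha> \<Omega>) p)) =
      distr (density lborel (\<lambda>p. ennreal (indicator W p * aut_jac J \<alpha> \<eta> (p $ None)))) borel (\<lambda>p. indicator W p *\<^sub>R aut J \<alpha> \<eta> p)"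
proof -
  have U: "open (U_alpha J \<alpha> \<Omega>)" by (rule open_U_alpha[OF \<Omega>])
  have W: "open W" unfolding W_def by (intro open_U_alpha open_U_alpha_eta \<Omega>)
  have Wlt: "cmod (p $ None) < 1" if "p \<in> W" for p using that by (simp add: W_def mem_U_alpha)
  have sets [measurable]: "W \<in> sets borel" "U_alpha J \<alpha> \<Omega> \<in> sets borel" using W U by auto
  show am [measurable]: "(\<lambda>p. indicator W p *\<^sub>R aut J \<alpha> \<eta> p) \<in> borel_measurable borel"
    by (rule borel_measurable_continuous_on_indicator[OF _ continuous_on_aut[OF \<eta> Wlt]]) auto
  have nm [measurable]: "(\<lambda>p::complex^('n option). p $ None) \<in> borel_measurable borel"
    by (intro borel_measurable_continuous_onI continuous_intros)
  show jm [measurable]: "(\<lambda>p. indicator W p * aut_jac J \<alpha> \<eta> (p $ None)) \<in> borel_measurable borel"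
    unfolding aut_jac_def by measurable
  show "density lborel (\<lambda>p. ennreal (indicator (U_alpha J \<alpha> \<Omega>) p)) =
      distr (density lborel (\<lambda>p. ennreal (indicator W p * aut_jac J \<alpha> \<eta> (p $ None)))) borel (\<lambda>p. indicator W p *\<^sub>R aut J \<alpha> \<eta> p)"
    (is "?M = ?N")
  proof (rule measure_eqI)
    fix S assume "S \<in> sets ?M"
    then have S [measurable]: "S \<in> sets borel" by simp
    let ?F = "\<lambda>p. ennreal (indicator (U_alpha J \<alpha> \<Omega>) p) * indicator S p"
    have "emeasure ?M S = (\<integral>\<^sup>+p. ?F p \<partial>lborel)" by (subst emeasure_density) auto
    also have "\<dots> = (\<integral>\<^sup>+p. indicator W p * (ennreal (aut_jac J \<alpha> \<eta> (p $ None)) * ?F (indicator W p *\<^sub>R aut J \<alpha> \<eta> p)) \<partial>lborel)"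
      unfolding W_def by (rule nn_integral_aut[OF \<Omega> star \<eta>]) auto
    also have "\<dots> = (\<integral>\<^sup>+p. ennreal (indicator W p * aut_jac J \<alpha> \<eta> (p $ None)) * indicator ((\<lambda>p. indicator W p *\<^sub>R aut J \<alpha> \<eta> p) -` S) p \<partial>lborel)"
    proof (rule nn_integral_cong)
      fix p
      show "indicator W p * (ennreal (aut_jac J \<alpha> \<eta> (p $ None)) * ?F (indicator W p *\<^sub>R aut J \<alpha> \<eta> p)) =
        ennreal (indicator W p * aut_jac J \<alpha> \<eta> (p $ None)) * indicator ((\<lambda>p. indicator W p *\<^sub>R aut J \<alpha> \<eta> p) -` S) p"
        using aut_mem_iff[OF star \<eta> Wlt, of p] by (cases "p \<in> W") (auto simp: W_def indicator_def)
    qed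
    also have "\<dots> = emeasure ?N S"
      using measurable_sets_borel[OF am S] by (subst emeasure_distr, simp, simp, subst emeasure_density) auto
    finally show "emeasure ?M S = emeasure ?N S" .
  qed auto
qed

lemma aut_jac_nonneg: "aut_jac J \<alpha> \<eta> w \<ge> 0"
  by (simp add: aut_jac_def)

lemma nn_integral_sq_aut:
  fixes \<Omega> :: "(complex^'n::finite) set" and f :: "complex^('n option) \<Rightarrow> complex"
  assumes \<Omega>: "open \<Omega>" and star: "star_hartogs J \<Omega>" and \<eta>: "cmod \<eta> < 1" and f: "continuous_on (U_alpha J \<alpha> \<Omega>) f"
  defines "W \<equiv> U_alpha J \<alpha> (U_alpha_eta J \<alpha> \<Omega> \<eta>)"
  shows "(\<integral>\<^sup>+p. ennreal (indicator (U_alpha J \<alpha> \<Omega>) p * (cmod (f p))\<^sup>2) \<partial>lborel) =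
    (\<integral>\<^sup>+p. ennreal (indicator W p * (aut_jac J \<alpha> \<eta> (p $ None) * (cmod (f (aut J \<alpha> \<eta> p)))\<^sup>2)) \<partial>lborel)"
proof -
  let ?F = "\<lambda>p. ennreal (indicator (U_alpha J \<alpha> \<Omega>) p * (cmod (f p))\<^sup>2)"
  have Wlt: "cmod (p $ None) < 1" if "p \<in> W" for p using that by (simp add: W_def mem_U_alpha)
  have F: "?F \<in> borel_measurable borel"
    using borel_measurable_indicator_sq[OF open_U_alpha[OF \<Omega>] f] by simp
  have "(\<integral>\<^sup>+p. ?F p \<partial>lborel) = (\<integral>\<^sup>+p. indicator W p * (ennreal (aut_jac J \<alpha> \<eta> (p $ None)) * ?F (indicator W p *\<^sub>R aut J \<alpha> \<eta> p)) \<partial>lborel)"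
    unfolding W_def by (rule nn_integral_aut[OF \<Omega> star \<eta> F]) auto
  also have "\<dots> = (\<integral>\<^sup>+p. ennreal (indicator W p * (aut_jac J \<alpha> \<eta> (p $ None) * (cmod (f (aut J \<alpha> \<eta> p)))\<^sup>2)) \<partial>lborel)"
  proof (rule nn_integral_cong)
    fix p
    show "indicator W p * (ennreal (aut_jac J \<alpha> \<eta> (p $ None)) * ?F (indicator W p *\<^sub>R aut J \<alpha> \<eta> p)) =
      ennreal (indicator W p * (aut_jac J \<alpha> \<eta> (p $ None) * (cmod (f (aut J \<alpha> \<eta> p)))\<^sup>2))"
      using aut_mem_iff[OF star \<eta> Wlt, of p] by (cases "p \<in> W") (auto simp: W_def ennreal_mult aut_jac_nonneg)
  qed
  finally show ?thesis .
qed

lemma integral_aut: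
  fixes \<Omega> :: "(complex^'n::finite) set" and f :: "complex^('n option) \<Rightarrow> complex"
  assumes \<Omega>: "open \<Omega>" and star: "star_hartogs J \<Omega>" and \<eta>: "cmod \<eta> < 1" and f: "continuous_on (U_alpha J \<alpha> \<Omega>) f"
  defines "W \<equiv> U_alpha J \<alpha> (U_alpha_eta J \<alpha> \<Omega> \<eta>)"
  shows "(LINT p:U_alpha J \<alpha> \<Omega>|lborel. f p) = (LINT p:W|lborel. of_real (aut_jac J \<alpha> \<eta> (p $ None)) * f (aut J \<alpha> \<eta> p))"
proof -
  define U where "U = U_alpha J \<alpha> \<Omega>"
  have Wlt: "cmod (p $ None) < 1" if "p \<in> W" for p using that by (simp add: W_def mem_U_alpha)
  have oU: "open U" unfolding U_def by (rule open_U_alpha[OF \<Omega>])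
  let ?h = "\<lambda>p. indicat_real U p *\<^sub>R f p" and ?a = "\<lambda>p. indicat_real W p *\<^sub>R aut J \<alpha> \<eta> p"
  let ?j = "\<lambda>p. indicat_real W p * aut_jac J \<alpha> \<eta> (p $ None)"
  note D = density_eq_distr_aut[OF \<Omega> star \<eta>, of \<alpha>, folded W_def U_def]
  have h [measurable]: "?h \<in> borel_measurable borel"
    using borel_measurable_indicator_continuous[OF oU] f by (simp add: U_def)
  have [measurable]: "U \<in> sets borel" using oU by simp
  have "(LINT p:U|lborel. f p) = (LINT p|lborel. indicat_real U p *\<^sub>R ?h p)"
    unfolding set_lebesgue_integral_def by (intro Bochner_Integration.integral_cong) (auto simp: indicator_def)
  also have "\<dots> = (LINT p|density lborel (\<lambda>p. ennreal (indicat_real U p)). ?h p)"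
    by (rule integral_density[symmetric]) auto
  also have "\<dots> = (LINT p|density lborel (\<lambda>p. ennreal (?j p)). ?h (?a p))"
    unfolding D(3) by (rule integral_distr) (use D(1) in auto)
  also have "\<dots> = (LINT p|lborel. ?j p *\<^sub>R ?h (?a p))"
  proof (rule integral_density)
    show "(\<lambda>p. ?h (?a p)) \<in> borel_measurable lborel" using measurable_compose[OF D(1) h] by simp
  qed (use D(2) in \<open>auto intro!: AE_I2 mult_nonneg_nonneg aut_jac_nonneg\<close>)
  also have "\<dots> = (LINT p:W|lborel. of_real (aut_jac J \<alpha> \<eta> (p $ None)) * f (aut J \<alpha> \<eta> p))"
    unfolding set_lebesgue_integral_def
  proof (rule Bochner_Integration.integral_cong[OF refl])
    fix p
    show "?j p *\<^sub>R ?h (?a p) = indicat_real W p *\<^sub>R (of_real (aut_jac J \<alpha> \<eta> (p $ None)) * f (aut J \<alpha> \<eta> p))"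
      using aut_mem_iff[OF star \<eta> Wlt, of p] by (cases "p \<in> W") (auto simp: W_def U_def scaleR_conv_of_real)
  qed
  finally show ?thesis by (simp add: U_def)
qed

text \<open>At the image point \<open>disc_aut \<eta> w\<close> the quotient inside
  \<open>h_map\<close> is the base \<open>1 + cnj \<eta> * w\<close> of the fibre multiplier at
  \<open>w\<close>. Hence \<open>h_map\<close> is the base component of the inverse of
  \<open>aut\<close>.\<close>

lemma aut_inverse_factor:
  assumes "cmod \<eta> < 1" "cmod w < 1"
  shows "of_real (1 - (cmod \<eta>)\<^sup>2) / (1 - disc_aut \<eta> w * cnj \<eta>) = 1 + cnj \<eta> * w"
    and "1 - disc_aut \<eta> w * cnj \<eta> = of_real (1 - (cmod \<eta>)\<^sup>2) / (1 + cnj \<eta> * w)"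
proof -
  have q0: "1 + cnj \<eta> * w \<noteq> 0"
    by (rule one_plus_cnj_mult_nonzero[OF assms])
  have a0: "complex_of_real (1 - (cmod \<eta>)\<^sup>2) \<noteq> 0" using one_minus_norm_sq_pos[OF assms(1)] unfolding of_real_eq_0_iff by simp
  have "(1 - disc_aut \<eta> w * cnj \<eta>) * (1 + cnj \<eta> * w) = of_real (1 - (cmod \<eta>)\<^sup>2)"
    unfolding of_real_diff complex_norm_square disc_aut_def using q0 by (simp add: field_simps)
  then show "1 - disc_aut \<eta> w * cnj \<eta> = of_real (1 - (cmod \<eta>)\<^sup>2) / (1 + cnj \<eta> * w)"
    using q0 by (simp add: eq_divide_eq)
  then show "of_real (1 - (cmod \<eta>)\<^sup>2) / (1 - disc_aut \<eta> w * cnj \<eta>) = 1 + cnj \<eta> * w"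
    using a0 by simp
qed

lemma h_map_aut:
  assumes "cmod \<eta> < 1" "cmod (p $ None) < 1"
  shows "h_map J \<alpha> (base (aut J \<alpha> \<eta> p)) (aut J \<alpha> \<eta> p $ None) \<eta> = base p"
proof -
  have q0: "1 + cnj \<eta> * p $ None \<noteq> 0"
    by (rule one_plus_cnj_mult_nonzero[OF assms])
  have "(1 + cnj \<eta> * p $ None) powr (- of_real (\<alpha> i)) * (1 + cnj \<eta> * p $ None) powr of_real (\<alpha> i) = 1" for i
    using q0 by (simp add: powr_minus)
  moreover have "(cmod \<eta>)\<^sup>2 \<noteq> 1" using one_minus_norm_sq_pos[OF assms(1)] by simp
  ultimately show ?thesis
    by (simp add: vec_eq_iff h_map_def aut_def aut_inverse_factor[OF assms] aut_factor_def del: of_real_diff of_real_power)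
qed

lemma aut_h_map:
  assumes \<eta>: "cmod \<eta> < 1" and w: "cmod w < 1"
  shows "aut J \<alpha> \<eta> (ext_pt (h_map J \<alpha> x w \<eta>) (disc_aut (- \<eta>) w)) = ext_pt x w"
proof -
  define v where "v = disc_aut (- \<eta>) w"
  have v: "cmod v < 1" unfolding v_def by (rule norm_disc_aut_less_1) (use \<eta> w in auto)
  have wv: "disc_aut \<eta> v = w" unfolding v_def using disc_aut_inverse[of "- \<eta>" w] \<eta> w by simp
  have q0: "1 + cnj \<eta> * v \<noteq> 0"
    by (rule one_plus_cnj_mult_nonzero[OF \<eta> v])
  have "h_map J \<alpha> x w \<eta> $ i = (if i \<in> J then x $ i * (1 + cnj \<eta> * v) powr of_real (\<alpha> i) else x $ i)" for i
    unfolding h_map_def using aut_inverse_factor(1)[OF \<eta> v] by (simp add: wv)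
  then have "diag_scale (aut_factor J \<alpha> \<eta> v) (h_map J \<alpha> x w \<eta>) = x"
    using q0 by (auto simp: vec_eq_iff aut_factor_def powr_minus)
  then show ?thesis by (simp add: aut_def v_def[symmetric] wv)
qed

section \<open>Transport of the kernel from the centre of the disc\<close>

definition bergman_factor :: "'n set \<Rightarrow> ('n \<Rightarrow> real) \<Rightarrow> complex \<Rightarrow> complex \<Rightarrow> complex" where
  "bergman_factor J \<alpha> \<eta> w = of_real ((1 - (cmod \<eta>)\<^sup>2) powr (\<Sum>j\<in>J. \<alpha> j))
     / (of_real pi * (1 - w * cnj \<eta>) powr of_real (2 + (\<Sum>j\<in>J. \<alpha> j)))"

text \<open>With \<open>a = 1 - |\<eta>|^2\<close> and \<open>J = a q^(-(2 + A))\<close> for the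
  Jacobian of \<open>aut\<close>, this says that \<open>bergman_factor\<close> at the image point is
  \<open>1 / (pi a J)\<close>, as the transformation law demands.\<close>

lemma bergman_factor_aut:
  assumes \<eta>: "cmod \<eta> < 1" and w: "cmod w < 1"
  shows "bergman_factor J \<alpha> \<eta> (disc_aut \<eta> w) * (1 + cnj \<eta> * w) powr (- of_real (2 + (\<Sum>j\<in>J. \<alpha> j)))
    = of_real (1 / (pi * (1 - (cmod \<eta>)\<^sup>2)\<^sup>2))"
proof -
  define A where "A = (\<Sum>j\<in>J. \<alpha> j)"
  define a where "a = 1 - (cmod \<eta>)\<^sup>2"
  define q where "q = 1 + cnj \<eta> * w"
  have a: "a > 0" unfolding a_def by (rule one_minus_norm_sq_pos[OF \<eta>])
  have q: "Re q > 0" unfolding q_def by (rule one_plus_cnj_mult_pos_Re[OF \<eta> w])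
  then have q0: "q \<noteq> 0" by auto
  have p: "(1 - disc_aut \<eta> w * cnj \<eta>) powr of_real (2 + A) = of_real (a powr (2 + A)) * q powr (- of_real (2 + A))"
    unfolding aut_inverse_factor(2)[OF \<eta> w] a_def[symmetric] q_def[symmetric] by (rule divide_powr_real[OF a q])
  have m0: "q powr (- of_real (2 + A)) \<noteq> 0" using q0 by simp
  have "bergman_factor J \<alpha> \<eta> (disc_aut \<eta> w) * q powr (- of_real (2 + A)) = of_real (a powr A) / (of_real pi * of_real (a powr (2 + A)))"
    unfolding bergman_factor_def A_def[symmetric] a_def[symmetric] p using m0 by (simp add: field_simps)
  also have "a powr (2 + A) = a\<^sup>2 * a powr A" using a by (simp add: powr_add)
  also have "complex_of_real (a powr A) / (of_real pi * of_real (a\<^sup>2 * a powr A)) = of_real (1 / (pi * a\<^sup>2))"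
    using a by simp
  finally show ?thesis by (simp add: a_def q_def A_def)
qed

lemma holo_on_h_map:
  assumes oE: "open E" and \<eta>: "cmod \<eta> < 1" and E: "\<And>p. p \<in> E \<Longrightarrow> cmod (p $ None) < 1"
  shows "holo_on (\<lambda>p. h_map J \<alpha> (base p) (p $ None) \<eta> $ i) E"
proof (cases "i \<in> J")
  case True
  let ?a = "1 - (cmod \<eta>)\<^sup>2"
  \<comment> \<open>Taking the positive constant out of the power leaves a power of
    \<open>1 + cnj (- \<eta>) * w\<close>, whose holomorphy is known.\<close>
  have eq: "(of_real ?a / (1 - w * cnj \<eta>)) powr of_real (\<alpha> i) = of_real (?a powr \<alpha> i) * (1 + cnj (- \<eta>) * w) powr (- of_real (\<alpha> i))" if "cmod w < 1" for w
  proof -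
    have "Re (1 + cnj (- \<eta>) * w) > 0" by (rule one_plus_cnj_mult_pos_Re) (use \<eta> that in auto)
    from divide_powr_real[OF one_minus_norm_sq_pos[OF \<eta>] this, of "\<alpha> i"] show ?thesis by (simp add: mult.commute)
  qed
  show ?thesis
  proof -
    have "holo_on (\<lambda>p. p $ Some i * (of_real (?a powr \<alpha> i) * (1 + cnj (- \<eta>) * p $ None) powr (- of_real (\<alpha> i)))) E"
      by (intro holo_on_mult holo_on_nth holo_on_const holo_on_one_plus_powr E) (use \<eta> in auto)
    moreover have "h_map J \<alpha> (base p) (p $ None) \<eta> $ i = p $ Some i * (of_real (?a powr \<alpha> i) * (1 + cnj (- \<eta>) * p $ None) powr (- of_real (\<alpha> i)))"
      if "cmod (p $ None) < 1" for p
      using True unfolding h_map_def vec_lambda_beta eq[OF that] by simp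
    ultimately show ?thesis
      by (elim holo_on_cong[OF oE, rotated]) (use E in auto)
  qed
next
  case False
  then show ?thesis by (simp add: h_map_def holo_on_nth)
qed

lemma holo_on_bergman_factor:
  fixes J :: "'n::finite set"
  assumes \<eta>: "cmod \<eta> < 1" and E: "\<And>p. p \<in> E \<Longrightarrow> cmod (p $ None) < 1"
  shows "holo_on (\<lambda>p::complex^('n option). bergman_factor J \<alpha> \<eta> (p $ None)) E"
proof -
  have "bergman_factor J \<alpha> \<eta> w = of_real ((1 - (cmod \<eta>)\<^sup>2) powr (\<Sum>j\<in>J. \<alpha> j) / pi)
      * (1 + cnj (- \<eta>) * w) powr (- of_real (2 + (\<Sum>j\<in>J. \<alpha> j)))" for w
    unfolding bergman_factor_def powr_minus[of _ "of_real _"] by (simp add: mult.commute divide_inverse)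
  then show ?thesis
    by (simp only:) (intro holo_on_mult holo_on_const holo_on_one_plus_powr E; simp add: \<eta>)
qed

text \<open>\<open>h_map\<close> gives the base of the preimage under \<open>aut\<close>, and base
  points of \<open>U_alpha\<close> over a star-shaped set lie in that set.\<close>

lemma h_map_mem:
  assumes star: "star_hartogs J \<Omega>" and \<alpha>: "\<And>j. j \<in> J \<Longrightarrow> \<alpha> j > 0" and \<eta>: "cmod \<eta> < 1"
    and p: "ext_pt x w \<in> U_alpha J \<alpha> \<Omega>"
  shows "h_map J \<alpha> x w \<eta> \<in> U_alpha_eta J \<alpha> \<Omega> \<eta>"
proof -
  have w: "cmod w < 1" using p by (simp add: ext_pt_mem_U_alpha)
  let ?q = "ext_pt (h_map J \<alpha> x w \<eta>) (disc_aut (- \<eta>) w)"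
  have "cmod (?q $ None) < 1" using norm_disc_aut_less_1[of "- \<eta>" w] \<eta> w by simp
  from aut_mem_iff[OF star \<eta> this, of \<alpha>] have "?q \<in> U_alpha J \<alpha> (U_alpha_eta J \<alpha> \<Omega> \<eta>)"
    using aut_h_map[OF \<eta> w, of J \<alpha> x] p by simp
  from U_alpha_base_mem[OF star_hartogs_U_alpha_eta[OF star] \<alpha> this] show ?thesis by simp
qed

lemma bergman_kernel_U_alpha:
  fixes \<Omega> :: "(complex^'n::finite) set"
  assumes \<Omega>: "open \<Omega>" and star: "star_hartogs J \<Omega>" and \<alpha>: "\<And>j. j \<in> J \<Longrightarrow> \<alpha> j > 0"
    and p: "ext_pt x w \<in> U_alpha J \<alpha> \<Omega>" and z: "ext_pt \<zeta> \<eta> \<in> U_alpha J \<alpha> \<Omega>"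
  shows "bergman_kernel (U_alpha J \<alpha> \<Omega>) (ext_pt x w) (ext_pt \<zeta> \<eta>) =
    bergman_factor J \<alpha> \<eta> w * Dop J \<alpha> (\<lambda>y. bergman_kernel (U_alpha_eta J \<alpha> \<Omega> \<eta>) y \<zeta>) (h_map J \<alpha> x w \<eta>)"
proof -
  define V where "V = U_alpha_eta J \<alpha> \<Omega> \<eta>"
  define U where "U = U_alpha J \<alpha> \<Omega>"
  define W where "W = U_alpha J \<alpha> V"
  define A where "A = (\<Sum>j\<in>J. \<alpha> j)"
  define a where "a = 1 - (cmod \<eta>)\<^sup>2"
  have \<eta>: "cmod \<eta> < 1" using z by (simp add: ext_pt_mem_U_alpha)
  have a: "a > 0" unfolding a_def by (rule one_minus_norm_sq_pos[OF \<eta>])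
  have V: "open V" unfolding V_def by (rule open_U_alpha_eta[OF \<Omega>])
  have U: "open U" unfolding U_def by (rule open_U_alpha[OF \<Omega>])
  have W: "open W" unfolding W_def by (rule open_U_alpha[OF V])
  have starV: "star_hartogs J V" unfolding V_def by (rule star_hartogs_U_alpha_eta[OF star])
  have \<zeta>: "\<zeta> \<in> V" using z by (simp add: V_def U_alpha_eta_def)
  have Ult: "cmod (p $ None) < 1" if "p \<in> U" for p using that by (simp add: U_def mem_U_alpha)
  have Wlt: "cmod (p $ None) < 1" if "p \<in> W" for p using that by (simp add: W_def mem_U_alpha)
  have autU: "aut J \<alpha> \<eta> p \<in> U" if "p \<in> W" for p
    using aut_mem_iff[OF star \<eta> Wlt[OF that], of \<alpha>] that by (simp add: U_def W_def V_def)
  obtain \<kappa> where \<kappa>: "\<kappa> \<in> A2 V" "\<And>f. f \<in> A2 V \<Longrightarrow> ip V f \<kappa> = Dop J \<alpha> f \<zeta>"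
    "\<And>z. z \<in> V \<Longrightarrow> \<kappa> z = Dop J \<alpha> (\<lambda>x. bergman_kernel V x \<zeta>) z"
    by (rule bergman_kernel_Dop[OF V starV \<alpha> \<zeta>]) blast+
  \<comment> \<open>The complex Jacobian of \<open>aut\<close> without its constant factor
    \<open>a\<close>.\<close>
  define m where "m = (\<lambda>p::complex^('n option). (1 + cnj \<eta> * p $ None) powr (- of_real (2 + A)))"
  define b where "b = (\<lambda>p::complex^('n option). bergman_factor J \<alpha> \<eta> (p $ None))"
  define G where "G = (\<lambda>p. b p * \<kappa> (h_map J \<alpha> (base p) (p $ None) \<eta>))"
  have hV: "h_map J \<alpha> (base p) (p $ None) \<eta> \<in> V" if "p \<in> U" for p
    unfolding V_def by (rule h_map_mem[OF star \<alpha> \<eta>]) (use that in \<open>auto simp: U_def\<close>)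
  have Gholo: "holo_on G U"
    unfolding G_def b_def
    by (intro holo_on_mult holo_on_bergman_factor[OF \<eta> Ult] holo_on_compose[OF A2_holo[OF \<kappa>(1)]] holo_on_h_map[OF U \<eta> Ult] hV)
  have Gaut: "G (aut J \<alpha> \<eta> p) = b (aut J \<alpha> \<eta> p) * \<kappa> (base p)" if "p \<in> W" for p
    unfolding G_def using h_map_aut[OF \<eta> Wlt[OF that]] by simp
  have bm: "b (aut J \<alpha> \<eta> p) * m p = of_real (1 / (pi * a\<^sup>2))" if "p \<in> W" for p
    using bergman_factor_aut[OF \<eta> Wlt[OF that], of J \<alpha>] by (simp add: b_def m_def aut_def a_def A_def)
  have jac: "aut_jac J \<alpha> \<eta> (p $ None) = (a * cmod (m p))\<^sup>2" for p
  proof -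
    have "cmod (q powr complex_of_real r) = cmod q powr r" for q r by (simp add: norm_powr_real_powr')
    then show ?thesis unfolding aut_jac_def m_def A_def a_def of_real_minus[symmetric] by (simp only:)
  qed
  have \<kappa>b: "(\<lambda>p. \<kappa> (base p)) \<in> A2 W" unfolding W_def by (rule A2_base[OF V starV \<alpha> \<kappa>(1)])
  have GA: "G \<in> A2 U"
  proof (rule A2I_nn_integral[OF U Gholo])
    \<comment> \<open>By \<open>bm\<close>, the Jacobian \<open>a * m\<close> turns the pullback of
      \<open>G\<close> into a constant multiple of \<kappa>:
      \<open>a * (b * m) = 1 / (pi * a)\<close>.\<close>
    let ?c = "complex_of_real (1 / (pi * a))"
    have "(\<integral>\<^sup>+p. ennreal (indicator U p * (cmod (G p))\<^sup>2) \<partial>lborel) =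
        (\<integral>\<^sup>+p. ennreal (indicator W p * (aut_jac J \<alpha> \<eta> (p $ None) * (cmod (G (aut J \<alpha> \<eta> p)))\<^sup>2)) \<partial>lborel)"
      unfolding U_def W_def V_def
      by (rule nn_integral_sq_aut[OF \<Omega> star \<eta>]) (use holo_on_continuous_on[OF Gholo] in \<open>simp add: U_def\<close>)
    also have "\<dots> = (\<integral>\<^sup>+p. ennreal (indicator W p * (cmod (?c * \<kappa> (base p)))\<^sup>2) \<partial>lborel)"
    proof (intro nn_integral_cong)
      fix p
      have "aut_jac J \<alpha> \<eta> (p $ None) * (cmod (G (aut J \<alpha> \<eta> p)))\<^sup>2 = (cmod (?c * \<kappa> (base p)))\<^sup>2" if p: "p \<in> W"
      proof -
        have "aut_jac J \<alpha> \<eta> (p $ None) * (cmod (G (aut J \<alpha> \<eta> p)))\<^sup>2 = (cmod (of_real a * (b (aut J \<alpha> \<eta> p) * m p) * \<kappa> (base p)))\<^sup>2"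
          unfolding jac Gaut[OF p] using a by (simp add: norm_mult power_mult_distrib)
        also have "of_real a * (b (aut J \<alpha> \<eta> p) * m p) = ?c"
          unfolding bm[OF p] using a by (simp add: power2_eq_square)
        finally show ?thesis .
      qed
      then show "ennreal (indicator W p * (aut_jac J \<alpha> \<eta> (p $ None) * (cmod (G (aut J \<alpha> \<eta> p)))\<^sup>2)) = ennreal (indicator W p * (cmod (?c * \<kappa> (base p)))\<^sup>2)"
        by (cases "p \<in> W") auto
    qed
    also have "\<dots> < \<infinity>"
      unfolding nn_integral_sq_eq_nrm2[OF W A2_cmult[OF W \<kappa>b]] by simp
    finally show "(\<integral>\<^sup>+p. ennreal (indicator U p * (cmod (G p))\<^sup>2) \<partial>lborel) < \<infinity>" .
  qed
  have rep: "ip U f G = f (ext_pt \<zeta> \<eta>)" if f: "f \<in> A2 U" for f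
  proof -
    \<comment> \<open>Up to the constant \<open>a\<close>, the isometric pullback of
      \<open>f\<close> from \<open>A2 U\<close> to \<open>A2 W\<close>.\<close>
    define g where "g = (\<lambda>p. f (aut J \<alpha> \<eta> p) * m p)"
    have gholo: "holo_on g W"
      unfolding g_def m_def
      by (intro holo_on_mult holo_on_one_plus_powr[OF \<eta> Wlt] holo_on_compose[OF A2_holo[OF f]] holo_on_aut[OF \<eta> Wlt] autU)
    have agA: "(\<lambda>p. of_real a * g p) \<in> A2 W"
    proof (rule A2I_nn_integral[OF W holo_on_mult[OF holo_on_const gholo]])
      have "(\<integral>\<^sup>+p. ennreal (indicator W p * (cmod (of_real a * g p))\<^sup>2) \<partial>lborel)
         = (\<integral>\<^sup>+p. ennreal (indicator W p * (aut_jac J \<alpha> \<eta> (p $ None) * (cmod (f (aut J \<alpha> \<eta> p)))\<^sup>2)) \<partial>lborel)"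
        unfolding jac g_def using a by (intro nn_integral_cong) (simp add: norm_mult power_mult_distrib mult_ac)
      also have "\<dots> = (\<integral>\<^sup>+p. ennreal (indicator U p * (cmod (f p))\<^sup>2) \<partial>lborel)"
        unfolding U_def W_def V_def
        by (rule nn_integral_sq_aut[OF \<Omega> star \<eta>, symmetric]) (use A2_continuous_on[OF f] in \<open>simp add: U_def\<close>)
      also have "\<dots> < \<infinity>" unfolding nn_integral_sq_eq_nrm2[OF U f] by simp
      finally show "(\<integral>\<^sup>+p. ennreal (indicator W p * (cmod (of_real a * g p))\<^sup>2) \<partial>lborel) < \<infinity>" .
    qed
    have gA: "g \<in> A2 W"
      by (rule A2_cong[OF W _ A2_cmult[OF W agA, of "1 / of_real a"]]) (use a in auto)
    have "ip U f G = (LINT p:W|lborel. of_real (aut_jac J \<alpha> \<eta> (p $ None)) * (f (aut J \<alpha> \<eta> p) * cnj (G (aut J \<alpha> \<eta> p))))"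
      unfolding ip_def U_def W_def V_def
      by (rule integral_aut[OF \<Omega> star \<eta>])
         (use A2_continuous_on[OF f] A2_continuous_on[OF GA] in \<open>auto simp: U_def intro!: continuous_intros\<close>)
    also have "\<dots> = (LINT p:W|lborel. (1 / of_real pi) * (g p * cnj (\<kappa> (base p))))"
      unfolding set_lebesgue_integral_def
    proof (rule Bochner_Integration.integral_cong[OF refl])
      fix p
      have "of_real (aut_jac J \<alpha> \<eta> (p $ None)) * (f (aut J \<alpha> \<eta> p) * cnj (G (aut J \<alpha> \<eta> p))) = (1 / of_real pi) * (g p * cnj (\<kappa> (base p)))" if p: "p \<in> W"
      proof -
        \<comment> \<open>Of the two factors in \<open>|m|^2 = m * cnj m\<close>, one completes
          \<open>g\<close> and the other cancels the power of \<open>q\<close> in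
          \<open>cnj b\<close>.\<close>
        have "complex_of_real ((a * cmod (m p))\<^sup>2) = (of_real a)\<^sup>2 * (m p * cnj (m p))"
          unfolding power_mult_distrib of_real_mult complex_norm_square by simp
        then have "of_real (aut_jac J \<alpha> \<eta> (p $ None)) * (f (aut J \<alpha> \<eta> p) * cnj (G (aut J \<alpha> \<eta> p)))
          = (of_real a)\<^sup>2 * cnj (b (aut J \<alpha> \<eta> p) * m p) * (g p * cnj (\<kappa> (base p)))"
          unfolding jac Gaut[OF p] g_def by (simp add: mult_ac)
        also have "(of_real a)\<^sup>2 * cnj (b (aut J \<alpha> \<eta> p) * m p) = 1 / of_real pi"
          unfolding bm[OF p] using a by simp
        finally show ?thesis .
      qed
      then show "indicat_real W p *\<^sub>R (of_real (aut_jac J \<alpha> \<eta> (p $ None)) * (f (aut J \<alpha> \<eta> p) * cnj (G (aut J \<alpha> \<eta> p))))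
        = indicat_real W p *\<^sub>R ((1 / of_real pi) * (g p * cnj (\<kappa> (base p))))"
        by (cases "p \<in> W") auto
    qed
    also have "\<dots> = (1 / of_real pi) * ip W g (\<lambda>p. \<kappa> (base p))"
      unfolding ip_def by (rule set_integral_mult_right)
    also have "ip W g (\<lambda>p. \<kappa> (base p)) = of_real pi * g (ext_pt \<zeta> 0)"
      unfolding W_def by (rule U_alpha_center_reproducing[OF V starV \<alpha> \<zeta> \<kappa>(1,2)]) (use gA in \<open>auto simp: W_def\<close>)
    \<comment> \<open>The centre goes to the given point: all multipliers and \<open>m\<close> are 1
      at \<open>w = 0\<close>.\<close>
    also have "g (ext_pt \<zeta> 0) = f (ext_pt \<zeta> \<eta>)"
    proof -
      have "diag_scale (aut_factor J \<alpha> \<eta> 0) \<zeta> = \<zeta>" by (simp add: vec_eq_iff aut_factor_def)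
      then show ?thesis by (simp add: g_def m_def aut_def disc_aut_def)
    qed
    finally show ?thesis by simp
  qed
  have "bergman_kernel U (ext_pt x w) (ext_pt \<zeta> \<eta>) = G (ext_pt x w)"
    by (rule bergman_kernel_eqI[OF U _ GA rep]) (use p z in \<open>auto simp: U_def\<close>)
  also have "\<dots> = bergman_factor J \<alpha> \<eta> w * \<kappa> (h_map J \<alpha> x w \<eta>)" by (simp add: G_def b_def)
  also have "\<kappa> (h_map J \<alpha> x w \<eta>) = Dop J \<alpha> (\<lambda>y. bergman_kernel V y \<zeta>) (h_map J \<alpha> x w \<eta>)"
    by (rule \<kappa>(3)) (use hV[of "ext_pt x w"] p in \<open>simp add: U_def\<close>)
  finally show ?thesis by (simp add: U_def V_def)
qed

text \<open>For fixed \<open>w\<close> the map \<open>h_map\<close> is diagonal in the base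
  variables, and \<open>z_j\<close> times the \<open>j\<close>-th partial derivative is invariant
  under scaling of \<open>z_j\<close>. So applying the operator after composing with
  \<open>h_map\<close> equals evaluating \<open>Dop\<close> at the point
  \<open>h_map\<close>.\<close>

lemma Dop_h_map:
  fixes k :: "complex^'n::finite \<Rightarrow> complex"
  assumes k: "holo_on k V" and mem: "h_map J \<alpha> x w \<eta> \<in> V"
  defines "F \<equiv> (\<lambda>y. k (h_map J \<alpha> y w \<eta>))"
  shows "Dop J \<alpha> k (h_map J \<alpha> x w \<eta>) = F x + (\<Sum>j\<in>J. of_real (\<alpha> j) * (F x + x $ j * cpartial j F x))"
proof -
  let ?h = "h_map J \<alpha> x w \<eta>"
  define c where "c = (\<lambda>i. (complex_of_real (1 - (cmod \<eta>)\<^sup>2) / (1 - w * cnj \<eta>)) powr of_real (\<alpha> i))"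
  have lin: "linear (cderiv k ?h)" by (rule linear_cderiv[OF k mem])
  have part: "x $ j * cpartial j F x = cderiv k ?h (axis j (?h $ j))" if j: "j \<in> J" for j
  proof -
    let ?\<gamma> = "\<lambda>t. h_map J \<alpha> (\<chi> i. if i = j then t else x $ i) w \<eta>"
    have \<gamma>x: "?\<gamma> (x $ j) = ?h"
      by (simp add: vec_eq_iff h_map_def)
    have "((\<lambda>t. k (?\<gamma> t)) has_field_derivative cderiv k (?\<gamma> (x $ j)) (axis j (c j))) (at (x $ j))"
    proof (rule has_field_derivative_holo_curve[OF k])
      show "?\<gamma> (x $ j) \<in> V" using mem \<gamma>x by simp
      fix i
      show "((\<lambda>t. ?\<gamma> t $ i) has_field_derivative axis j (c j) $ i) (at (x $ j))"
      proof (cases "i = j")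
        case True
        have "((\<lambda>t. t * c j) has_field_derivative c j) (at (x $ j))" by (auto intro!: derivative_eq_intros)
        then show ?thesis using True j by (simp add: h_map_def c_def axis_def)
      next
        case False
        then have "(\<lambda>t. ?\<gamma> t $ i) = (\<lambda>t. ?h $ i)" by (auto simp: h_map_def fun_eq_iff)
        then show ?thesis using False by (simp add: axis_def)
      qed
    qed
    then have "cpartial j F x = cderiv k ?h (axis j (c j))"
      unfolding cpartial_def F_def \<gamma>x by (rule DERIV_imp_deriv)
    then have "x $ j * cpartial j F x = cderiv k ?h (x $ j *s axis j (c j))"
      by (simp add: holo_on_has_derivative(2)[OF k mem])
    also have "x $ j *s axis j (c j) = axis j (?h $ j)"
      using j by (simp add: vec_eq_iff axis_def h_map_def c_def)
    finally show ?thesis .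
  qed
  have ev: "euler_vec J \<alpha> ?h = (\<Sum>j\<in>J. of_real (\<alpha> j) *s axis j (?h $ j))"
    by (simp add: vec_eq_iff euler_vec_def axis_def if_distrib[of "(*) _"] sum.delta cong: if_cong)
  have "cderiv k ?h (euler_vec J \<alpha> ?h) = (\<Sum>j\<in>J. cderiv k ?h (of_real (\<alpha> j) *s axis j (?h $ j)))"
    unfolding ev by (rule linear_sum[OF lin])
  also have "\<dots> = (\<Sum>j\<in>J. of_real (\<alpha> j) * (x $ j * cpartial j F x))"
    by (intro sum.cong refl) (simp only: holo_on_has_derivative(2)[OF k mem] part)
  finally have "Dop J \<alpha> k ?h = of_real (1 + (\<Sum>j\<in>J. \<alpha> j)) * F x + (\<Sum>j\<in>J. of_real (\<alpha> j) * (x $ j * cpartial j F x))"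
    by (simp add: Dop_def F_def)
  then show ?thesis by (simp add: algebra_simps sum.distrib sum_distrib_left sum_distrib_right)
qed

theorem theorem1:
  fixes J :: "'n::finite set" and \<alpha> :: "'n \<Rightarrow> real" and \<Omega> :: "(complex ^ 'n) set"
  assumes "J \<noteq> {}"
    and "open \<Omega>" and "connected \<Omega>" and "\<Omega> \<noteq> {}"
    and "star_hartogs J \<Omega>"
    and "\<forall>j\<in>J. \<alpha> j > 0"
    and "ext_pt x w \<in> U_alpha J \<alpha> \<Omega>" and "ext_pt \<zeta> \<eta> \<in> U_alpha J \<alpha> \<Omega>"
  shows "bergman_kernel (U_alpha J \<alpha> \<Omega>) (ext_pt x w) (ext_pt \<zeta> \<eta>) =
    (let A = (\<Sum>j\<in>J. \<alpha> j);
         F = (\<lambda>y. bergman_kernel (U_alpha_eta J \<alpha> \<Omega> \<eta>) (h_map J \<alpha> y w \<eta>) \<zeta>)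
     in complex_of_real ((1 - (cmod \<eta>)\<^sup>2) powr A)
          / (complex_of_real pi * (1 - w * cnj \<eta>) powr complex_of_real (2 + A))
        * (F x + (\<Sum>j\<in>J. complex_of_real (\<alpha> j) * (F x + x $ j * cpartial j F x))))"
proof -
  have \<alpha>: "\<alpha> j > 0" if "j \<in> J" for j using assms(6) that by blast
  have \<eta>: "cmod \<eta> < 1" using assms(8) by (simp add: ext_pt_mem_U_alpha)
  have "\<zeta> \<in> U_alpha_eta J \<alpha> \<Omega> \<eta>" using assms(8) by (simp add: U_alpha_eta_def)
  then have k: "holo_on (\<lambda>y. bergman_kernel (U_alpha_eta J \<alpha> \<Omega> \<eta>) y \<zeta>) (U_alpha_eta J \<alpha> \<Omega> \<eta>)"
    by (intro A2_holo bergman_kernel_A2 open_U_alpha_eta assms(2))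
  note bergman_kernel_U_alpha[OF assms(2,5) \<alpha> assms(7,8)]
  also note Dop_h_map[OF k h_map_mem[OF assms(5) \<alpha> \<eta> assms(7)]]
  finally show ?thesis unfolding Let_def bergman_factor_def .
qed

end
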